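(* Let $\mathcal{L}$ be a representable conditional independence relation on $[4]=\{1,2,3,4\}$. Then the conditional independence ideal $I_{\mathcal{L}}\subseteq\mathbb{R}[\mathbf{r}]$ is a prime ideal except when $\mathcal{L}$ is equivalent to one of the four relations $$\mathcal{L}_{15}=\{14,\,14|23,\,23,\,23|14\},\qquad \mathcal{L}_{24}=\{12,\,23|14,\,24|3\},$$ $$\mathcal{L}_{28}=\{13|2,\,14,\,23|14,\,24|3\},\qquad \mathcal{L}_{37}=\{12|3,\,12|4,\,34|1,\,34|2\}.$$ That is, $I_{\mathcal{L}}$ is prime if and only if $\mathcal{L}$ is not equivalent to any of these four relations.
   Context: Let $[m]=\{1,\dots,m\}$ (here $m=4$) and let $PD_m$ be the set of real symmetric positive definite $m\times m$ matrices. A conditional independence (CI) couple over $[m]$, written $ij|C$ (or $ij$ if $C=\emptyset$), consists of a two-element set $ij=\{i,j\}\subseteq[m]$ and a set $C\subseteq[m]\setminus ij$; thus $ij|C=ji|C$, and e.g. $14|23$ means $\{1,4\}|\{2,3\}$. $\mathcal{R}(m)$ is the set of all CI couples over $[m]$, and a CI relation on $[m]$ is any subset $\mathcal{L}\subseteq\mathcal{R}(m)$. Concatenation of symbols denotes union of index sets (indices are identified with singletons), e.g. $iC=\{i\}\cup C$; for a matrix $M$, $M_{A,B}$ is the submatrix with rows $A$ and columns $B$ (for $M_{iC,jC}$ list $i$, resp. $j$, first and then $C$ in a fixed order). A relation $\mathcal{L}$ is representable if there exists $\Sigma\in PD_m$ such that, for every $ij|C\in\mathcal{R}(m)$, $\det(\Sigma_{iC,jC})=0$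 if and only if $ij|C\in\mathcal{L}$. Two relations on $[m]$ are equivalent if some permutation of the ground set $[m]$, applied to all indices, turns one into the other. Let $\mathbb{R}[\mathbf{r}]=\mathbb{R}[r_{ij}:1\le i<j\le m]$ and let $R=(r_{ij})$ be the symmetric $m\times m$ matrix with $r_{ii}=1$ and $r_{ji}=r_{ij}$. The conditional independence ideal of $\mathcal{L}$ is $I_{\mathcal{L}}=\langle\det(R_{iC,jC}):ij|C\in\mathcal{L}\rangle\subseteq\mathbb{R}[\mathbf{r}]$. *)

theory Defs
  imports
    "Jordan_Normal_Form.Determinant"
    "HOL-Algebra.Ideal"
    "HOL-Library.Poly_Mapping"
    "HOL-Combinatorics.Permutations"
begin

section \<open>Conditional independence relations\<close>

text \<open>The couple $ij|C$ is the pair of the two-element set $\{i,j\}$ and the set $C$.\<close>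

type_synonym ci_couple = "nat set \<times> nat set"

definition ci :: "nat \<Rightarrow> nat \<Rightarrow> nat set \<Rightarrow> ci_couple" where
  "ci i j C = ({i, j}, C)"

definition ci_couples :: "nat \<Rightarrow> ci_couple set" where
  "ci_couples m = {ci i j C | i j C. i \<in> {1..m} \<and> j \<in> {1..m} \<and> i \<noteq> j \<and> C \<subseteq> {1..m} - {i, j}}"

definition ci_relation :: "nat \<Rightarrow> ci_couple set \<Rightarrow> bool" where
  "ci_relation m L \<longleftrightarrow> L \<subseteq> ci_couples m"

definition ci_equivalent :: "nat \<Rightarrow> ci_couple set \<Rightarrow> ci_couple set \<Rightarrow> bool" where
  "ci_equivalent m L L' \<longleftrightarrow> (\<exists>\<pi>. \<pi> permutes {1..m} \<and> L' = (\<lambda>(E, C). (\<pi> ` E, \<pi> ` C)) ` L)"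


section \<open>Representability\<close>

text \<open>
  The ground set is $\{1,\dots,m\}$, whereas matrix entries are counted from $0$; hence the
  shift by one. Rows and columns are selected by lists of distinct indices, since the minors
  below list \<open>i\<close>, resp. \<open>j\<close>, first.
\<close>

definition submat :: "'a mat \<Rightarrow> nat list \<Rightarrow> nat list \<Rightarrow> 'a mat" where
  "submat M as bs = mat (length as) (length bs) (\<lambda>(k, l). M $$ (as ! k - 1, bs ! l - 1))"

definition ci_minor :: "'a :: comm_ring_1 mat \<Rightarrow> nat \<Rightarrow> nat \<Rightarrow> nat set \<Rightarrow> 'a" where
  "ci_minor M i j C = det (submat M (i # sorted_list_of_set C) (j # sorted_list_of_set C))"

definition PD :: "nat \<Rightarrow> real mat set" where
  "PD m = {A \<in> carrier_mat m m. transpose_mat A = A \<and>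
            (\<forall>v \<in> carrier_vec m. v \<noteq> 0\<^sub>v m \<longrightarrow> v \<bullet> (A *\<^sub>v v) > 0)}"

text \<open>
  Both orderings of each pair \<open>i\<close>, \<open>j\<close> are quantified over; for a symmetric matrix the two
  minors are determinants of mutually transposed matrices.
\<close>

definition representable :: "nat \<Rightarrow> ci_couple set \<Rightarrow> bool" where
  "representable m L \<longleftrightarrow> (\<exists>\<Sigma> \<in> PD m. \<forall>i j C.
     i \<in> {1..m} \<and> j \<in> {1..m} \<and> i \<noteq> j \<and> C \<subseteq> {1..m} - {i, j} \<longrightarrow>
     (ci_minor \<Sigma> i j C = 0 \<longleftrightarrow> ci i j C \<in> L))"


section \<open>The conditional independence ideal\<close>

text \<open>
  Polynomials are finitely supported maps from monomials to coefficients, and monomials are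
  finitely supported maps from indeterminates to exponents. The indeterminate $r_{ij}$ is named
  by the pair \<open>(i, j)\<close>. The type allows arbitrary pairs; the carrier of the ring below consists
  of the polynomials that involve only indeterminates $r_{ij}$ with $1 \le i < j \le m$.
\<close>

type_synonym corr_poly = "((nat \<times> nat) \<Rightarrow>\<^sub>0 nat) \<Rightarrow>\<^sub>0 real"

definition indets :: "corr_poly \<Rightarrow> (nat \<times> nat) set" where
  "indets p = (\<Union>t \<in> Poly_Mapping.keys p. Poly_Mapping.keys t)"

definition corr_ring :: "nat \<Rightarrow> corr_poly ring" where
  "corr_ring m =
     \<lparr>carrier = {p. indets p \<subseteq> {(i, j). 1 \<le> i \<and> i < j \<and> j \<le> m}},
      mult = (*), one = 1, zero = 0, add = (+)\<rparr>"

definition rvar :: "nat \<Rightarrow> nat \<Rightarrow> corr_poly" where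
  "rvar i j = Poly_Mapping.single (Poly_Mapping.single (i, j) 1) 1"

definition corr_mat :: "nat \<Rightarrow> corr_poly mat" where
  "corr_mat m = mat m m (\<lambda>(k, l). if k = l then 1 else rvar (min k l + 1) (max k l + 1))"

definition ci_ideal :: "nat \<Rightarrow> ci_couple set \<Rightarrow> corr_poly set" where
  "ci_ideal m L =
     Idl\<^bsub>corr_ring m\<^esub> {ci_minor (corr_mat m) i j C | i j C. i \<noteq> j \<and> ci i j C \<in> L}"

lemma indets_add: "indets (p + q) \<subseteq> indets p \<union> indets q"
  unfolding indets_def using keys_add[of p q] by blast

lemma indets_uminus: "indets (- p) = indets p"
  by (simp add: indets_def)

lemma indets_mult: "indets (p * q) \<subseteq> indets p \<union> indets q"
proof
  fix x assume "x \<in> indets (p * q)"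
  then obtain t where t: "t \<in> Poly_Mapping.keys (p * q)" "x \<in> Poly_Mapping.keys t"
    by (auto simp: indets_def)
  then obtain a b where ab: "t = a + b" "a \<in> Poly_Mapping.keys p" "b \<in> Poly_Mapping.keys q"
    using keys_mult[of p q] by blast
  then have "x \<in> Poly_Mapping.keys a \<union> Poly_Mapping.keys b"
    using t(2) keys_add[of a b] by blast
  then show "x \<in> indets p \<union> indets q"
    using ab by (auto simp: indets_def)
qed

lemma cring_corr_ring: "cring (corr_ring m)"
proof (rule cringI)
  show "abelian_group (corr_ring m)"
  proof (rule abelian_groupI)
    fix x assume x: "x \<in> carrier (corr_ring m)"
    have "- x \<in> carrier (corr_ring m)" "- x \<oplus>\<^bsub>corr_ring m\<^esub> x = \<zero>\<^bsub>corr_ring m\<^esub>"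
      using x by (simp_all add: corr_ring_def indets_uminus)
    then show "\<exists>y \<in> carrier (corr_ring m). y \<oplus>\<^bsub>corr_ring m\<^esub> x = \<zero>\<^bsub>corr_ring m\<^esub>"
      by blast
  next
    fix x y assume "x \<in> carrier (corr_ring m)" "y \<in> carrier (corr_ring m)"
    then show "x \<oplus>\<^bsub>corr_ring m\<^esub> y \<in> carrier (corr_ring m)"
      using indets_add[of x y] by (auto simp: corr_ring_def)
  qed (auto simp: corr_ring_def indets_def ac_simps)
  show "Group.comm_monoid (corr_ring m)"
  proof (rule comm_monoidI)
    fix x y assume "x \<in> carrier (corr_ring m)" "y \<in> carrier (corr_ring m)"
    then show "x \<otimes>\<^bsub>corr_ring m\<^esub> y \<in> carrier (corr_ring m)"
      using indets_mult[of x y] by (auto simp: corr_ring_def)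
  qed (auto simp: corr_ring_def indets_def ac_simps)
qed (simp add: corr_ring_def algebra_simps)

lemma rvar_in_carrier: "1 \<le> i \<Longrightarrow> i < j \<Longrightarrow> j \<le> m \<Longrightarrow> rvar i j \<in> carrier (corr_ring m)"
  by (simp add: rvar_def corr_ring_def indets_def)


section \<open>The four exceptional relations on four variables\<close>

definition L15 :: "ci_couple set" where
  "L15 = {ci 1 4 {}, ci 1 4 {2, 3}, ci 2 3 {}, ci 2 3 {1, 4}}"

definition L24 :: "ci_couple set" where
  "L24 = {ci 1 2 {}, ci 2 3 {1, 4}, ci 2 4 {3}}"

definition L28 :: "ci_couple set" where
  "L28 = {ci 1 3 {2}, ci 1 4 {}, ci 2 3 {1, 4}, ci 2 4 {3}}"

definition L37 :: "ci_couple set" where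
  "L37 = {ci 1 2 {3}, ci 1 2 {4}, ci 3 4 {1}, ci 3 4 {2}}"

end

theory Submission
  imports Defs "HOL-Library.Product_Lexorder"
begin

text \<open>
  Relabelling the four indices is an automorphism of the polynomial ring that permutes the minors,
  so only one relation of each equivalence class has to be examined.

  Which classes occur is a question about real matrices. After scaling to a unit diagonal, the
  vanishing minors of a positive definite matrix obey the gaussoid axioms and five further
  implications that depend on positivity (\<open>ci_axioms_vanishing\<close>). For every relabelling these are
  implications between the 24 couples, and propositional reasoning leaves 53 classes
  (\<open>classification\<close>).

  For 49 of the classes the ideal is prime because its equations can be solved one after the other.
  If \<open>x - p\<close> lies in the ideal, then \<open>x\<close> may be replaced by \<open>p\<close> (\<open>prime_by_substitution\<close>). In 28
  classes nothing is left after these substitutions. In most others the last equation is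
  \<open>s * x - p\<close>, linear in some indeterminate. Where \<open>s\<close> is inverted it defines the graph \<open>x = p/s\<close>,
  so its saturation by \<open>s\<close> is prime (\<open>prime_saturation_linear\<close>). The ideal agrees with its
  saturation if \<open>s\<close> is a nonzerodivisor modulo the ideal, and this holds if \<open>p\<close> is one modulo \<open>s\<close>
  (\<open>nzd_mod_swap\<close>). As \<open>s\<close> is a product of simple factors, each generating a prime ideal, it
  suffices that \<open>p\<close> does not vanish identically on the hypersurface of any factor; one real point on
  each shows that. In two classes the last equation is quadratic, and it is irreducible because its
  discriminant is negative at some real point (\<open>prime_quadratic\<close>). In two more, two equations linear
  in the same indeterminate remain, and eliminating it leads to such a quadratic
  (\<open>prime_two_linear_equations\<close>).

  For each of the four exceptions, the ideal contains a product of two polynomials, neither of which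
  vanishes on all real zeros of the ideal.
\<close>

section \<open>Substitution homomorphisms\<close>

lemma poly_mapping_sum_monomials:
  fixes f :: "'k \<Rightarrow>\<^sub>0 'b::comm_monoid_add"
  shows "f = (\<Sum>t\<in>Poly_Mapping.keys f. Poly_Mapping.single t (Poly_Mapping.lookup f t))"
  by (rule poly_mapping_eqI)
    (simp add: lookup_sum lookup_single when_def in_keys_iff)

definition monom_at :: "('k \<Rightarrow> 'a::comm_monoid_mult) \<Rightarrow> ('k \<Rightarrow>\<^sub>0 nat) \<Rightarrow> 'a" where
  "monom_at v t = (\<Prod>k\<in>Poly_Mapping.keys t. v k ^ Poly_Mapping.lookup t k)"

lemma monom_at_superset:
  assumes "finite S" "Poly_Mapping.keys t \<subseteq> S"
  shows "monom_at v t = (\<Prod>k\<in>S. v k ^ Poly_Mapping.lookup t k)"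
  unfolding monom_at_def
  by (rule prod.mono_neutral_left) (use assms in \<open>auto simp: in_keys_iff\<close>)

lemma monom_at_zero [simp]: "monom_at v 0 = 1"
  by (simp add: monom_at_def)

lemma monom_at_add: "monom_at v (t + u) = monom_at v t * monom_at v u"
proof -
  let ?S = "Poly_Mapping.keys t \<union> Poly_Mapping.keys u"
  have "monom_at v (t + u) = (\<Prod>k\<in>?S. v k ^ Poly_Mapping.lookup (t + u) k)"
    by (rule monom_at_superset) (simp_all add: keys_add)
  also have "\<dots> = monom_at v t * monom_at v u"
    by (simp add: monom_at_superset[of ?S] lookup_add power_add prod.distrib)
  finally show ?thesis .
qed

definition subst :: "(real \<Rightarrow> 'a::comm_ring_1) \<Rightarrow> (nat \<times> nat \<Rightarrow> 'a) \<Rightarrow> corr_poly \<Rightarrow> 'a" where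
  "subst c v f = (\<Sum>t\<in>Poly_Mapping.keys f. c (Poly_Mapping.lookup f t) * monom_at v t)"

text \<open>
  The map \<open>c\<close> says what becomes of the real coefficients. It is needed for three targets: the reals,
  the ring itself, and univariate polynomials over it.
\<close>

locale coeff_hom =
  fixes c :: "real \<Rightarrow> 'a::comm_ring_1"
  assumes hom_zero: "c 0 = 0"
    and hom_one: "c 1 = 1"
    and hom_add: "c (a + b) = c a + c b"
    and hom_mult: "c (a * b) = c a * c b"
begin

lemma subst_superset:
  assumes "finite S" "Poly_Mapping.keys f \<subseteq> S"
  shows "subst c v f = (\<Sum>t\<in>S. c (Poly_Mapping.lookup f t) * monom_at v t)"
  unfolding subst_def
  by (rule sum.mono_neutral_left) (use assms in \<open>auto simp: in_keys_iff hom_zero\<close>)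

lemma subst_zero [simp]: "subst c v 0 = 0"
  by (simp add: subst_def)

lemma subst_single: "subst c v (Poly_Mapping.single t a) = c a * monom_at v t"
  by (cases "a = 0") (simp_all add: subst_def hom_zero)

lemma subst_const [simp]: "subst c v (Poly_Mapping.single 0 a) = c a"
  by (simp add: subst_single)

lemma subst_one [simp]: "subst c v 1 = 1"
  using subst_const[of v 1] by (simp add: hom_one del: subst_const)

lemma subst_rvar [simp]: "subst c v (rvar i j) = v (i, j)"
  by (simp add: rvar_def subst_single hom_one monom_at_def)

lemma subst_add [simp]: "subst c v (f + g) = subst c v f + subst c v g"
proof -
  let ?S = "Poly_Mapping.keys f \<union> Poly_Mapping.keys g"
  have "subst c v (f + g) = (\<Sum>t\<in>?S. c (Poly_Mapping.lookup (f + g) t) * monom_at v t)"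
    by (rule subst_superset) (simp_all add: keys_add)
  also have "\<dots> = subst c v f + subst c v g"
    by (simp add: subst_superset[of ?S] lookup_add hom_add distrib_right sum.distrib)
  finally show ?thesis .
qed

lemma subst_uminus [simp]: "subst c v (- f) = - subst c v f"
  using subst_add[of v "- f" f] by (simp add: eq_neg_iff_add_eq_0)

lemma subst_diff [simp]: "subst c v (f - g) = subst c v f - subst c v g"
  using subst_add[of v f "- g"] by simp

lemma subst_sum: "subst c v (\<Sum>x\<in>X. f x) = (\<Sum>x\<in>X. subst c v (f x))"
  by (induction X rule: infinite_finite_induct) simp_all

lemma subst_mult [simp]: "subst c v (f * g) = subst c v f * subst c v g"
proof -
  let ?m = "\<lambda>h t. Poly_Mapping.single t (Poly_Mapping.lookup h t) :: corr_poly"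
  have "f * g = (\<Sum>t\<in>Poly_Mapping.keys f. ?m f t) * (\<Sum>u\<in>Poly_Mapping.keys g. ?m g u)"
    by (simp flip: poly_mapping_sum_monomials)
  then have "f * g = (\<Sum>t\<in>Poly_Mapping.keys f. \<Sum>u\<in>Poly_Mapping.keys g. ?m f t * ?m g u)"
    by (simp add: sum_product)
  then have "subst c v (f * g) = (\<Sum>t\<in>Poly_Mapping.keys f. \<Sum>u\<in>Poly_Mapping.keys g.
      (c (Poly_Mapping.lookup f t) * monom_at v t) * (c (Poly_Mapping.lookup g u) * monom_at v u))"
    by (simp add: subst_sum mult_single subst_single hom_mult monom_at_add mult_ac)
  then show ?thesis
    by (simp add: subst_def sum_product)
qed

lemma subst_power [simp]: "subst c v (f ^ n) = subst c v f ^ n"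
  by (induction n) simp_all

lemma subst_of_nat [simp]: "subst c v (of_nat n) = of_nat n"
  by (induction n) simp_all

lemma subst_numeral [simp]: "subst c v (numeral n) = numeral n"
  using subst_of_nat[of v "numeral n"] by simp

end

lemma monom_at_rvar: "monom_at (\<lambda>(i, j). rvar i j) t = Poly_Mapping.single t 1"
proof -
  have pow: "rvar i j ^ n = Poly_Mapping.single (Poly_Mapping.single (i, j) n) 1" for i j n
    by (induction n) (simp_all add: rvar_def mult_single flip: single_add)
  have "(\<Prod>k\<in>S. Poly_Mapping.single (e k) (1::real)) = Poly_Mapping.single (\<Sum>k\<in>S. e k) 1"
    for S and e :: "nat \<times> nat \<Rightarrow> ((nat \<times> nat) \<Rightarrow>\<^sub>0 nat)"
    by (induction S rule: infinite_finite_induct) (simp_all add: mult_single)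
  then show ?thesis
    using poly_mapping_sum_monomials[of t]
    by (simp add: monom_at_def split_def pow)
qed

text \<open>
  Constants and indeterminates generate the ring. This is how a composition of two substitutions is
  identified.
\<close>

lemma corr_poly_induct [case_names const var add mult]:
  assumes const: "\<And>a. P (Poly_Mapping.single 0 a)"
    and var: "\<And>i j. P (rvar i j)"
    and add: "\<And>f g. P f \<Longrightarrow> P g \<Longrightarrow> P (f + g)"
    and mult: "\<And>f g. P f \<Longrightarrow> P g \<Longrightarrow> P (f * g)"
  shows "P f"
proof -
  have zero: "P 0" and one: "P 1"
    using const[of 0] const[of 1] by simp_all
  have pow: "P (rvar i j ^ n)" for i j n
    by (induction n) (simp_all add: one var mult)
  have "P (\<Prod>k\<in>S. (\<lambda>(i, j). rvar i j) k ^ e k)" for S and e :: "nat \<times> nat \<Rightarrow> nat"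
    by (induction S rule: infinite_finite_induct) (auto simp: one pow mult)
  then have "P (Poly_Mapping.single t 1)" for t
    unfolding monom_at_rvar[symmetric] monom_at_def .
  then have "P (Poly_Mapping.single 0 a * Poly_Mapping.single t 1)" for a t
    by (rule mult[OF const])
  then have mon: "P (Poly_Mapping.single t a)" for a t
    by (simp add: mult_single)
  have "P (\<Sum>t\<in>T. Poly_Mapping.single t (Poly_Mapping.lookup f t))" for T
    by (induction T rule: infinite_finite_induct) (simp_all add: zero mon add)
  then show ?thesis
    by (subst poly_mapping_sum_monomials)
qed

interpretation real_coeffs: coeff_hom "\<lambda>a::real. a"
  by unfold_locales simp_all

interpretation const_coeffs: coeff_hom "Poly_Mapping.single 0 :: real \<Rightarrow> corr_poly"
  by unfold_locales (simp_all add: single_add mult_single)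

interpretation lifted_coeffs: coeff_hom "\<lambda>a. [:Poly_Mapping.single 0 a :: corr_poly:]"
  by unfold_locales (simp_all add: single_add mult_single one_pCons mult.commute)

abbreviation eval_at :: "(nat \<times> nat \<Rightarrow> real) \<Rightarrow> corr_poly \<Rightarrow> real" where
  "eval_at \<equiv> subst (\<lambda>a. a)"

abbreviation subst_vars :: "(nat \<times> nat \<Rightarrow> corr_poly) \<Rightarrow> corr_poly \<Rightarrow> corr_poly" where
  "subst_vars \<equiv> subst (Poly_Mapping.single 0)"

definition subst_var :: "nat \<times> nat \<Rightarrow> corr_poly \<Rightarrow> corr_poly \<Rightarrow> corr_poly" where
  "subst_var x p = subst_vars ((\<lambda>(i, j). rvar i j)(x := p))"

text \<open>
  The coefficients are taken in the whole ring, not in the subring of polynomials without \<open>x\<close>: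
  elimination works over every coefficient ring, and there is then no subring to carry along.
\<close>

definition as_poly_in :: "nat \<times> nat \<Rightarrow> corr_poly \<Rightarrow> corr_poly poly" where
  "as_poly_in x = subst (\<lambda>a. [:Poly_Mapping.single 0 a:]) ((\<lambda>(i, j). [:rvar i j:])(x := [:0, 1:]))"

lemma subst_var_simps [simp]:
  "subst_var x p 0 = 0" "subst_var x p 1 = 1" "subst_var x p (numeral n) = numeral n"
  "subst_var x p (f + g) = subst_var x p f + subst_var x p g"
  "subst_var x p (f - g) = subst_var x p f - subst_var x p g"
  "subst_var x p (- f) = - subst_var x p f"
  "subst_var x p (f * g) = subst_var x p f * subst_var x p g"
  "subst_var x p (f ^ k) = subst_var x p f ^ k"
  "subst_var x p (rvar i j) = (if x = (i, j) then p else rvar i j)"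
  by (simp_all add: subst_var_def)

lemma as_poly_in_simps [simp]:
  "as_poly_in x 0 = 0" "as_poly_in x 1 = 1" "as_poly_in x (numeral n) = [:numeral n:]"
  "as_poly_in x (f + g) = as_poly_in x f + as_poly_in x g"
  "as_poly_in x (f - g) = as_poly_in x f - as_poly_in x g"
  "as_poly_in x (- f) = - as_poly_in x f"
  "as_poly_in x (f * g) = as_poly_in x f * as_poly_in x g"
  "as_poly_in x (f ^ k) = as_poly_in x f ^ k"
  "as_poly_in x (rvar i j) = (if x = (i, j) then [:0, 1:] else [:rvar i j:])"
  by (simp_all add: as_poly_in_def numeral_poly)

lemma poly_as_poly_in: "poly (as_poly_in (i, j) f) (rvar i j) = f"
  by (induction f rule: corr_poly_induct) (auto simp: as_poly_in_def)

section \<open>Ideals\<close>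

text \<open>
  The ideals of a ring are its submodules when it acts on itself, which makes the theory of spans
  available.
\<close>

interpretation idl: Modules.module "(*) :: 'a::comm_ring_1 \<Rightarrow> 'a \<Rightarrow> 'a"
  by standard (auto simp: algebra_simps)

\<comment> \<open>Here this rule is associativity from right to left; it would loop against \<open>mult.assoc\<close>.\<close>
declare idl.scale_scale [simp del]

abbreviation ideal_of :: "'a::comm_ring_1 set \<Rightarrow> 'a set" where
  "ideal_of \<equiv> idl.span"

lemma ideal_of_mult_left: "a \<in> ideal_of G \<Longrightarrow> r * a \<in> ideal_of G"
  by (rule idl.span_scale)

lemma ideal_of_mult_right: "a \<in> ideal_of G \<Longrightarrow> a * r \<in> ideal_of G"
  using ideal_of_mult_left[of a G r] by (simp add: mult.commute)

lemma ideal_of_insert_iff: "a \<in> ideal_of (insert g G) \<longleftrightarrow> (\<exists>k. a - k * g \<in> ideal_of G)"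
  by (simp add: idl.span_insert)

lemma ideal_of_least:
  assumes "\<And>g. g \<in> G \<Longrightarrow> g \<in> ideal_of H" "a \<in> ideal_of G"
  shows "a \<in> ideal_of H"
proof -
  have "ideal_of G \<subseteq> ideal_of H"
    by (rule idl.span_minimal) (use assms(1) in \<open>auto intro: idl.subspace_span\<close>)
  with assms(2) show ?thesis by blast
qed

lemma ideal_of_mono: "a \<in> ideal_of G \<Longrightarrow> G \<subseteq> H \<Longrightarrow> a \<in> ideal_of H"
  using idl.span_mono[of G H] by blast

lemma ideal_of_eqI:
  assumes "\<And>g. g \<in> G \<Longrightarrow> g \<in> ideal_of H" "\<And>h. h \<in> H \<Longrightarrow> h \<in> ideal_of G"
  shows "ideal_of G = ideal_of H"
  using ideal_of_least assms by blast

lemma ideal_of_hom: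
  assumes "h 0 = 0" "\<And>a b. h (a + b) = h a + h b" "\<And>a b. h (a * b) = h a * h b"
    and "a \<in> ideal_of G"
  shows "h a \<in> ideal_of (h ` G)"
  using assms(4)
proof (induction rule: idl.span_induct_alt)
  case base
  show ?case by (simp add: assms(1) idl.span_zero)
next
  case (step c x y)
  then show ?case
    by (simp add: assms idl.span_add idl.span_base ideal_of_mult_left)
qed

lemma ideal_of_singleton: "a \<in> ideal_of {g} \<longleftrightarrow> g dvd a"
  by (auto simp: idl.span_singleton dvd_def mult.commute)

lemma eval_at_ideal_zero:
  assumes "a \<in> ideal_of G" "\<And>g. g \<in> G \<Longrightarrow> eval_at q g = 0"
  shows "eval_at q a = 0"
  using assms(1)
  by (induction rule: idl.span_induct_alt) (simp_all add: assms(2))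

definition prime_id :: "'a::comm_ring_1 set \<Rightarrow> bool" where
  "prime_id I \<longleftrightarrow> 1 \<notin> I \<and> (\<forall>a b. a * b \<in> I \<longrightarrow> a \<in> I \<or> b \<in> I)"

definition nzd_mod :: "'a::comm_ring_1 \<Rightarrow> 'a set \<Rightarrow> bool" where
  "nzd_mod s I \<longleftrightarrow> (\<forall>a. a * s \<in> I \<longrightarrow> a \<in> I)"

definition saturation :: "'a::comm_ring_1 set \<Rightarrow> 'a \<Rightarrow> 'a set" where
  "saturation I s = {a. \<exists>n. s ^ n * a \<in> I}"

lemma prime_idD: "prime_id I \<Longrightarrow> a * b \<in> I \<Longrightarrow> a \<in> I \<or> b \<in> I"
  unfolding prime_id_def by blast

lemma prime_id_power: "prime_id I \<Longrightarrow> s \<notin> I \<Longrightarrow> s ^ n * a \<in> I \<Longrightarrow> a \<in> I"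
proof (induction n)
  case (Suc n)
  have "s * (s ^ n * a) \<in> I" using Suc.prems(3) by (simp add: mult.assoc)
  then have "s ^ n * a \<in> I" using prime_idD[OF Suc.prems(1)] Suc.prems(2) by blast
  then show ?case by (rule Suc.IH[OF Suc.prems(1,2)])
qed simp

lemma prime_id_zero: "prime_id (ideal_of {} :: 'a::idom set)"
  by (auto simp: prime_id_def)

lemma nzd_mod_prime: "prime_id I \<Longrightarrow> s \<notin> I \<Longrightarrow> nzd_mod s I"
  unfolding nzd_mod_def using prime_idD by blast

lemma nzd_mod_zero_ideal: "s \<noteq> 0 \<Longrightarrow> nzd_mod (s::'a::idom) (ideal_of {})"
  by (simp add: nzd_mod_def)

lemma nzd_mod_power: "nzd_mod s I \<Longrightarrow> s ^ n * a \<in> I \<Longrightarrow> a \<in> I"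
proof (induction n)
  case (Suc n)
  have "(s ^ n * a) * s \<in> I" using Suc.prems(2) by (simp add: mult_ac)
  then have "s ^ n * a \<in> I" using Suc.prems(1) unfolding nzd_mod_def by blast
  then show ?case by (rule Suc.IH[OF Suc.prems(1)])
qed simp

text \<open>
  A regular sequence may be reordered: if \<open>a * b = k * f\<close> modulo \<open>J\<close>, then \<open>k\<close> lies in the ideal of
  \<open>b\<close> and \<open>J\<close>, say \<open>k = l * b\<close>, and \<open>b\<close> can be cancelled from \<open>(a - l * f) * b = 0\<close>.
\<close>

lemma nzd_mod_swap:
  assumes b: "nzd_mod b (ideal_of J)" and f: "nzd_mod f (ideal_of (insert b J))"
  shows "nzd_mod b (ideal_of (insert f J))"
  unfolding nzd_mod_def
proof (intro allI impI)
  fix a assume "a * b \<in> ideal_of (insert f J)"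
  then obtain k where k: "a * b - k * f \<in> ideal_of J"
    by (auto simp: ideal_of_insert_iff)
  have "k * f - a * b \<in> ideal_of J"
    using idl.span_neg[OF k] by simp
  then have "k * f \<in> ideal_of (insert b J)"
    by (auto simp: ideal_of_insert_iff)
  then have "k \<in> ideal_of (insert b J)"
    using f by (simp add: nzd_mod_def)
  then obtain l where l: "k - l * b \<in> ideal_of J"
    by (auto simp: ideal_of_insert_iff)
  have "(a - l * f) * b = (a * b - k * f) + (k - l * b) * f"
    by (simp add: algebra_simps)
  also have "\<dots> \<in> ideal_of J"
    using k l by (intro idl.span_add ideal_of_mult_right)
  finally have "a - l * f \<in> ideal_of J"
    using b by (simp add: nzd_mod_def)
  then show "a \<in> ideal_of (insert f J)"
    by (auto simp: ideal_of_insert_iff)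
qed

text \<open>
  From \<open>a * p \<in> (s * t)\<close> one gets \<open>a = k * s\<close> by the assumption on \<open>s\<close>; cancelling \<open>s\<close> leaves
  \<open>k * p \<in> (t)\<close>, so \<open>t\<close> divides \<open>k\<close>; everything is read modulo \<open>J\<close>.
\<close>

lemma nzd_mod_product_ideal:
  assumes s: "nzd_mod p (ideal_of (insert s J))" and t: "nzd_mod p (ideal_of (insert t J))"
    and sJ: "nzd_mod s (ideal_of J)"
  shows "nzd_mod p (ideal_of (insert (s * t) J))"
  unfolding nzd_mod_def
proof (intro allI impI)
  fix a assume "a * p \<in> ideal_of (insert (s * t) J)"
  then obtain l where l: "a * p - l * (s * t) \<in> ideal_of J"
    by (auto simp: ideal_of_insert_iff)
  then have "a * p - (l * t) * s \<in> ideal_of J"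
    by (simp add: mult_ac)
  then have "a * p \<in> ideal_of (insert s J)"
    unfolding ideal_of_insert_iff by blast
  then have "a \<in> ideal_of (insert s J)"
    using s by (simp add: nzd_mod_def)
  then obtain k where k: "a - k * s \<in> ideal_of J"
    by (auto simp: ideal_of_insert_iff)
  have "(k * p - l * t) * s = (a * p - l * (s * t)) - (a - k * s) * p"
    by (simp add: algebra_simps)
  also have "\<dots> \<in> ideal_of J"
    by (rule idl.span_diff[OF l ideal_of_mult_right[OF k]])
  finally have "k * p - l * t \<in> ideal_of J"
    using sJ by (simp add: nzd_mod_def)
  then have "k * p \<in> ideal_of (insert t J)"
    unfolding ideal_of_insert_iff by blast
  then have "k \<in> ideal_of (insert t J)"
    using t by (simp add: nzd_mod_def)
  then obtain m where m: "k - m * t \<in> ideal_of J"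
    by (auto simp: ideal_of_insert_iff)
  have "a - m * (s * t) = (a - k * s) + (k - m * t) * s"
    by (simp add: algebra_simps)
  also have "\<dots> \<in> ideal_of J"
    using k m by (intro idl.span_add ideal_of_mult_right)
  finally show "a \<in> ideal_of (insert (s * t) J)"
    unfolding ideal_of_insert_iff by blast
qed

text \<open>
  The ideals of \<open>G\<close> and \<open>H\<close> agree once \<open>s\<close> is inverted, and inverting \<open>s\<close> loses nothing on the side
  of \<open>G\<close>.
\<close>

lemma prime_of_saturation:
  assumes prime: "prime_id (saturation (ideal_of H) s)"
    and HG: "\<And>h. h \<in> H \<Longrightarrow> h \<in> ideal_of G"
    and GH: "\<And>g. g \<in> G \<Longrightarrow> g \<in> saturation (ideal_of H) s"
    and nzd: "nzd_mod s (ideal_of G)"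
  shows "prime_id (ideal_of G)"
proof -
  have "a \<in> ideal_of G" if a: "a \<in> saturation (ideal_of H) s" for a
  proof -
    obtain n where "s ^ n * a \<in> ideal_of H"
      using a by (auto simp: saturation_def)
    then show ?thesis
      using ideal_of_least[OF HG] nzd_mod_power[OF nzd] by blast
  qed
  moreover have "a \<in> saturation (ideal_of H) s" if "a \<in> ideal_of G" for a
    using that
  proof (induction rule: idl.span_induct_alt)
    case base
    show ?case by (auto simp: saturation_def idl.span_zero)
  next
    case (step c x y)
    obtain m n where "s ^ m * x \<in> ideal_of H" "s ^ n * y \<in> ideal_of H"
      using GH[OF step(1)] step(2) by (auto simp: saturation_def)
    then have "(s ^ n * c) * (s ^ m * x) + s ^ m * (s ^ n * y) \<in> ideal_of H"
      by (blast intro: idl.span_add ideal_of_mult_left)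
    also have "(s ^ n * c) * (s ^ m * x) + s ^ m * (s ^ n * y) = s ^ (m + n) * (c * x + y)"
      by (simp add: algebra_simps power_add)
    finally show ?case by (auto simp: saturation_def)
  qed
  ultimately have "ideal_of G = saturation (ideal_of H) s" by blast
  with prime show ?thesis by simp
qed

section \<open>Elimination of a variable\<close>

text \<open>
  Evaluation at \<open>p/s\<close> with denominators cleared: for \<open>n\<close> at least the degree of \<open>F\<close> this is
  \<open>s ^ n * F(p/s)\<close>.
\<close>

definition heval :: "'a::comm_ring_1 \<Rightarrow> 'a \<Rightarrow> nat \<Rightarrow> 'a poly \<Rightarrow> 'a" where
  "heval s p n F = (\<Sum>i\<le>n. coeff F i * p ^ i * s ^ (n - i))"

lemma heval_add: "heval s p n (F + G) = heval s p n F + heval s p n G"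
  by (simp add: heval_def algebra_simps sum.distrib)

lemma heval_linear_multiple:
  assumes "degree k < n"
  shows "heval s p n (k * [:- p, s:]) = 0"
proof -
  obtain m where n: "n = Suc m" using assms by (cases n) auto
  have kn: "coeff k n = 0" using assms by (simp add: coeff_eq_0)
  have "heval s p n (k * [:- p, s:])
      = (\<Sum>i\<le>n. (case i of 0 \<Rightarrow> 0 | Suc j \<Rightarrow> coeff k j * s * p ^ i * s ^ (n - i)))
        - (\<Sum>i\<le>n. coeff k i * p ^ Suc i * s ^ (n - i))"
    unfolding heval_def sum_subtractf[symmetric]
    by (intro sum.cong) (auto simp: algebra_simps coeff_pCons split: nat.split)
  also have "(\<Sum>i\<le>n. (case i of 0 \<Rightarrow> 0 | Suc j \<Rightarrow> coeff k j * s * p ^ i * s ^ (n - i)))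
      = (\<Sum>j\<le>m. coeff k j * s * p ^ Suc j * s ^ (m - j))"
    unfolding n sum.atMost_Suc_shift by simp
  also have "(\<Sum>i\<le>n. coeff k i * p ^ Suc i * s ^ (n - i)) = (\<Sum>j\<le>m. coeff k j * p ^ Suc j * s ^ (n - j))"
    using kn unfolding n sum.atMost_Suc by simp
  also have "\<dots> = (\<Sum>j\<le>m. coeff k j * s * p ^ Suc j * s ^ (m - j))"
    unfolding n by (intro sum.cong) (auto simp: Suc_diff_le mult_ac)
  finally show ?thesis by (simp only: diff_self)
qed

lemma coeff_ideal_const:
  assumes "F \<in> ideal_of ((\<lambda>a. [:a:]) ` J)"
  shows "coeff F i \<in> ideal_of J"
  using assms
proof (induction arbitrary: i rule: idl.span_induct_alt)
  case base
  show ?case by (simp add: idl.span_zero)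
next
  case (step c x y)
  then obtain a where "x = [:a:]" "a \<in> J" by auto
  then show ?case
    using step by (simp add: idl.span_add idl.span_base ideal_of_mult_left mult.commute[of a])
qed

lemma heval_in_ideal:
  assumes "F \<in> ideal_of (insert [:- p, s:] ((\<lambda>a. [:a:]) ` J))"
  shows "\<exists>N. \<forall>n\<ge>N. heval s p n F \<in> ideal_of J"
proof -
  obtain k where k: "F - k * [:- p, s:] \<in> ideal_of ((\<lambda>a. [:a:]) ` J)"
    using assms by (auto simp: ideal_of_insert_iff)
  have "heval s p n F \<in> ideal_of J" if "n > degree k" for n
  proof -
    have "heval s p n F = heval s p n (F - k * [:- p, s:]) + heval s p n (k * [:- p, s:])"
      by (simp flip: heval_add)
    also have "\<dots> = heval s p n (F - k * [:- p, s:])"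
      by (simp only: heval_linear_multiple[OF that] add_0_right)
    also have "\<dots> \<in> ideal_of J"
      unfolding heval_def
      by (intro idl.span_sum ideal_of_mult_right coeff_ideal_const[OF k])
    finally show ?thesis .
  qed
  then show ?thesis by (intro exI[of _ "Suc (degree k)"]) auto
qed

text \<open>
  Division with remainder by \<open>s * X - p\<close>, after multiplication by a power of the leading
  coefficient.
\<close>

lemma linear_pseudo_division:
  "\<exists>n c. [:s ^ n:] * F - [:c:] \<in> ideal_of {[:- p, s:]}"
proof (induction F)
  case 0
  show ?case by (intro exI[of _ 0]) (simp add: idl.span_zero)
next
  case (pCons a F)
  then obtain n c where IH: "[:s ^ n:] * F - [:c:] \<in> ideal_of {[:- p, s:]}" by blast
  have "[:s ^ Suc n:] * pCons a F - [:s ^ Suc n * a + p * c:]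
      = [:0, s:] * ([:s ^ n:] * F - [:c:]) + [:c:] * [:- p, s:]"
    by (simp add: algebra_simps)
  also have "\<dots> \<in> ideal_of {[:- p, s:]}"
    using IH by (intro idl.span_add ideal_of_mult_left) (simp_all add: idl.span_base)
  finally show ?case by blast
qed

lemma heval_const: "heval s p n [:a:] = s ^ n * a"
proof -
  have "heval s p n [:a:] = (\<Sum>i\<le>n. if i = 0 then s ^ n * a else 0)"
    unfolding heval_def by (intro sum.cong) (auto simp: coeff_pCons mult_ac split: nat.split)
  then show ?thesis by (simp add: sum.delta)
qed

lemma const_pow: "[:a:] ^ n = [:a ^ n:]"
  by (induction n) (simp_all add: one_pCons mult_ac)

text \<open>
  Modulo the ideal, and up to powers of \<open>s\<close>, every polynomial is a constant. A constant that lies in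
  the saturation already lies in \<open>J\<close>, as evaluation at \<open>p/s\<close> shows. So primality is inherited
  from \<open>J\<close>.
\<close>

lemma prime_saturation_linear_poly:
  fixes s p :: "'a::comm_ring_1"
  assumes J: "prime_id (ideal_of J)" and s: "s \<notin> ideal_of J"
  defines "I \<equiv> ideal_of (insert [:- p, s:] ((\<lambda>a. [:a:]) ` J))"
  shows "prime_id (saturation I [:s:])"
proof -
  have const: "c \<in> ideal_of J" if c: "[:s:] ^ n * [:c:] \<in> I" for c n
  proof -
    obtain N where "heval s p N ([:s:] ^ n * [:c:]) \<in> ideal_of J"
      using heval_in_ideal c unfolding I_def by blast
    moreover have "heval s p N ([:s:] ^ n * [:c:]) = s ^ (N + n) * c"
      by (simp add: const_pow heval_const power_add mult.assoc)
    ultimately show ?thesis using prime_id_power[OF J s] by simp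
  qed
  have lin: "x \<in> I" if "x \<in> ideal_of {[:- p, s:]}" for x
    using that unfolding I_def by (rule ideal_of_mono) auto
  have J_I: "[:c:] \<in> I" if "c \<in> ideal_of J" for c
  proof -
    have "[:c:] \<in> ideal_of ((\<lambda>a. [:a:]) ` J)"
      by (rule ideal_of_hom) (use that in simp_all)
    then show ?thesis unfolding I_def by (rule ideal_of_mono) auto
  qed
  have sat: "F \<in> saturation I [:s:]" if "[:s:] ^ n * F - [:c:] \<in> I" "c \<in> ideal_of J" for F n c
  proof -
    have "([:s:] ^ n * F - [:c:]) + [:c:] \<in> I"
      using that J_I[OF that(2)] unfolding I_def by (blast intro: idl.span_add)
    then show ?thesis by (auto simp: saturation_def)
  qed
  show ?thesis
    unfolding prime_id_def
  proof (intro conjI allI impI notI)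
    assume "1 \<in> saturation I [:s:]"
    then obtain n where "[:s:] ^ n * [:1:] \<in> I"
      by (auto simp: saturation_def one_pCons)
    then have "1 \<in> ideal_of J" by (rule const)
    with J show False by (simp add: prime_id_def)
  next
    fix F G assume "F * G \<in> saturation I [:s:]"
    then obtain m where FG: "[:s:] ^ m * (F * G) \<in> I" by (auto simp: saturation_def)
    obtain n c where F: "[:s:] ^ n * F - [:c:] \<in> I"
      using linear_pseudo_division[of s F p] lin by (auto simp: const_pow)
    obtain k d where G: "[:s:] ^ k * G - [:d:] \<in> I"
      using linear_pseudo_division[of s G p] lin by (auto simp: const_pow)
    have id: "x * (c' * d') = (y * z) * (x * (F * G)) - (y * F - c') * (x * z * G) - (z * G - d') * (x * c')"
      for x y z c' d' :: "'a poly"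
      by (simp add: algebra_simps)
    have "[:s:] ^ m * [:c * d:] = [:s:] ^ m * ([:c:] * [:d:])" by (simp add: mult.commute)
    also have "\<dots> = [:s:] ^ (n + k) * ([:s:] ^ m * (F * G))
        - ([:s:] ^ n * F - [:c:]) * ([:s:] ^ m * [:s:] ^ k * G)
        - ([:s:] ^ k * G - [:d:]) * ([:s:] ^ m * [:c:])"
      unfolding power_add by (rule id)
    also have "\<dots> \<in> I"
      unfolding I_def
      by (rule idl.span_diff[OF idl.span_diff[OF ideal_of_mult_left[OF FG[unfolded I_def]]
            ideal_of_mult_right[OF F[unfolded I_def]]] ideal_of_mult_right[OF G[unfolded I_def]]])
    finally have "c * d \<in> ideal_of J" by (rule const)
    then have "c \<in> ideal_of J \<or> d \<in> ideal_of J" by (rule prime_idD[OF J])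
    then show "F \<in> saturation I [:s:] \<or> G \<in> saturation I [:s:]"
      using sat F G by blast
  qed
qed

text \<open>
  Reading a polynomial in the indeterminate \<open>x\<close>, and evaluating at \<open>x\<close> again, exchange the two
  saturations; so one is the preimage of the other.
\<close>

lemma prime_saturation_transfer:
  assumes prime: "prime_id (saturation (ideal_of K) [:s:])"
    and HK: "\<And>h. h \<in> H \<Longrightarrow> as_poly_in (i, j) h \<in> K"
    and KH: "\<And>k. k \<in> K \<Longrightarrow> poly k (rvar i j) \<in> H"
    and s: "as_poly_in (i, j) s = [:s:]"
  shows "prime_id (saturation (ideal_of H) s)"
proof -
  have "a \<in> saturation (ideal_of H) s
      \<longleftrightarrow> as_poly_in (i, j) a \<in> saturation (ideal_of K) [:s:]" for a
  proof
    assume "a \<in> saturation (ideal_of H) s"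
    then obtain n where n: "s ^ n * a \<in> ideal_of H" by (auto simp: saturation_def)
    have "as_poly_in (i, j) (s ^ n * a) \<in> ideal_of (as_poly_in (i, j) ` H)"
      by (rule ideal_of_hom[OF _ _ _ n]) simp_all
    then have "as_poly_in (i, j) (s ^ n * a) \<in> ideal_of K"
      by (rule ideal_of_mono) (use HK in auto)
    then show "as_poly_in (i, j) a \<in> saturation (ideal_of K) [:s:]"
      by (auto simp: saturation_def s)
  next
    assume "as_poly_in (i, j) a \<in> saturation (ideal_of K) [:s:]"
    then obtain n where n: "[:s:] ^ n * as_poly_in (i, j) a \<in> ideal_of K"
      by (auto simp: saturation_def)
    have "poly ([:s:] ^ n * as_poly_in (i, j) a) (rvar i j) \<in> ideal_of ((\<lambda>k. poly k (rvar i j)) ` K)"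
      by (rule ideal_of_hom[OF _ _ _ n]) simp_all
    then have "poly ([:s:] ^ n * as_poly_in (i, j) a) (rvar i j) \<in> ideal_of H"
      by (rule ideal_of_mono) (use KH in auto)
    then show "a \<in> saturation (ideal_of H) s"
      by (auto simp: saturation_def poly_as_poly_in)
  qed
  then show ?thesis
    using prime unfolding prime_id_def
    by (simp only: as_poly_in_simps) blast
qed

lemma prime_saturation_linear:
  assumes J: "prime_id (ideal_of J)" and sJ: "s \<notin> ideal_of J"
    and free: "\<And>g. g \<in> J \<Longrightarrow> as_poly_in (i, j) g = [:g:]"
      "as_poly_in (i, j) s = [:s:]" "as_poly_in (i, j) p = [:p:]"
  shows "prime_id (saturation (ideal_of (insert (s * rvar i j - p) J)) s)"
  by (rule prime_saturation_transfer[OF prime_saturation_linear_poly[OF J sJ, of p], where i = i and j = j])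
    (auto simp: free mult.commute)

section \<open>Quadratic equations\<close>

lemma quadratic_pseudo_division:
  "\<exists>n u v. [:\<alpha> ^ n:] * F - [:v, u:] \<in> ideal_of {[:\<gamma>, \<beta>, \<alpha>:]}"
proof (induction F)
  case 0
  show ?case by (intro exI[of _ 0]) (simp add: idl.span_zero)
next
  case (pCons a F)
  then obtain n u v where IH: "[:\<alpha> ^ n:] * F - [:v, u:] \<in> ideal_of {[:\<gamma>, \<beta>, \<alpha>:]}" by blast
  have "[:\<alpha> ^ Suc n:] * pCons a F - [:\<alpha> ^ Suc n * a - \<gamma> * u, \<alpha> * v - \<beta> * u:]
      = [:0, \<alpha>:] * ([:\<alpha> ^ n:] * F - [:v, u:]) + [:u:] * [:\<gamma>, \<beta>, \<alpha>:]"
    by (simp add: algebra_simps)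
  also have "\<dots> \<in> ideal_of {[:\<gamma>, \<beta>, \<alpha>:]}"
    using IH by (intro idl.span_add ideal_of_mult_left) (simp_all add: idl.span_base)
  finally show ?case by blast
qed

text \<open>
  If the quadratic divides a nonzero product of two linear polynomials, the quotient is a constant by
  degrees, and a root of the first factor is a root of the quadratic.
\<close>

lemma quadratic_dvd_product_of_linear:
  fixes \<alpha> \<beta> \<gamma> :: "'a::idom"
  assumes irred: "\<And>u v. \<alpha> * u\<^sup>2 + \<beta> * u * v + \<gamma> * v\<^sup>2 = 0 \<Longrightarrow> v = 0"
    and \<alpha>: "\<alpha> \<noteq> 0"
    and dvd: "[:\<gamma>, \<beta>, \<alpha>:] dvd [:c:] * ([:v, u:] * [:v', u':])" and c: "c \<noteq> 0"
  shows "[:v, u:] = 0 \<or> [:v', u':] = 0"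
proof -
  obtain w where w: "[:c:] * ([:v, u:] * [:v', u':]) = [:\<gamma>, \<beta>, \<alpha>:] * w"
    using dvd by (auto simp: dvd_def)
  have "w = 0"
  proof (rule ccontr)
    assume "w \<noteq> 0"
    then have "degree ([:\<gamma>, \<beta>, \<alpha>:] * w) = 2 + degree w"
      using \<alpha> by (subst degree_mult_eq) auto
    moreover have "degree ([:c:] * ([:v, u:] * [:v', u':])) \<le> 0 + (1 + 1)"
      by (intro order.trans[OF degree_mult_le] add_mono) auto
    ultimately have "degree w = 0" unfolding w by linarith
    then obtain d where d: "w = [:d:]" by (rule degree_eq_zeroE)
    with \<open>w \<noteq> 0\<close> have d0: "d \<noteq> 0" by simp
    have eqs: "c * (v * v') = \<gamma> * d" "c * (v * u' + u * v') = \<beta> * d" "c * (u * u') = \<alpha> * d"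
      using w unfolding d by (simp_all add: algebra_simps)
    have "d * (\<alpha> * v\<^sup>2 + \<beta> * v * (- u) + \<gamma> * (- u)\<^sup>2)
        = (\<alpha> * d) * v\<^sup>2 - (\<beta> * d) * (u * v) + (\<gamma> * d) * u\<^sup>2"
      by (simp add: algebra_simps)
    also have "\<dots> = 0"
      unfolding eqs[symmetric] by (simp add: algebra_simps power2_eq_square)
    finally have "\<alpha> * v\<^sup>2 + \<beta> * v * (- u) + \<gamma> * (- u)\<^sup>2 = 0"
      using d0 by simp
    then have "- u = 0" by (rule irred)
    then have "\<alpha> * d = 0" using eqs(3) by simp
    with \<alpha> d0 show False by simp
  qed
  then have "[:v, u:] * [:v', u':] = 0"
    using w c by auto
  then show ?thesis by (simp only: mult_eq_0_iff)
qed

lemma prime_saturation_quadratic_poly: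
  fixes \<alpha> \<beta> \<gamma> :: "'a::idom"
  assumes irred: "\<And>u v. \<alpha> * u\<^sup>2 + \<beta> * u * v + \<gamma> * v\<^sup>2 = 0 \<Longrightarrow> v = 0"
    and \<alpha>: "\<alpha> \<noteq> 0"
  defines "I \<equiv> ideal_of {[:\<gamma>, \<beta>, \<alpha>:]}"
  shows "prime_id (saturation I [:\<alpha>:])"
  unfolding prime_id_def
proof (intro conjI allI impI notI)
  assume "1 \<in> saturation I [:\<alpha>:]"
  then obtain n where "[:\<gamma>, \<beta>, \<alpha>:] dvd [:\<alpha> ^ n:]"
    by (auto simp: saturation_def I_def ideal_of_singleton const_pow)
  then have "[:\<gamma>, \<beta>, \<alpha>:] dvd [:\<alpha> ^ n:] * ([:1, 0:] * [:1, 0:])"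
    by simp
  from quadratic_dvd_product_of_linear[OF irred \<alpha> this] \<alpha> show False by simp
next
  fix F G assume "F * G \<in> saturation I [:\<alpha>:]"
  then obtain m where FG: "[:\<alpha>:] ^ m * (F * G) \<in> I" by (auto simp: saturation_def)
  obtain n u v where F: "[:\<alpha>:] ^ n * F - [:v, u:] \<in> I"
    using quadratic_pseudo_division[of \<alpha> F \<gamma> \<beta>] by (auto simp: I_def const_pow)
  obtain k u' v' where G: "[:\<alpha>:] ^ k * G - [:v', u':] \<in> I"
    using quadratic_pseudo_division[of \<alpha> G \<gamma> \<beta>] by (auto simp: I_def const_pow)
  have id: "x * (c' * d') = (y * z) * (x * (F * G)) - (y * F - c') * (x * z * G) - (z * G - d') * (x * c')"
    for x y z c' d' :: "'a poly"
    by (simp add: algebra_simps)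
  have "[:\<alpha>:] ^ m * ([:v, u:] * [:v', u':]) = [:\<alpha>:] ^ (n + k) * ([:\<alpha>:] ^ m * (F * G))
      - ([:\<alpha>:] ^ n * F - [:v, u:]) * ([:\<alpha>:] ^ m * [:\<alpha>:] ^ k * G)
      - ([:\<alpha>:] ^ k * G - [:v', u':]) * ([:\<alpha>:] ^ m * [:v, u:])"
    unfolding power_add by (rule id)
  also have "\<dots> \<in> I"
    unfolding I_def
    by (rule idl.span_diff[OF idl.span_diff[OF ideal_of_mult_left[OF FG[unfolded I_def]]
          ideal_of_mult_right[OF F[unfolded I_def]]] ideal_of_mult_right[OF G[unfolded I_def]]])
  finally have dvd: "[:\<gamma>, \<beta>, \<alpha>:] dvd [:\<alpha> ^ m:] * ([:v, u:] * [:v', u':])"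
    by (simp only: I_def ideal_of_singleton const_pow)
  have "\<alpha> ^ m \<noteq> 0" using \<alpha> by simp
  with irred \<alpha> dvd have "[:v, u:] = 0 \<or> [:v', u':] = 0"
    by (rule quadratic_dvd_product_of_linear)
  then show "F \<in> saturation I [:\<alpha>:] \<or> G \<in> saturation I [:\<alpha>:]"
    using F G unfolding saturation_def by (metis (mono_tags, lifting) diff_zero mem_Collect_eq)
qed

lemma prime_saturation_quadratic:
  assumes irred: "\<And>u v. \<alpha> * u\<^sup>2 + \<beta> * u * v + \<gamma> * v\<^sup>2 = 0 \<Longrightarrow> v = 0"
    and \<alpha>: "\<alpha> \<noteq> 0"
    and free: "as_poly_in (i, j) \<alpha> = [:\<alpha>:]" "as_poly_in (i, j) \<beta> = [:\<beta>:]" "as_poly_in (i, j) \<gamma> = [:\<gamma>:]"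
  shows "prime_id (saturation (ideal_of {\<alpha> * (rvar i j)\<^sup>2 + \<beta> * rvar i j + \<gamma>}) \<alpha>)"
proof (rule prime_saturation_transfer)
  show "prime_id (saturation (ideal_of {[:\<gamma>, \<beta>, \<alpha>:]}) [:\<alpha>:])"
    using irred \<alpha> by (rule prime_saturation_quadratic_poly)
qed (auto simp: free algebra_simps power2_eq_square)

section \<open>Polynomials free of an indeterminate\<close>

definition free_of :: "nat \<times> nat \<Rightarrow> corr_poly \<Rightarrow> bool" where
  "free_of x f \<longleftrightarrow> as_poly_in x f = [:f:]"

lemma free_of_simps [simp]:
  "free_of x 0" "free_of x 1" "free_of x (numeral n)"
  "free_of x f \<Longrightarrow> free_of x g \<Longrightarrow> free_of x (f + g)"
  "free_of x f \<Longrightarrow> free_of x g \<Longrightarrow> free_of x (f - g)"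
  "free_of x f \<Longrightarrow> free_of x (- f)"
  "free_of x f \<Longrightarrow> free_of x g \<Longrightarrow> free_of x (f * g)"
  "free_of x f \<Longrightarrow> free_of x (f ^ k)"
  "x \<noteq> (i, j) \<Longrightarrow> free_of x (rvar i j)"
  by (simp_all add: free_of_def one_pCons const_pow mult.commute)

lemma not_in_ideal_of:
  assumes "\<And>g. g \<in> G \<Longrightarrow> eval_at q g = 0" "eval_at q a \<noteq> 0"
  shows "a \<notin> ideal_of G"
  using eval_at_ideal_zero[of a G q] assms by blast

section \<open>Negative discriminants\<close>

text \<open>
  Leading terms are multiplicative; this is the version for the smallest monomial.
\<close>

lemma lowest_term_mult:
  fixes f g :: "'k::{ordered_cancel_comm_monoid_add, linorder} \<Rightarrow>\<^sub>0 real"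
  assumes m: "\<forall>k\<in>Poly_Mapping.keys f. m \<le> k" and n: "\<forall>k\<in>Poly_Mapping.keys g. n \<le> k"
  shows "Poly_Mapping.lookup (f * g) (m + n) = Poly_Mapping.lookup f m * Poly_Mapping.lookup g n"
    and "\<forall>k\<in>Poly_Mapping.keys (f * g). m + n \<le> k"
proof -
  show "\<forall>k\<in>Poly_Mapping.keys (f * g). m + n \<le> k"
  proof
    fix k assume k: "k \<in> Poly_Mapping.keys (f * g)"
    obtain a b where "k = a + b" "a \<in> Poly_Mapping.keys f" "b \<in> Poly_Mapping.keys g"
      using k keys_mult[of f g] by blast
    then show "m + n \<le> k" using m n by (simp add: add_mono)
  qed
  define f' where "f' = f - Poly_Mapping.single m (Poly_Mapping.lookup f m)"
  define g' where "g' = g - Poly_Mapping.single n (Poly_Mapping.lookup g n)"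
  have f': "m < k" if "k \<in> Poly_Mapping.keys f'" for k
    using that m by (cases "k = m") (auto simp: f'_def in_keys_iff lookup_minus lookup_single Ball_def order.strict_iff_order)
  have g': "n < k" if "k \<in> Poly_Mapping.keys g'" for k
    using that n by (cases "k = n") (auto simp: g'_def in_keys_iff lookup_minus lookup_single Ball_def order.strict_iff_order)
  have "m + n \<notin> Poly_Mapping.keys (f' * g)"
  proof
    assume "m + n \<in> Poly_Mapping.keys (f' * g)"
    then obtain a b where "m + n = a + b" "a \<in> Poly_Mapping.keys f'" "b \<in> Poly_Mapping.keys g"
      using keys_mult[of f' g] by blast
    then show False using f'[of a] n add_less_le_mono[of m a n b] by simp
  qed
  moreover have "m + n \<notin> Poly_Mapping.keys (Poly_Mapping.single m (Poly_Mapping.lookup f m) * g')"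
  proof
    assume "m + n \<in> Poly_Mapping.keys (Poly_Mapping.single m (Poly_Mapping.lookup f m) * g')"
    then obtain a b where "m + n = a + b" "a \<in> Poly_Mapping.keys (Poly_Mapping.single m (Poly_Mapping.lookup f m))"
      "b \<in> Poly_Mapping.keys g'"
      using keys_mult[of "Poly_Mapping.single m (Poly_Mapping.lookup f m)" g'] by blast
    then show False using g'[of b] by (auto split: if_splits)
  qed
  moreover have "f * g = f' * g + Poly_Mapping.single m (Poly_Mapping.lookup f m) * g'
      + Poly_Mapping.single (m + n) (Poly_Mapping.lookup f m * Poly_Mapping.lookup g n)"
    by (simp add: f'_def g'_def algebra_simps flip: mult_single)
  ultimately show "Poly_Mapping.lookup (f * g) (m + n) = Poly_Mapping.lookup f m * Poly_Mapping.lookup g n"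
    by (simp add: lookup_add in_keys_iff)
qed

lemma exponent_nonneg: "(0 :: 'k::linorder \<Rightarrow>\<^sub>0 nat) \<le> t"
proof (cases "t = 0")
  case False
  let ?k = "Min (Poly_Mapping.keys t)"
  have "?k \<in> Poly_Mapping.keys t" using False by (intro Min_in) auto
  moreover have "Poly_Mapping.lookup t k' = 0" if "k' < ?k" for k'
    using that by (metis False Min_le finite_keys in_keys_iff not_le)
  ultimately have "0 < t"
    by (auto simp: less_poly_mapping.rep_eq less_fun_def in_keys_iff)
  then show ?thesis by simp
qed simp

lemma eval_at_zero: "eval_at (\<lambda>_. 0) f = Poly_Mapping.lookup f 0"
proof -
  have "monom_at (\<lambda>_. 0 :: real) t = (if t = 0 then 1 else 0)" for t :: "(nat \<times> nat) \<Rightarrow>\<^sub>0 nat"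
  proof (cases "t = 0")
    case False
    then obtain k where k: "Poly_Mapping.lookup t k \<noteq> 0"
      by (metis lookup_zero poly_mapping_eqI)
    then have "monom_at (\<lambda>_. 0 :: real) t = 0"
      unfolding monom_at_def by (intro prod_zero bexI[of _ k]) (auto simp: in_keys_iff)
    with False show ?thesis by simp
  qed simp
  then have "eval_at (\<lambda>_. 0) f
      = (\<Sum>t\<in>Poly_Mapping.keys f. if t = 0 then Poly_Mapping.lookup f t else 0)"
    unfolding subst_def by (intro sum.cong) auto
  also have "\<dots> = Poly_Mapping.lookup f 0"
    by (simp only: sum.delta[OF finite_keys]) (simp add: in_keys_iff)
  finally show ?thesis .
qed

text \<open>
  Order the ring by the sign of the lowest term of a polynomial expanded around the point \<open>q\<close>. Then
  squares are positive and \<open>D\<close> is negative, its lowest term being its value at \<open>q\<close>.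
\<close>

lemma negative_not_square_quotient:
  assumes neg: "eval_at q D < 0" and eq: "w\<^sup>2 = D * v\<^sup>2"
  shows "v = 0"
proof (rule ccontr)
  assume v: "v \<noteq> 0"
  \<comment> \<open>Moving \<open>q\<close> to the origin.\<close>
  define shift where "shift r = subst_vars (\<lambda>(i, j). rvar i j + Poly_Mapping.single 0 (r (i, j)))" for r
  have inv: "shift (\<lambda>k. - r k) (shift r f) = f" for r f
    by (induction f rule: corr_poly_induct) (simp_all add: shift_def split_def flip: single_add)
  have ev: "eval_at (\<lambda>_. 0) (shift r f) = eval_at r f" for r f
    by (induction f rule: corr_poly_induct) (simp_all add: shift_def split_def)
  define D' v' w' where "D' = shift q D" and "v' = shift q v" and "w' = shift q w"
  have D': "Poly_Mapping.lookup D' 0 < 0"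
    using neg ev[of q D] eval_at_zero[of D'] by (simp add: D'_def)
  have v': "v' \<noteq> 0"
    using v inv[of q v] by (auto simp: v'_def shift_def)
  have eq': "w' * w' = D' * (v' * v')"
    using arg_cong[OF eq, of "shift q"] by (simp add: D'_def v'_def w'_def shift_def power2_eq_square)
  have w': "w' \<noteq> 0"
    using eq' v' D' by auto
  let ?m = "Min (Poly_Mapping.keys v')" and ?n = "Min (Poly_Mapping.keys w')"
  have m: "?m \<in> Poly_Mapping.keys v'" "\<forall>k\<in>Poly_Mapping.keys v'. ?m \<le> k"
    using v' by (auto intro!: Min_in)
  have n: "?n \<in> Poly_Mapping.keys w'" "\<forall>k\<in>Poly_Mapping.keys w'. ?n \<le> k"
    using w' by (auto intro!: Min_in)
  note ww = lowest_term_mult[OF n(2) n(2)]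
  note vv = lowest_term_mult[OF m(2) m(2)]
  have D'0: "\<forall>k\<in>Poly_Mapping.keys D'. 0 \<le> k"
    by (simp add: exponent_nonneg)
  note Dvv = lowest_term_mult[OF D'0 vv(2)]
  have pos: "Poly_Mapping.lookup (w' * w') (?n + ?n) > 0"
    unfolding ww(1) using n(1) by (auto simp: in_keys_iff zero_less_mult_iff neq_iff)
  have "Poly_Mapping.lookup (w' * w') (0 + (?m + ?m)) < 0"
    unfolding eq' Dvv(1) vv(1) using m(1) D' by (auto simp: in_keys_iff mult_less_0_iff zero_less_mult_iff neq_iff)
  then have ne: "Poly_Mapping.lookup (w' * w') (?m + ?m) < 0"
    by (simp only: add_0_left)
  have "?n + ?n \<in> Poly_Mapping.keys (w' * w')" "?m + ?m \<in> Poly_Mapping.keys (w' * w')"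
    using pos ne by (simp_all only: in_keys_iff)
  then have "?m + ?m \<le> ?n + ?n" "?n + ?n \<le> ?m + ?m"
    using Dvv(2) ww(2) unfolding eq'[symmetric] add_0_left by blast+
  then have "?n + ?n = ?m + ?m" by simp
  with pos ne show False by simp
qed

text \<open>
  Completing the square turns a root into a square with the sign of the discriminant.
\<close>

lemma no_root_of_negative_discriminant:
  assumes "eval_at q (\<beta>\<^sup>2 - 4 * \<alpha> * \<gamma>) < 0" and root: "\<alpha> * u\<^sup>2 + \<beta> * u * v + \<gamma> * v\<^sup>2 = 0"
  shows "v = 0"
proof (rule negative_not_square_quotient[OF assms(1)])
  have "(2 * \<alpha> * u + \<beta> * v)\<^sup>2 = (\<beta>\<^sup>2 - 4 * \<alpha> * \<gamma>) * v\<^sup>2 + 4 * \<alpha> * (\<alpha> * u\<^sup>2 + \<beta> * u * v + \<gamma> * v\<^sup>2)"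
    by (simp add: algebra_simps power2_eq_square)
  then show "(2 * \<alpha> * u + \<beta> * v)\<^sup>2 = (\<beta>\<^sup>2 - 4 * \<alpha> * \<gamma>) * v\<^sup>2"
    by (simp only: root mult_zero_right add_0_right)
qed

section \<open>Criteria for primality\<close>

lemma diff_subst_var: "f - subst_var (i, j) p f \<in> ideal_of {rvar i j - p}"
proof (induction f rule: corr_poly_induct)
  case (const a)
  show ?case by (simp add: subst_var_def idl.span_zero)
next
  case (var k l)
  show ?case by (simp add: idl.span_zero idl.span_base)
next
  case (add f g)
  have "f + g - subst_var (i, j) p (f + g) = (f - subst_var (i, j) p f) + (g - subst_var (i, j) p g)"
    by simp
  then show ?case using add by (simp only: idl.span_add)
next
  case (mult f g)
  have "f * g - subst_var (i, j) p (f * g)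
      = f * (g - subst_var (i, j) p g) + (f - subst_var (i, j) p f) * subst_var (i, j) p g"
    by (simp add: algebra_simps)
  then show ?case
    using mult by (simp only: idl.span_add ideal_of_mult_left ideal_of_mult_right)
qed

text \<open>
  The polynomials \<open>f\<close> and \<open>subst_var (i, j) p f\<close> are congruent modulo \<open>x - p\<close>.
\<close>

lemma ideal_of_substitution_iff:
  assumes x: "rvar i j - p \<in> ideal_of G"
  shows "f \<in> ideal_of G \<longleftrightarrow> subst_var (i, j) p f \<in> ideal_of (subst_var (i, j) p ` G)"
proof
  assume "f \<in> ideal_of G"
  then show "subst_var (i, j) p f \<in> ideal_of (subst_var (i, j) p ` G)"
    by (rule ideal_of_hom[rotated 3]) simp_all
next
  assume f: "subst_var (i, j) p f \<in> ideal_of (subst_var (i, j) p ` G)"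
  have diff: "h - subst_var (i, j) p h \<in> ideal_of G" for h
    by (rule ideal_of_least[OF _ diff_subst_var]) (use x in auto)
  have "subst_var (i, j) p f \<in> ideal_of G"
  proof (rule ideal_of_least[OF _ f])
    fix h assume "h \<in> subst_var (i, j) p ` G"
    then obtain g where g: "g \<in> G" "h = g - (g - subst_var (i, j) p g)" by auto
    show "h \<in> ideal_of G"
      unfolding g(2) by (rule idl.span_diff[OF idl.span_base[OF g(1)] diff])
  qed
  from idl.span_add[OF diff[of f] this] show "f \<in> ideal_of G" by simp
qed

lemma prime_by_substitution:
  assumes "rvar i j - p \<in> ideal_of G" "prime_id (ideal_of (subst_var (i, j) p ` G))"
  shows "prime_id (ideal_of G)"
  using assms(2) unfolding prime_id_def ideal_of_substitution_iff[OF assms(1)]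
  by (simp only: subst_var_simps) blast

text \<open>
  The ideal of \<open>G\<close> is compared with the ideal of \<open>s * x - p\<close> and \<open>J\<close>, whose saturation by \<open>s\<close> is known
  to be prime.
\<close>

lemma prime_by_elimination:
  assumes J: "prime_id (ideal_of J)" "s \<notin> ideal_of J"
    and free: "\<forall>g\<in>J. free_of (i, j) g" "free_of (i, j) s" "free_of (i, j) p"
    and lin: "s * rvar i j - p \<in> ideal_of G" and JG: "\<forall>g\<in>J. g \<in> ideal_of G"
    and sat: "\<forall>g\<in>G. g \<in> saturation (ideal_of (insert (s * rvar i j - p) J)) s"
    and nzd: "nzd_mod s (ideal_of G)"
  shows "prime_id (ideal_of G)"
proof (rule prime_of_saturation)
  show "prime_id (saturation (ideal_of (insert (s * rvar i j - p) J)) s)"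
    by (rule prime_saturation_linear[OF J]) (use free in \<open>simp_all add: free_of_def\<close>)
  show "h \<in> ideal_of G" if "h \<in> insert (s * rvar i j - p) J" for h
    using that lin JG by blast
  show "g \<in> saturation (ideal_of (insert (s * rvar i j - p) J)) s" if "g \<in> G" for g
    using that sat by blast
qed (rule nzd)

lemma in_saturation_base: "g \<in> G \<Longrightarrow> g \<in> saturation (ideal_of G) s"
  by (auto simp: saturation_def idl.span_base intro!: exI[of _ 0])

text \<open>
  Modulo \<open>s\<close> the equation \<open>s * x - p\<close> reads \<open>- p\<close>. So \<open>p\<close> being a nonzerodivisor modulo \<open>s\<close> makes
  \<open>s * x - p\<close> one, and \<open>nzd_mod_swap\<close> applies.
\<close>

lemma prime_linear:
  assumes J: "prime_id (ideal_of J)" "s \<notin> ideal_of J"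
    and free: "\<forall>g\<in>J. free_of (i, j) g" "free_of (i, j) s" "free_of (i, j) p"
    and p: "nzd_mod p (ideal_of (insert s J))"
  shows "prime_id (ideal_of (insert (s * rvar i j - p) J))"
proof (rule prime_by_elimination[OF J free])
  have "nzd_mod (s * rvar i j - p) (ideal_of (insert s J))"
    unfolding nzd_mod_def
  proof (intro allI impI)
    fix a assume "a * (s * rvar i j - p) \<in> ideal_of (insert s J)"
    then have "(a * rvar i j) * s - a * (s * rvar i j - p) \<in> ideal_of (insert s J)"
      by (rule idl.span_diff[OF ideal_of_mult_left[OF idl.span_base[OF insertI1]]])
    then have "a * p \<in> ideal_of (insert s J)" by (simp add: algebra_simps)
    then show "a \<in> ideal_of (insert s J)" using p by (simp add: nzd_mod_def)
  qed
  then show "nzd_mod s (ideal_of (insert (s * rvar i j - p) J))"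
    by (rule nzd_mod_swap[OF nzd_mod_prime[OF J]])
qed (simp_all add: idl.span_base in_saturation_base)

lemma prime_quadratic:
  assumes neg: "eval_at q (\<beta>\<^sup>2 - 4 * \<alpha> * \<gamma>) < 0" and \<alpha>: "\<alpha> \<noteq> 0"
    and free: "free_of (i, j) \<alpha>" "free_of (i, j) \<beta>" "free_of (i, j) \<gamma>"
    and nzd: "nzd_mod (\<alpha> * (rvar i j)\<^sup>2 + \<beta> * rvar i j + \<gamma>) (ideal_of {\<alpha>})"
  shows "prime_id (ideal_of {\<alpha> * (rvar i j)\<^sup>2 + \<beta> * rvar i j + \<gamma>})"
proof (rule prime_of_saturation)
  show "prime_id (saturation (ideal_of {\<alpha> * (rvar i j)\<^sup>2 + \<beta> * rvar i j + \<gamma>}) \<alpha>)"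
    using no_root_of_negative_discriminant[OF neg] \<alpha> free
    unfolding free_of_def by (rule prime_saturation_quadratic)
  show "nzd_mod \<alpha> (ideal_of {\<alpha> * (rvar i j)\<^sup>2 + \<beta> * rvar i j + \<gamma>})"
    by (rule nzd_mod_swap[OF nzd_mod_zero_ideal[OF \<alpha>] nzd])
qed (simp_all add: idl.span_base in_saturation_base)

section \<open>Minors of small size\<close>

text \<open>
  Over four indices at most two remain for \<open>C\<close>, so that determinants of order three suffice; the
  last equation is a default value. The formulas are those of a symmetric \<open>r\<close>.
\<close>

fun minor_poly :: "(nat \<Rightarrow> nat \<Rightarrow> 'a::comm_ring_1) \<Rightarrow> nat \<Rightarrow> nat \<Rightarrow> nat list \<Rightarrow> 'a" where
  "minor_poly r i j [] = r i j"
| "minor_poly r i j [k] = r i j * r k k - r i k * r j k"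
| "minor_poly r i j [k, l] = r i j * (r k k * r l l - (r k l)\<^sup>2) - r i k * r j k * r l l
     - r i l * r j l * r k k + r k l * (r i k * r j l + r i l * r j k)"
| "minor_poly r i j (k # l # m # C) = 0"

lemma det2:
  "det (mat 2 2 f) = f (0, 0) * f (1, 1) - f (0, 1) * (f (1, 0) :: 'a::comm_ring_1)"
proof -
  have "det (mat 2 2 f) = (\<Sum>j<2. mat 2 2 f $$ (0, j) * cofactor (mat 2 2 f) 0 j)"
    by (rule laplace_expansion_row) auto
  then show ?thesis
    by (simp add: numeral_2_eq_2 cofactor_def mat_delete_def det_single)
qed

lemma det3:
  "det (mat 3 3 f) = f (0, 0) * (f (1, 1) * f (2, 2) - f (1, 2) * f (2, 1))
     - f (0, 1) * (f (1, 0) * f (2, 2) - f (1, 2) * f (2, 0))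
     + f (0, 2) * (f (1, 0) * f (2, 1) - f (1, 1) * (f (2, 0) :: 'a::comm_ring_1))"
proof -
  have "det (mat 3 3 f) = (\<Sum>j<3. mat 3 3 f $$ (0, j) * cofactor (mat 3 3 f) 0 j)"
    by (rule laplace_expansion_row) auto
  moreover have "mat_delete (mat 3 3 f) 0 j = mat 2 2 (\<lambda>(a, b). f (Suc a, if b < j then b else Suc b))" for j
    by (rule eq_matI) (auto simp: mat_delete_def)
  ultimately show ?thesis
    by (simp add: cofactor_def det2 det2[unfolded numeral_2_eq_2] lessThan_nat_numeral lessThan_Suc numeral_3_eq_3 numeral_2_eq_2 algebra_simps)
qed

lemma det_submat_minor_poly:
  assumes r: "\<And>a b. a \<in> set (i # j # C) \<Longrightarrow> b \<in> set (i # j # C) \<Longrightarrow> M $$ (a - 1, b - 1) = r a b"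
    and sym: "\<And>a b. r a b = r b a" and C: "length C \<le> 2"
  shows "det (submat M (i # C) (j # C)) = minor_poly r i j C"
proof -
  consider "C = []" | k where "C = [k]" | k l where "C = [k, l]"
    using C by (auto simp: le_Suc_eq length_Suc_conv numeral_2_eq_2)
  then show ?thesis
  proof cases
    case 1
    then show ?thesis
      using r by (simp add: submat_def det_single)
  next
    case 2
    then show ?thesis
      using r sym[of k j] by (simp add: submat_def det2[unfolded numeral_2_eq_2] numeral_2_eq_2)
  next
    case 3
    then show ?thesis
      using r sym[of k j] sym[of l j] sym[of l k]
      by (simp add: submat_def det3[unfolded numeral_3_eq_3] numeral_2_eq_2 power2_eq_square algebra_simps)
  qed
qed

lemma minor_poly_swap:
  assumes "\<And>a b. r a b = r b a"
  shows "minor_poly r i j C = minor_poly r j i C"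
  by (cases "(r, i, j, C)" rule: minor_poly.cases) (auto simp: assms[of i j] algebra_simps)

lemma minor_poly_swap_cond:
  assumes "\<And>a b. r a b = r b a"
  shows "minor_poly r i j [k, l] = minor_poly r i j [l, k]"
  by (simp add: assms[of k l] algebra_simps)

text \<open>
  The minor depends on the couple only, not on the order in which its members are listed.
\<close>

lemma minor_poly_cong:
  assumes sym: "\<And>a b. r a b = r b a" and "{i, j} = {i', j'}" "set C = set C'" "i \<noteq> j"
    and "distinct C" "distinct C'" "length C \<le> 2"
  shows "minor_poly r i j C = minor_poly r i' j' C'"
proof -
  have len: "length C' = length C"
    using distinct_card[of C] distinct_card[of C'] assms by simp
  have "minor_poly r i' j' C = minor_poly r i' j' C'"
  proof -
    consider "C = []" | k where "C = [k]" | k l where "C = [k, l]"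
      using \<open>length C \<le> 2\<close> by (auto simp: le_Suc_eq length_Suc_conv numeral_2_eq_2)
    then show ?thesis
    proof cases
      case (3 k l)
      then obtain a b where C': "C' = [a, b]"
        using len by (auto simp: length_Suc_conv)
      then have "a = k \<and> b = l \<or> a = l \<and> b = k"
        using assms(3) 3 by (auto simp: doubleton_eq_iff)
      then show ?thesis
        using C' 3 minor_poly_swap_cond[of r i' j' k l, OF sym] by auto
    qed (use assms(3) len in \<open>auto simp: length_Suc_conv\<close>)
  qed
  moreover have "i = i' \<and> j = j' \<or> i = j' \<and> j = i'"
    using assms by (auto simp: doubleton_eq_iff)
  ultimately show ?thesis
    using minor_poly_swap[of r i' j' C, OF sym] by auto
qed

section \<open>The generators of the ideal\<close>

definition corr :: "nat \<Rightarrow> nat \<Rightarrow> corr_poly" where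
  "corr i j = (if i = j then 1 else rvar (min i j) (max i j))"

lemma corr_sym: "corr i j = corr j i"
  by (simp add: corr_def min.commute max.commute)

type_synonym couple = "nat \<times> nat \<times> nat list"

definition to_ci :: "couple \<Rightarrow> ci_couple" where
  "to_ci = (\<lambda>(i, j, C). ci i j (set C))"

text \<open>
  All listings of a couple are admitted, because relabelling does not preserve sorted lists.
\<close>

definition gens :: "ci_couple set \<Rightarrow> corr_poly set" where
  "gens L = {minor_poly corr i j C | i j C. i \<noteq> j \<and> distinct C \<and> ci i j (set C) \<in> L}"

lemma ci_couples4D:
  assumes "ci i j C \<in> L" "L \<subseteq> ci_couples 4" "i \<noteq> j"
  shows "i \<in> {1..4}" "j \<in> {1..4}" "C \<subseteq> {1..4} - {i, j}" "finite C" "card C \<le> 2"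
proof -
  obtain i' j' where ij: "{i, j} = {i', j'}" "i' \<in> {1..4}" "j' \<in> {1..4}" "C \<subseteq> {1..4} - {i', j'}"
    using assms(1,2) by (auto simp: ci_couples_def ci_def)
  then show "i \<in> {1..4}" "j \<in> {1..4}" and C: "C \<subseteq> {1..4} - {i, j}"
    by (auto simp: doubleton_eq_iff)
  then show fin: "finite C"
    using finite_subset by blast
  have "card C \<le> card ({1..4} - {i, j} :: nat set)"
    by (rule card_mono) (use C in auto)
  also have "\<dots> = 2"
    using \<open>i \<in> {1..4}\<close> \<open>j \<in> {1..4}\<close> \<open>i \<noteq> j\<close> by (subst card_Diff_subset) auto
  finally show "card C \<le> 2" .
qed

lemma corr_mat_entry:
  "a \<in> {1..4} \<Longrightarrow> b \<in> {1..4} \<Longrightarrow> corr_mat 4 $$ (a - 1, b - 1) = corr a b"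
  by (auto simp: corr_mat_def corr_def min_def max_def)

lemma ci_minor_corr_mat:
  assumes "i \<in> {1..4}" "j \<in> {1..4}" "C \<subseteq> {1..4} - {i, j}" "finite C" "card C \<le> 2"
  shows "ci_minor (corr_mat 4) i j C = minor_poly corr i j (sorted_list_of_set C)"
  unfolding ci_minor_def
proof (rule det_submat_minor_poly)
  show "corr_mat 4 $$ (a - 1, b - 1) = corr a b"
    if "a \<in> set (i # j # sorted_list_of_set C)" "b \<in> set (i # j # sorted_list_of_set C)" for a b
    using that assms by (intro corr_mat_entry) auto
qed (use assms in \<open>simp_all add: corr_sym[of a b for a b]\<close>)

lemma gens_eq_minors:
  assumes "L \<subseteq> ci_couples 4"
  shows "{ci_minor (corr_mat 4) i j C | i j C. i \<noteq> j \<and> ci i j C \<in> L} = gens L"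
proof (intro equalityI subsetI)
  fix p assume "p \<in> {ci_minor (corr_mat 4) i j C | i j C. i \<noteq> j \<and> ci i j C \<in> L}"
  then obtain i j C where ijC: "i \<noteq> j" "ci i j C \<in> L" "p = ci_minor (corr_mat 4) i j C" by blast
  note D = ci_couples4D[OF ijC(2) assms ijC(1)]
  have "p = minor_poly corr i j (sorted_list_of_set C)"
    using ijC(3) ci_minor_corr_mat[OF D] by simp
  moreover have "distinct (sorted_list_of_set C)" "ci i j (set (sorted_list_of_set C)) \<in> L"
    using ijC(2) D(4) by simp_all
  ultimately show "p \<in> gens L"
    unfolding gens_def using ijC(1) by blast
next
  fix p assume "p \<in> gens L"
  then obtain i j C where ijC: "i \<noteq> j" "distinct C" "ci i j (set C) \<in> L" "p = minor_poly corr i j C"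
    by (auto simp: gens_def)
  note D = ci_couples4D[OF ijC(3) assms ijC(1)]
  have "p = ci_minor (corr_mat 4) i j (set C)"
    unfolding ci_minor_corr_mat[OF D] ijC(4)
    by (rule minor_poly_cong) (use ijC D in \<open>auto simp: corr_sym distinct_card\<close>)
  then show "p \<in> {ci_minor (corr_mat 4) i j C | i j C. i \<noteq> j \<and> ci i j C \<in> L}"
    using ijC by blast
qed

lemma gens_to_ci:
  assumes "\<forall>(i, j, C)\<in>set ts. i \<noteq> j \<and> distinct C \<and> length C \<le> 2"
  shows "gens (to_ci ` set ts) = (\<lambda>(i, j, C). minor_poly corr i j C) ` set ts"
proof (intro equalityI subsetI)
  fix p assume "p \<in> gens (to_ci ` set ts)"
  then obtain i j C where ijC: "i \<noteq> j" "distinct C" "p = minor_poly corr i j C" "ci i j (set C) \<in> to_ci ` set ts"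
    by (auto simp: gens_def)
  then obtain i' j' C' where t: "(i', j', C') \<in> set ts" "ci i j (set C) = ci i' j' (set C')"
    by (auto simp: to_ci_def)
  have "minor_poly corr i' j' C' = minor_poly corr i j C"
    by (rule minor_poly_cong) (use ijC t assms in \<open>auto simp: corr_sym ci_def\<close>)
  then show "p \<in> (\<lambda>(i, j, C). minor_poly corr i j C) ` set ts"
    using ijC(3) t(1) by force
next
  fix p assume "p \<in> (\<lambda>(i, j, C). minor_poly corr i j C) ` set ts"
  then obtain i j C where "(i, j, C) \<in> set ts" "p = minor_poly corr i j C" by auto
  moreover from this have "i \<noteq> j" "distinct C" "ci i j (set C) \<in> to_ci ` set ts"
    using assms by (auto, force simp: to_ci_def)
  ultimately show "p \<in> gens (to_ci ` set ts)"
    unfolding gens_def by blast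
qed

section \<open>Ideals of the correlation ring\<close>

definition corr_carrier :: "corr_poly set" where
  "corr_carrier = {p. indets p \<subseteq> {(i, j). 1 \<le> i \<and> i < j \<and> j \<le> 4}}"

lemma carrier_corr_ring: "carrier (corr_ring 4) = corr_carrier"
  by (simp add: corr_ring_def corr_carrier_def)

lemma corr_ring_operations:
  "x \<otimes>\<^bsub>corr_ring m\<^esub> y = x * y" "x \<oplus>\<^bsub>corr_ring m\<^esub> y = x + y"
  "\<one>\<^bsub>corr_ring m\<^esub> = 1" "\<zero>\<^bsub>corr_ring m\<^esub> = 0"
  by (simp_all add: corr_ring_def)

lemma corr_carrier_closed:
  "f \<in> corr_carrier \<Longrightarrow> g \<in> corr_carrier \<Longrightarrow> f + g \<in> corr_carrier"
  "f \<in> corr_carrier \<Longrightarrow> g \<in> corr_carrier \<Longrightarrow> f * g \<in> corr_carrier"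
  "f \<in> corr_carrier \<Longrightarrow> - f \<in> corr_carrier"
  "Poly_Mapping.single 0 a \<in> corr_carrier" "0 \<in> corr_carrier" "1 \<in> corr_carrier"
  "1 \<le> i \<Longrightarrow> i < j \<Longrightarrow> j \<le> 4 \<Longrightarrow> rvar i j \<in> corr_carrier"
  subgoal using indets_add[of f g] by (auto simp: corr_carrier_def)
  subgoal using indets_mult[of f g] by (auto simp: corr_carrier_def)
  subgoal by (simp add: corr_carrier_def indets_uminus)
  by (simp_all add: corr_carrier_def indets_def rvar_def)

lemma corr_carrier_diff: "f \<in> corr_carrier \<Longrightarrow> g \<in> corr_carrier \<Longrightarrow> f - g \<in> corr_carrier"
  using corr_carrier_closed(1)[of f "- g"] corr_carrier_closed(3)[of g] by simp

lemma corr_in_carrier: "i \<in> {1..4} \<Longrightarrow> j \<in> {1..4} \<Longrightarrow> corr i j \<in> corr_carrier"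
  by (auto simp: corr_def corr_carrier_closed min_def max_def)

lemma minor_poly_in_carrier:
  assumes "i \<in> {1..4}" "j \<in> {1..4}" "set C \<subseteq> {1..4}"
  shows "minor_poly corr i j C \<in> corr_carrier"
  using assms
  by (cases "(corr, i, j, C)" rule: minor_poly.cases)
    (auto simp: power2_eq_square intro!: corr_carrier_closed corr_carrier_diff corr_in_carrier)

lemma gens_in_carrier:
  assumes "L \<subseteq> ci_couples 4"
  shows "gens L \<subseteq> corr_carrier"
proof
  fix p assume "p \<in> gens L"
  then obtain i j C where ijC: "i \<noteq> j" "ci i j (set C) \<in> L" "p = minor_poly corr i j C"
    by (auto simp: gens_def)
  show "p \<in> corr_carrier"
    unfolding ijC(3) using ci_couples4D[OF ijC(2) assms ijC(1)]
    by (intro minor_poly_in_carrier) auto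
qed

lemma subst_vars_cong_carrier:
  assumes "f \<in> corr_carrier" "\<And>i j. 1 \<le> i \<Longrightarrow> i < j \<Longrightarrow> j \<le> 4 \<Longrightarrow> v (i, j) = w (i, j)"
  shows "subst c v f = subst c w f"
proof -
  have "monom_at v t = monom_at w t" if "t \<in> Poly_Mapping.keys f" for t
    unfolding monom_at_def
  proof (rule prod.cong[OF refl])
    fix k assume k: "k \<in> Poly_Mapping.keys t"
    then have "k \<in> indets f" using that by (auto simp: indets_def)
    then have "v k = w k" using assms by (cases k) (auto simp: corr_carrier_def)
    then show "v k ^ Poly_Mapping.lookup t k = w k ^ Poly_Mapping.lookup t k" by simp
  qed
  then show ?thesis unfolding subst_def by (intro sum.cong) auto
qed

lemma subst_vars_rvar: "subst_vars (\<lambda>(i, j). rvar i j) f = f"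
  by (induction f rule: corr_poly_induct) simp_all

lemma subst_vars_in_carrier:
  assumes "\<And>i j. v (i, j) \<in> corr_carrier"
  shows "subst_vars v f \<in> corr_carrier"
  by (induction f rule: corr_poly_induct) (simp_all add: corr_carrier_closed assms)

text \<open>
  A retraction of the ring in all \<open>r\<^sub>i\<^sub>j\<close> onto the subring of those with \<open>1 \<le> i < j \<le> 4\<close>.
\<close>

definition retract :: "corr_poly \<Rightarrow> corr_poly" where
  "retract = subst_vars (\<lambda>(i, j). if 1 \<le> i \<and> i < j \<and> j \<le> 4 then rvar i j else 0)"

lemma retract_simps [simp]:
  "retract 0 = 0" "retract (f + g) = retract f + retract g" "retract (f * g) = retract f * retract g"
  by (simp_all add: retract_def)

lemma retract_in_carrier: "retract f \<in> corr_carrier"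
  unfolding retract_def by (rule subst_vars_in_carrier) (simp add: corr_carrier_closed)

lemma retract_id: "f \<in> corr_carrier \<Longrightarrow> retract f = f"
  unfolding retract_def
  by (subst subst_vars_cong_carrier[of f _ "\<lambda>(i, j). rvar i j"]) (simp_all add: subst_vars_rvar)

text \<open>
  The cofactors of a linear combination of \<open>G\<close> may involve surplus indeterminates; the retraction
  removes them without changing a combination that lies in the subring.
\<close>

lemma genideal_corr_ring:
  assumes G: "G \<subseteq> corr_carrier"
  shows "Idl\<^bsub>corr_ring 4\<^esub> G = ideal_of G \<inter> corr_carrier"
proof
  interpret R: cring "corr_ring 4" by (rule cring_corr_ring)
  have "ideal (ideal_of G \<inter> corr_carrier) (corr_ring 4)"
  proof (rule idealI)
    show "ring (corr_ring 4)" by (rule R.ring_axioms)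
    show "subgroup (ideal_of G \<inter> corr_carrier) (add_monoid (corr_ring 4))"
    proof (rule R.add.subgroupI)
      show "ideal_of G \<inter> corr_carrier \<noteq> {}"
        using idl.span_zero corr_carrier_closed(5) by blast
      fix a assume a: "a \<in> ideal_of G \<inter> corr_carrier"
      have "\<ominus>\<^bsub>corr_ring 4\<^esub> a = - a"
        using a by (intro R.minus_equality) (auto simp: carrier_corr_ring corr_ring_operations corr_carrier_closed)
      then show "\<ominus>\<^bsub>corr_ring 4\<^esub> a \<in> ideal_of G \<inter> corr_carrier"
        using a by (simp add: idl.span_neg corr_carrier_closed)
    next
      show "ideal_of G \<inter> corr_carrier \<subseteq> carrier (corr_ring 4)"
        by (simp add: carrier_corr_ring)
    next
      show "a \<oplus>\<^bsub>corr_ring 4\<^esub> b \<in> ideal_of G \<inter> corr_carrier"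
        if "a \<in> ideal_of G \<inter> corr_carrier" "b \<in> ideal_of G \<inter> corr_carrier" for a b
        using that by (simp add: corr_ring_operations idl.span_add corr_carrier_closed)
    qed
  qed (auto simp: carrier_corr_ring corr_ring_operations ideal_of_mult_left ideal_of_mult_right corr_carrier_closed)
  then show "Idl\<^bsub>corr_ring 4\<^esub> G \<subseteq> ideal_of G \<inter> corr_carrier"
    by (rule R.genideal_minimal) (use G in \<open>auto intro: idl.span_base\<close>)
  have I: "ideal (Idl\<^bsub>corr_ring 4\<^esub> G) (corr_ring 4)"
    by (rule R.genideal_ideal) (simp add: carrier_corr_ring G)
  then interpret I: ideal "Idl\<^bsub>corr_ring 4\<^esub> G" "corr_ring 4" .
  have "retract f \<in> Idl\<^bsub>corr_ring 4\<^esub> G" if "f \<in> ideal_of G" for f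
    using that
  proof (induction rule: idl.span_induct_alt)
    case base
    show ?case using I.zero_closed by (simp add: corr_ring_operations)
  next
    case (step c x y)
    have "x \<in> Idl\<^bsub>corr_ring 4\<^esub> G"
      using R.genideal_self[of G] G step(1) by (auto simp: carrier_corr_ring)
    then have "retract c * x \<in> Idl\<^bsub>corr_ring 4\<^esub> G"
      using I.I_l_closed[of x "retract c"] retract_in_carrier
      by (simp add: carrier_corr_ring corr_ring_operations)
    then have "retract c * x + retract y \<in> Idl\<^bsub>corr_ring 4\<^esub> G"
      using I.a_closed[OF _ step(2)] by (simp add: corr_ring_operations)
    then show ?case
      using retract_id[of x] G step(1) by auto
  qed
  then show "ideal_of G \<inter> corr_carrier \<subseteq> Idl\<^bsub>corr_ring 4\<^esub> G"
    using retract_id by (metis IntE subsetI)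
qed

definition prime_on_carrier :: "corr_poly set \<Rightarrow> bool" where
  "prime_on_carrier I \<longleftrightarrow> 1 \<notin> I \<and>
     (\<forall>f\<in>corr_carrier. \<forall>g\<in>corr_carrier. f * g \<in> I \<longrightarrow> f \<in> I \<or> g \<in> I)"

lemma prime_on_carrierI: "prime_id I \<Longrightarrow> prime_on_carrier I"
  by (simp add: prime_id_def prime_on_carrier_def)

lemma primeideal_ci_ideal_iff:
  assumes L: "L \<subseteq> ci_couples 4"
  shows "primeideal (ci_ideal 4 L) (corr_ring 4) \<longleftrightarrow> prime_on_carrier (ideal_of (gens L))"
proof -
  let ?I = "ideal_of (gens L)"
  have I: "ci_ideal 4 L = ?I \<inter> corr_carrier"
    unfolding ci_ideal_def gens_eq_minors[OF L] by (rule genideal_corr_ring[OF gens_in_carrier[OF L]])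
  interpret R: cring "corr_ring 4" by (rule cring_corr_ring)
  have id: "ideal (?I \<inter> corr_carrier) (corr_ring 4)"
    unfolding genideal_corr_ring[OF gens_in_carrier[OF L], symmetric]
    by (rule R.genideal_ideal) (simp add: carrier_corr_ring gens_in_carrier[OF L])
  show ?thesis
  proof
    assume "primeideal (ci_ideal 4 L) (corr_ring 4)"
    then interpret P: primeideal "?I \<inter> corr_carrier" "corr_ring 4" by (simp add: I)
    show "prime_on_carrier ?I"
      unfolding prime_on_carrier_def
    proof (intro conjI ballI impI notI)
      assume "1 \<in> ?I"
      then have "\<one>\<^bsub>corr_ring 4\<^esub> \<in> ?I \<inter> corr_carrier"
        using corr_carrier_closed(6) by (simp add: corr_ring_operations)
      then show False using P.one_imp_carrier P.I_notcarr by simp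
    next
      fix f g assume "f \<in> corr_carrier" "g \<in> corr_carrier" "f * g \<in> ?I"
      then show "f \<in> ?I \<or> g \<in> ?I"
        using P.I_prime[of f g] corr_carrier_closed(2)[of f g]
        by (simp add: carrier_corr_ring corr_ring_operations)
    qed
  next
    assume p: "prime_on_carrier ?I"
    show "primeideal (ci_ideal 4 L) (corr_ring 4)"
      unfolding I
    proof (rule primeidealI[OF id cring_corr_ring])
      show "carrier (corr_ring 4) \<noteq> ?I \<inter> corr_carrier"
        using p corr_carrier_closed(6) by (auto simp: carrier_corr_ring prime_on_carrier_def)
    next
      fix a b assume "a \<in> carrier (corr_ring 4)" "b \<in> carrier (corr_ring 4)"
        "a \<otimes>\<^bsub>corr_ring 4\<^esub> b \<in> ?I \<inter> corr_carrier"
      then show "a \<in> ?I \<inter> corr_carrier \<or> b \<in> ?I \<inter> corr_carrier"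
        using p unfolding carrier_corr_ring by (auto simp: prime_on_carrier_def corr_ring_operations)
    qed
  qed
qed

section \<open>Symmetry\<close>

text \<open>
  A permutation of the indices acts on polynomials by \<open>rename\<close> and on relations by \<open>relabel\<close>; the
  former carries the generators for \<open>L\<close> to those for the relabelled relation.
\<close>

definition rename :: "(nat \<Rightarrow> nat) \<Rightarrow> corr_poly \<Rightarrow> corr_poly" where
  "rename \<pi> = subst_vars (\<lambda>(i, j). corr (\<pi> i) (\<pi> j))"

lemma rename_simps [simp]:
  "rename \<pi> 0 = 0" "rename \<pi> 1 = 1"
  "rename \<pi> (f + g) = rename \<pi> f + rename \<pi> g" "rename \<pi> (f - g) = rename \<pi> f - rename \<pi> g"
  "rename \<pi> (f * g) = rename \<pi> f * rename \<pi> g" "rename \<pi> (f ^ n) = rename \<pi> f ^ n"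
  by (simp_all add: rename_def)

lemma rename_corr [simp]: "rename \<pi> (corr i j) = corr (\<pi> i) (\<pi> j)"
  by (auto simp: corr_def[of i j] rename_def min_def max_def corr_sym corr_def[of "\<pi> j" "\<pi> j"])

lemma rename_minor_poly [simp]: "rename \<pi> (minor_poly corr i j C) = minor_poly corr (\<pi> i) (\<pi> j) (map \<pi> C)"
  by (cases "(corr, i, j, C)" rule: minor_poly.cases) simp_all

text \<open>
  The restriction to the carrier is needed: \<open>rvar 2 1\<close> is sent to the image of \<open>rvar 1 2\<close>.
\<close>

lemma rename_inverse:
  assumes "\<pi> permutes {1..4}" "f \<in> corr_carrier"
  shows "rename (inv_into UNIV \<pi>) (rename \<pi> f) = f"
proof -
  have inv: "inv_into UNIV \<pi> (\<pi> i) = i" for i using permutes_inverses(2)[OF assms(1)] .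
  have "rename (inv_into UNIV \<pi>) (rename \<pi> g) = subst_vars (\<lambda>(i, j). corr i j) g" for g
    by (induction g rule: corr_poly_induct) (simp_all add: rename_def[of \<pi>] inv, simp add: rename_def)
  also have "subst_vars (\<lambda>(i, j). corr i j) f = subst_vars (\<lambda>(i, j). rvar i j) f"
    by (rule subst_vars_cong_carrier[OF assms(2)]) (simp add: corr_def)
  finally show ?thesis by (simp add: subst_vars_rvar)
qed

lemma rename_in_carrier:
  assumes \<pi>: "\<pi> permutes {1..4}" and f: "f \<in> corr_carrier"
  shows "rename \<pi> f \<in> corr_carrier"
proof -
  have \<pi>4: "\<pi> i \<in> {1..4}" if "i \<in> {1..4}" for i
    using that permutes_in_image[OF \<pi>] by blast
  have "rename \<pi> f = subst_vars (\<lambda>(i, j). if 1 \<le> i \<and> i < j \<and> j \<le> 4 then corr (\<pi> i) (\<pi> j) else 0) f"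
    unfolding rename_def by (rule subst_vars_cong_carrier[OF f]) simp
  also have "\<dots> \<in> corr_carrier"
    by (rule subst_vars_in_carrier) (auto intro!: corr_in_carrier \<pi>4 corr_carrier_closed)
  finally show ?thesis .
qed

definition relabel :: "(nat \<Rightarrow> nat) \<Rightarrow> ci_couple set \<Rightarrow> ci_couple set" where
  "relabel \<pi> L = (\<lambda>(E, C). (\<pi> ` E, \<pi> ` C)) ` L"

lemma relabel_ci: "(\<lambda>(E, C). (\<pi> ` E, \<pi> ` C)) (ci i j C) = ci (\<pi> i) (\<pi> j) (\<pi> ` C)"
  by (simp add: ci_def)

lemma rename_gens:
  assumes "inj \<pi>" "p \<in> gens L"
  shows "rename \<pi> p \<in> gens (relabel \<pi> L)"
proof -
  obtain i j C where ijC: "i \<noteq> j" "distinct C" "ci i j (set C) \<in> L" "p = minor_poly corr i j C"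
    using assms(2) by (auto simp: gens_def)
  have "ci (\<pi> i) (\<pi> j) (set (map \<pi> C)) \<in> relabel \<pi> L"
    unfolding relabel_def using ijC(3) relabel_ci[of \<pi> i j "set C"] by (force simp: image_iff)
  moreover have "\<pi> i \<noteq> \<pi> j" "distinct (map \<pi> C)"
    using ijC assms(1) by (auto simp: inj_eq distinct_map intro: inj_on_subset)
  ultimately show ?thesis
    unfolding gens_def ijC(4) rename_minor_poly by blast
qed

lemma rename_ideal:
  assumes "inj \<pi>" "f \<in> ideal_of (gens L)"
  shows "rename \<pi> f \<in> ideal_of (gens (relabel \<pi> L))"
proof -
  have "rename \<pi> f \<in> ideal_of (rename \<pi> ` gens L)"
    by (rule ideal_of_hom[OF _ _ _ assms(2)]) simp_all
  then show ?thesis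
    by (rule ideal_of_mono) (use rename_gens[OF assms(1)] in auto)
qed

lemma relabel_inverse: "\<pi> permutes S \<Longrightarrow> relabel (inv_into UNIV \<pi>) (relabel \<pi> L) = L"
  by (simp add: relabel_def image_image split_def permutes_inverses(2))

lemma prime_on_carrier_relabel:
  assumes \<pi>: "\<pi> permutes {1..4}" and prime: "prime_on_carrier (ideal_of (gens (relabel \<pi> L)))"
  shows "prime_on_carrier (ideal_of (gens L))"
proof -
  have inj: "inj \<pi>" "inj (inv_into UNIV \<pi>)"
    using \<pi> permutes_inv[OF \<pi>] by (auto intro: permutes_inj)
  have iff: "f \<in> ideal_of (gens L) \<longleftrightarrow> rename \<pi> f \<in> ideal_of (gens (relabel \<pi> L))"
    if f: "f \<in> corr_carrier" for f
    using rename_ideal[OF inj(1), of f L] rename_ideal[OF inj(2), of "rename \<pi> f" "relabel \<pi> L"]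
      rename_inverse[OF \<pi> f] relabel_inverse[OF \<pi>] by auto
  show ?thesis
    unfolding prime_on_carrier_def
  proof (intro conjI ballI impI)
    show "1 \<notin> ideal_of (gens L)"
      using prime iff[of 1] by (simp add: prime_on_carrier_def corr_carrier_closed)
  next
    fix f g assume fg: "f \<in> corr_carrier" "g \<in> corr_carrier" "f * g \<in> ideal_of (gens L)"
    then have "rename \<pi> f * rename \<pi> g \<in> ideal_of (gens (relabel \<pi> L))"
      using iff[of "f * g"] by (simp add: corr_carrier_closed)
    then show "f \<in> ideal_of (gens L) \<or> g \<in> ideal_of (gens L)"
      using prime fg(1,2) iff rename_in_carrier[OF \<pi>] by (simp add: prime_on_carrier_def)
  qed
qed

section \<open>Hypersurfaces and test points\<close>

abbreviation "r12 \<equiv> rvar 1 2"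
abbreviation "r13 \<equiv> rvar 1 3"
abbreviation "r14 \<equiv> rvar 1 4"
abbreviation "r23 \<equiv> rvar 2 3"
abbreviation "r24 \<equiv> rvar 2 4"
abbreviation "r34 \<equiv> rvar 3 4"

definition minors_of :: "couple list \<Rightarrow> corr_poly set" where
  "minors_of ts = (\<lambda>(i, j, C). minor_poly corr i j C) ` set ts"

lemma minors_of_simps:
  "minors_of [] = {}" "minors_of ((i, j, C) # ts) = insert (minor_poly corr i j C) (minors_of ts)"
  "corr i i = 1" "i < j \<Longrightarrow> corr i j = rvar i j" "j < i \<Longrightarrow> corr i j = rvar j i"
  by (simp_all add: minors_of_def corr_def min_def max_def)

lemmas poly_simps = algebra_simps power2_eq_square power3_eq_cube

lemma free_of_rvar: "free_of x (rvar i j) \<longleftrightarrow> x \<noteq> (i, j)"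
  by (auto simp: free_of_def)

lemma subst_var_eq_poly: "subst_var (i, j) p f = poly (as_poly_in (i, j) f) p"
  by (induction f rule: corr_poly_induct) (auto simp: as_poly_in_def subst_var_def)

lemma prime_graph:
  "rvar i j - p \<in> G \<Longrightarrow> prime_id (ideal_of (subst_var (i, j) p ` G)) \<Longrightarrow> prime_id (ideal_of G)"
  by (rule prime_by_substitution) (auto intro: idl.span_base)

lemma prime_id_singleton_zero [simp]: "prime_id (ideal_of {0 :: corr_poly})"
proof -
  have "ideal_of {0 :: corr_poly} = ideal_of {}"
    by (rule ideal_of_eqI) (auto simp: idl.span_zero)
  then show ?thesis using prime_id_zero by metis
qed

lemma prime_id_zero_set [simp]: "prime_id {0 :: corr_poly}"
  using prime_id_zero by simp

text \<open>
  Zeros and signs of generators do not matter.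
\<close>

lemma prime_id_cong:
  assumes "prime_id (ideal_of H)" "\<forall>h\<in>H. h \<in> G \<or> - h \<in> G" "\<forall>g\<in>G. g = 0 \<or> g \<in> H \<or> - g \<in> H"
  shows "prime_id (ideal_of G)"
proof -
  have pm: "g \<in> ideal_of X" if "g \<in> X \<or> - g \<in> X" for g X
  proof -
    have "g \<in> ideal_of X \<or> - g \<in> ideal_of X" using that idl.span_base by metis
    then show ?thesis using idl.span_neg[of "- g" X] by (metis minus_minus)
  qed
  have "ideal_of G = ideal_of H"
  proof (rule ideal_of_eqI)
    show "g \<in> ideal_of H" if "g \<in> G" for g
    proof (cases "g = 0")
      case True
      then show ?thesis by (simp only: idl.span_zero)
    next
      case False
      with assms(3) \<open>g \<in> G\<close> show ?thesis by (intro pm) metis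
    qed
    show "h \<in> ideal_of G" if "h \<in> H" for h
      using assms(2) that by (intro pm) metis
  qed
  with assms(1) show ?thesis by simp
qed

lemma prime_principal_linear:
  assumes "eval_at q s \<noteq> 0" "free_of (i, j) s" "free_of (i, j) p" "nzd_mod p (ideal_of {s})"
  shows "prime_id (ideal_of {s * rvar i j - p})"
proof (rule prime_linear[of "{}"])
  show "s \<notin> ideal_of {}"
    using not_in_ideal_of[of "{}" q s] assms(1) by simp
qed (use assms in \<open>simp_all add: prime_id_zero del: idl.span_empty\<close>)

lemma nzd_mod_principal_mult:
  assumes "eval_at q s \<noteq> 0" "nzd_mod p (ideal_of {s})" "nzd_mod p (ideal_of {t})"
  shows "nzd_mod p (ideal_of {s * t})"
proof -
  have "s \<noteq> 0" using assms(1) by auto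
  then show ?thesis
    using assms nzd_mod_product_ideal[of p s "{}" t] nzd_mod_zero_ideal[of s] by simp
qed

lemma prime_principal_graph:
  assumes "t = rvar i j - \<pi> \<or> t = \<pi> - rvar i j" "free_of (i, j) \<pi>"
  shows "prime_id (ideal_of {t})"
proof -
  have "rvar i j - \<pi> \<in> ideal_of {t}"
    using assms(1) idl.span_base[of t "{t}"] idl.span_neg[of t "{t}"] by auto
  moreover have "subst_var (i, j) \<pi> ` {t} = {0}"
    using assms by (auto simp: subst_var_eq_poly[of i j \<pi> \<pi>] free_of_def)
  ultimately show ?thesis
    using prime_by_substitution[of i j \<pi> "{t}"] prime_id_singleton_zero by simp
qed

text \<open>
  The point \<open>q\<close> lies on the hypersurface \<open>t = 0\<close>, where \<open>p\<close> is to be nonzero.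
\<close>

lemma nzd_mod_graph:
  assumes "t = rvar i j - \<pi> \<or> t = \<pi> - rvar i j" "free_of (i, j) \<pi>"
    and "eval_at q t = 0" "eval_at q p \<noteq> 0"
  shows "nzd_mod p (ideal_of {t})"
  by (rule nzd_mod_prime[OF prime_principal_graph[OF assms(1,2)]])
    (use not_in_ideal_of[of "{t}" q p] assms(3,4) in simp)

lemma nzd_mod_one: "nzd_mod 1 I"
  by (simp add: nzd_mod_def)

lemma nzd_mod_by_point:
  assumes "prime_id (ideal_of G)" "\<forall>g\<in>G. eval_at q g = 0" "eval_at q p \<noteq> 0"
  shows "nzd_mod p (ideal_of G)"
  using assms by (intro nzd_mod_prime not_in_ideal_of[of G q]) auto

lemma prime_two_graphs:
  assumes u: "u = rvar i j - p \<or> u = p - rvar i j" "free_of (i, j) p"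
    and t: "t = rvar k l - \<pi> \<or> t = \<pi> - rvar k l" "free_of (k, l) \<pi>" "free_of (i, j) t"
  shows "prime_id (ideal_of {t, u})"
proof (rule prime_by_substitution)
  show "rvar i j - p \<in> ideal_of {t, u}"
    using u(1) idl.span_base[of u "{t, u}"] idl.span_neg[of u "{t, u}"] by auto
  have "subst_var (i, j) p t = t" "subst_var (i, j) p u = 0"
    using u t(3) subst_var_eq_poly[of i j p t] subst_var_eq_poly[of i j p p] by (auto simp: free_of_def)
  then show "prime_id (ideal_of (subst_var (i, j) p ` {t, u}))"
    by (intro prime_id_cong[OF prime_principal_graph[OF t(1,2)]]) simp_all
qed

lemma nonzero_by_point: "eval_at q s \<noteq> 0 \<Longrightarrow> s \<noteq> 0"
  by auto

lemma ideal_of_replace: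
  assumes "f - c * s = g \<or> f - c * s = - g"
  shows "ideal_of {s, f} = ideal_of {g, s}"
proof -
  have "g \<in> ideal_of {s, f}"
  proof -
    have "f - c * s \<in> ideal_of {s, f}"
      by (intro idl.span_diff ideal_of_mult_left idl.span_base) simp_all
    then have "f - c * s \<in> ideal_of {s, f}" "- (f - c * s) \<in> ideal_of {s, f}"
      by (simp_all only: idl.span_neg)
    moreover have "g = f - c * s \<or> g = - (f - c * s)" using assms by (metis minus_minus)
    ultimately show ?thesis by metis
  qed
  moreover have "f \<in> ideal_of {g, s}"
  proof -
    have "g + c * s \<in> ideal_of {g, s}" "- g + c * s \<in> ideal_of {g, s}"
      by (intro idl.span_add idl.span_neg ideal_of_mult_left idl.span_base; simp)+
    moreover have "f = g + c * s \<or> f = - g + c * s" using assms by (auto simp: algebra_simps)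
    ultimately show ?thesis by metis
  qed
  ultimately show ?thesis
    by (intro ideal_of_eqI) (auto simp: idl.span_base)
qed

section \<open>Relations whose generators define graphs\<close>

text \<open>
  Lemmas about single relations are named after couples whose minors generate the ideal, with \<open>ijcK\<close>
  for the couple \<open>ij|K\<close>; the remaining couples of the relation follow from these. The steps
  substitute for one indeterminate after the other, until all generators have become zero.
\<close>

lemma prime_empty:
  "prime_id (ideal_of (minors_of []))"
  by (simp add: minors_of_simps)

lemma prime_12:
  "prime_id (ideal_of (minors_of [(1,2,[])]))"
  by (simp add: minors_of_simps,
    rule prime_graph[of 1 2 0], simp add: poly_simps,
    simp add: poly_simps)

lemma prime_12c3:
  "prime_id (ideal_of (minors_of [(1,2,[3])]))"
  by (simp add: minors_of_simps,
    rule prime_graph[of 1 2 "r13 * r23"], simp add: poly_simps,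
    simp add: poly_simps)

lemma prime_12_13c4:
  "prime_id (ideal_of (minors_of [(1,2,[]), (1,3,[4])]))"
  by (simp add: minors_of_simps,
    rule prime_graph[of 1 2 0], simp add: poly_simps,
    rule prime_graph[of 1 3 "r14 * r34"], simp add: poly_simps,
    simp add: poly_simps)

lemma prime_12_34:
  "prime_id (ideal_of (minors_of [(1,2,[]), (3,4,[])]))"
  by (simp add: minors_of_simps,
    rule prime_graph[of 1 2 0], simp add: poly_simps,
    rule prime_graph[of 3 4 0], simp add: poly_simps,
    simp add: poly_simps)

lemma prime_12_34c1:
  "prime_id (ideal_of (minors_of [(1,2,[]), (3,4,[1])]))"
  by (simp add: minors_of_simps,
    rule prime_graph[of 1 2 0], simp add: poly_simps,
    rule prime_graph[of 3 4 "r13 * r14"], simp add: poly_simps,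
    simp add: poly_simps)

lemma prime_12_34c12:
  "prime_id (ideal_of (minors_of [(1,2,[]), (3,4,[1,2])]))"
  by (simp add: minors_of_simps,
    rule prime_graph[of 1 2 0], simp add: poly_simps,
    rule prime_graph[of 3 4 "r13 * r14 + r23 * r24"], simp add: poly_simps,
    simp add: poly_simps)

lemma prime_12c3_13c4:
  "prime_id (ideal_of (minors_of [(1,2,[3]), (1,3,[4])]))"
  by (simp add: minors_of_simps,
    rule prime_graph[of 1 2 "r13 * r23"], simp add: poly_simps,
    rule prime_graph[of 1 3 "r14 * r34"], simp add: poly_simps,
    simp add: poly_simps)

lemma prime_12c3_34c1:
  "prime_id (ideal_of (minors_of [(1,2,[3]), (3,4,[1])]))"
  by (simp add: minors_of_simps,
    rule prime_graph[of 1 2 "r13 * r23"], simp add: poly_simps,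
    rule prime_graph[of 3 4 "r13 * r14"], simp add: poly_simps,
    simp add: poly_simps)

lemma prime_12_13c4_24c3:
  "prime_id (ideal_of (minors_of [(1,2,[]), (1,3,[4]), (2,4,[3])]))"
  by (simp add: minors_of_simps,
    rule prime_graph[of 1 2 0], simp add: poly_simps,
    rule prime_graph[of 1 3 "r14 * r34"], simp add: poly_simps,
    rule prime_graph[of 2 4 "r23 * r34"], simp add: poly_simps,
    simp add: poly_simps)

lemma prime_12_13c4_34c2:
  "prime_id (ideal_of (minors_of [(1,2,[]), (1,3,[4]), (3,4,[2])]))"
  by (simp add: minors_of_simps,
    rule prime_graph[of 1 2 0], simp add: poly_simps,
    rule prime_graph[of 1 3 "r14 * r34"], simp add: poly_simps,
    rule prime_graph[of 3 4 "r23 * r24"], simp add: poly_simps,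
    simp add: poly_simps)

lemma prime_12c3_13c4_24c1:
  "prime_id (ideal_of (minors_of [(1,2,[3]), (1,3,[4]), (2,4,[1])]))"
  by (simp add: minors_of_simps,
    rule prime_graph[of 1 2 "r13 * r23"], simp add: poly_simps,
    rule prime_graph[of 1 3 "r14 * r34"], simp add: poly_simps,
    rule prime_graph[of 2 4 "r14^2 * r23 * r34"], simp add: poly_simps,
    simp add: poly_simps)

lemma prime_12_13:
  "prime_id (ideal_of (minors_of [(1,2,[]), (1,2,[3]), (1,3,[]), (1,3,[2])]))"
  by (simp add: minors_of_simps,
    rule prime_graph[of 1 2 0], simp add: poly_simps,
    rule prime_graph[of 1 3 0], simp add: poly_simps,
    simp add: poly_simps)

lemma prime_12c3_14c3:
  "prime_id (ideal_of (minors_of [(1,2,[3]), (1,2,[3,4]), (1,4,[3]), (1,4,[2,3])]))"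
  by (simp add: minors_of_simps,
    rule prime_graph[of 1 2 "r13 * r23"], simp add: poly_simps,
    rule prime_graph[of 1 4 "r13 * r34"], simp add: poly_simps,
    simp add: poly_simps)

lemma prime_12_13_23c4:
  "prime_id (ideal_of (minors_of [(1,2,[]), (1,2,[3]), (1,3,[]), (1,3,[2]), (2,3,[4])]))"
  by (simp add: minors_of_simps,
    rule prime_graph[of 1 2 0], simp add: poly_simps,
    rule prime_graph[of 1 3 0], simp add: poly_simps,
    rule prime_graph[of 2 3 "r24 * r34"], simp add: poly_simps,
    simp add: poly_simps)

lemma prime_12_13c4_23c4:
  "prime_id (ideal_of (minors_of [(1,2,[]), (1,3,[4]), (1,3,[2,4]), (2,3,[4]), (2,3,[1,4])]))"
  by (simp add: minors_of_simps,
    rule prime_graph[of 1 2 0], simp add: poly_simps,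
    rule prime_graph[of 1 3 "r14 * r34"], simp add: poly_simps,
    rule prime_graph[of 2 3 "r24 * r34"], simp add: poly_simps,
    simp add: poly_simps)

lemma prime_12c3_14c2_24c3:
  "prime_id (ideal_of (minors_of [(1,2,[3]), (1,2,[3,4]), (1,4,[2]), (2,4,[3]), (2,4,[1,3])]))"
  by (simp add: minors_of_simps,
    rule prime_graph[of 1 2 "r13 * r23"], simp add: poly_simps,
    rule prime_graph[of 1 4 "r13 * r23 * r24"], simp add: poly_simps,
    rule prime_graph[of 2 4 "r23 * r34"], simp add: poly_simps,
    simp add: poly_simps)

lemma prime_12_13_23:
  "prime_id (ideal_of (minors_of [(1,2,[]), (1,2,[3]), (1,3,[]), (1,3,[2]), (2,3,[]), (2,3,[1])]))"
  by (simp add: minors_of_simps,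
    rule prime_graph[of 1 2 0], simp add: poly_simps,
    rule prime_graph[of 1 3 0], simp add: poly_simps,
    rule prime_graph[of 2 3 0], simp add: poly_simps,
    simp add: poly_simps)

lemma prime_12c3_14c3_24c3:
  "prime_id (ideal_of (minors_of [(1,2,[3]), (1,2,[3,4]), (1,4,[3]), (1,4,[2,3]), (2,4,[3]),
      (2,4,[1,3])]))"
  by (simp add: minors_of_simps,
    rule prime_graph[of 1 2 "r13 * r23"], simp add: poly_simps,
    rule prime_graph[of 1 4 "r13 * r34"], simp add: poly_simps,
    rule prime_graph[of 2 4 "r23 * r34"], simp add: poly_simps,
    simp add: poly_simps)

lemma prime_12_13_24:
  "prime_id (ideal_of (minors_of [(1,2,[]), (1,2,[3]), (1,2,[4]), (1,3,[]), (1,3,[2]), (2,4,[]),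
      (2,4,[1])]))"
  by (simp add: minors_of_simps,
    rule prime_graph[of 1 2 0], simp add: poly_simps,
    rule prime_graph[of 1 3 0], simp add: poly_simps,
    rule prime_graph[of 2 4 0], simp add: poly_simps,
    simp add: poly_simps)

lemma prime_12_13_24c3:
  "prime_id (ideal_of (minors_of [(1,2,[]), (1,2,[3]), (1,2,[3,4]), (1,3,[]), (1,3,[2]), (2,4,[3]),
      (2,4,[1,3])]))"
  by (simp add: minors_of_simps,
    rule prime_graph[of 1 2 0], simp add: poly_simps,
    rule prime_graph[of 1 3 0], simp add: poly_simps,
    rule prime_graph[of 2 4 "r23 * r34"], simp add: poly_simps,
    simp add: poly_simps)

lemma prime_12c4_13c4_24c3:
  "prime_id (ideal_of (minors_of [(1,2,[3]), (1,2,[4]), (1,2,[3,4]), (1,3,[4]), (1,3,[2,4]),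
      (2,4,[3]), (2,4,[1,3])]))"
  by (simp add: minors_of_simps,
    rule prime_graph[of 1 2 "r13 * r23"], simp add: poly_simps,
    rule prime_graph[of 1 3 "r14 * r34"], simp add: poly_simps,
    rule prime_graph[of 2 4 "r23 * r34"], simp add: poly_simps,
    simp add: poly_simps)

lemma prime_12_13_14:
  "prime_id (ideal_of (minors_of [(1,2,[]), (1,2,[3]), (1,2,[4]), (1,2,[3,4]), (1,3,[]), (1,3,[2]),
      (1,3,[4]), (1,3,[2,4]), (1,4,[]), (1,4,[2]), (1,4,[3]), (1,4,[2,3])]))"
  by (simp add: minors_of_simps,
    rule prime_graph[of 1 2 0], simp add: poly_simps,
    rule prime_graph[of 1 3 0], simp add: poly_simps,
    rule prime_graph[of 1 4 0], simp add: poly_simps,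
    simp add: poly_simps)

lemma prime_12_13_14_23:
  "prime_id (ideal_of (minors_of [(1,2,[]), (1,2,[3]), (1,2,[4]), (1,2,[3,4]), (1,3,[]), (1,3,[2]),
      (1,3,[4]), (1,3,[2,4]), (1,4,[]), (1,4,[2]), (1,4,[3]), (1,4,[2,3]), (2,3,[]), (2,3,[1])]))"
  by (simp add: minors_of_simps,
    rule prime_graph[of 1 2 0], simp add: poly_simps,
    rule prime_graph[of 1 3 0], simp add: poly_simps,
    rule prime_graph[of 1 4 0], simp add: poly_simps,
    rule prime_graph[of 2 3 0], simp add: poly_simps,
    simp add: poly_simps)

lemma prime_12_13_14_23c4:
  "prime_id (ideal_of (minors_of [(1,2,[]), (1,2,[3]), (1,2,[4]), (1,2,[3,4]), (1,3,[]), (1,3,[2]),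
      (1,3,[4]), (1,3,[2,4]), (1,4,[]), (1,4,[2]), (1,4,[3]), (1,4,[2,3]), (2,3,[4]),
      (2,3,[1,4])]))"
  by (simp add: minors_of_simps,
    rule prime_graph[of 1 2 0], simp add: poly_simps,
    rule prime_graph[of 1 3 0], simp add: poly_simps,
    rule prime_graph[of 1 4 0], simp add: poly_simps,
    rule prime_graph[of 2 3 "r24 * r34"], simp add: poly_simps,
    simp add: poly_simps)

lemma prime_12_13_24_34:
  "prime_id (ideal_of (minors_of [(1,2,[]), (1,2,[3]), (1,2,[4]), (1,2,[3,4]), (1,3,[]), (1,3,[2]),
      (1,3,[4]), (1,3,[2,4]), (2,4,[]), (2,4,[1]), (2,4,[3]), (2,4,[1,3]), (3,4,[]), (3,4,[1]),
      (3,4,[2]), (3,4,[1,2])]))"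
  by (simp add: minors_of_simps,
    rule prime_graph[of 1 2 0], simp add: poly_simps,
    rule prime_graph[of 1 3 0], simp add: poly_simps,
    rule prime_graph[of 2 4 0], simp add: poly_simps,
    rule prime_graph[of 3 4 0], simp add: poly_simps,
    simp add: poly_simps)

lemma prime_12_13_14_23_24:
  "prime_id (ideal_of (minors_of [(1,2,[]), (1,2,[3]), (1,2,[4]), (1,2,[3,4]), (1,3,[]), (1,3,[2]),
      (1,3,[4]), (1,3,[2,4]), (1,4,[]), (1,4,[2]), (1,4,[3]), (1,4,[2,3]), (2,3,[]), (2,3,[1]),
      (2,3,[4]), (2,3,[1,4]), (2,4,[]), (2,4,[1]), (2,4,[3]), (2,4,[1,3])]))"
  by (simp add: minors_of_simps,
    rule prime_graph[of 1 2 0], simp add: poly_simps,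
    rule prime_graph[of 1 3 0], simp add: poly_simps,
    rule prime_graph[of 1 4 0], simp add: poly_simps,
    rule prime_graph[of 2 3 0], simp add: poly_simps,
    rule prime_graph[of 2 4 0], simp add: poly_simps,
    simp add: poly_simps)

lemma prime_12_13_14_23_24_34:
  "prime_id (ideal_of (minors_of [(1,2,[]), (1,2,[3]), (1,2,[4]), (1,2,[3,4]), (1,3,[]), (1,3,[2]),
      (1,3,[4]), (1,3,[2,4]), (1,4,[]), (1,4,[2]), (1,4,[3]), (1,4,[2,3]), (2,3,[]), (2,3,[1]),
      (2,3,[4]), (2,3,[1,4]), (2,4,[]), (2,4,[1]), (2,4,[3]), (2,4,[1,3]), (3,4,[]), (3,4,[1]),
      (3,4,[2]), (3,4,[1,2])]))"
  by (simp add: minors_of_simps,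
    rule prime_graph[of 1 2 0], simp add: poly_simps,
    rule prime_graph[of 1 3 0], simp add: poly_simps,
    rule prime_graph[of 1 4 0], simp add: poly_simps,
    rule prime_graph[of 2 3 0], simp add: poly_simps,
    rule prime_graph[of 2 4 0], simp add: poly_simps,
    rule prime_graph[of 3 4 0], simp add: poly_simps,
    simp add: poly_simps)

section \<open>Relations with one further equation that is linear in a variable\<close>

text \<open>
  A lemma named \<open>prime_reduced\<close> is about what remains after the substitutions, the last equation
  written as \<open>s * x - p\<close> with \<open>s\<close> in factors. For each factor a point is given
  where the factor vanishes and \<open>p\<close> does not; the first point is one where \<open>s\<close> is nonzero.
\<close>

lemma prime_reduced_12c34:
  "prime_id (ideal_of {(1 - r34) * (r34 + 1) * r12 - (r13 * r23 - r14 * r23 * r34 - r13 * r24 * r34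
      + r14 * r24)})"
  (is "prime_id (ideal_of {?s * _ - ?p})")
proof (rule prime_principal_linear[of "(\<lambda>_. 0)"])
  show "nzd_mod ?p (ideal_of {?s})"
    by (rule nzd_mod_principal_mult[of "(\<lambda>_. 0)"], simp,
      (rule nzd_mod_graph[of _ 3 4 "1"
        "(\<lambda>_. 0)((1, 4) := -1, (2, 4) := 2, (3, 4) := 1)"]; simp add: free_of_rvar),
      (rule nzd_mod_graph[of _ 3 4 "- 1"
        "(\<lambda>_. 0)((1, 4) := 2, (2, 4) := 1, (3, 4) := -1)"]; simp add: free_of_rvar))
qed (simp_all add: free_of_rvar)

lemma prime_12c34:
  "prime_id (ideal_of (minors_of [(1,2,[3,4])]))"
  by (simp add: minors_of_simps,
    rule prime_id_cong[OF prime_reduced_12c34]; simp add: poly_simps)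

lemma prime_reduced_12_12c34:
  "prime_id (ideal_of {(r24 * r34 - r23) * r13 - (r14 * r24 - r14 * r23 * r34)})"
  (is "prime_id (ideal_of {?s * _ - ?p})")
proof (rule prime_principal_linear[of "(\<lambda>_. 0)((2, 4) := 1, (3, 4) := 2)"])
  show "nzd_mod ?p (ideal_of {?s})"
    by ((rule nzd_mod_graph[of _ 2 3 "r24 * r34"
        "(\<lambda>_. 0)((1, 4) := 2, (2, 4) := 2)"]; simp add: free_of_rvar))
qed (simp_all add: free_of_rvar)

lemma prime_12_12c34:
  "prime_id (ideal_of (minors_of [(1,2,[]), (1,2,[3,4])]))"
  by (simp add: minors_of_simps,
    rule prime_graph[of 1 2 0], simp add: poly_simps,
    rule prime_id_cong[OF prime_reduced_12_12c34]; simp add: poly_simps)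

lemma prime_reduced_12_13c24:
  "prime_id (ideal_of {r14 * r24 * r23 - (r13 * r24^2 + r14 * r34 - r13)})"
  (is "prime_id (ideal_of {?s * _ - ?p})")
proof (rule prime_principal_linear[of "(\<lambda>_. 0)((1, 4) := 2, (2, 4) := 1)"])
  show "nzd_mod ?p (ideal_of {?s})"
    by (rule nzd_mod_principal_mult[of "(\<lambda>_. 0)((1, 4) := 2, (2, 4) := 1)"], simp,
      (rule nzd_mod_graph[of _ 1 4 "0"
        "(\<lambda>_. 0)((1, 3) := 1)"]; simp add: free_of_rvar),
      (rule nzd_mod_graph[of _ 2 4 "0"
        "(\<lambda>_. 0)((1, 4) := 2, (3, 4) := -1)"]; simp add: free_of_rvar))
qed (simp_all add: free_of_rvar)

lemma prime_12_13c24: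
  "prime_id (ideal_of (minors_of [(1,2,[]), (1,3,[2,4])]))"
  by (simp add: minors_of_simps,
    rule prime_graph[of 1 2 0], simp add: poly_simps,
    rule prime_id_cong[OF prime_reduced_12_13c24]; simp add: poly_simps)

lemma prime_reduced_12c3_12c4:
  "prime_id (ideal_of {r23 * r13 - r14 * r24})"
  (is "prime_id (ideal_of {?s * _ - ?p})")
proof (rule prime_principal_linear[of "(\<lambda>_. 0)((2, 3) := 1)"])
  show "nzd_mod ?p (ideal_of {?s})"
    by ((rule nzd_mod_graph[of _ 2 3 "0"
        "(\<lambda>_. 0)((1, 4) := 2, (2, 4) := 1)"]; simp add: free_of_rvar))
qed (simp_all add: free_of_rvar)

lemma prime_12c3_12c4:
  "prime_id (ideal_of (minors_of [(1,2,[3]), (1,2,[4])]))"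
  by (simp add: minors_of_simps,
    rule prime_graph[of 1 2 "r13 * r23"], simp add: poly_simps,
    rule prime_id_cong[OF prime_reduced_12c3_12c4]; simp add: poly_simps)

lemma prime_reduced_12c3_13c24:
  "prime_id (ideal_of {(r23 * r24 - r34) * r14 - (r13 * r23^2 - r13 * r23 * r24 * r34 + r13 * r24^2
      - r13)})"
  (is "prime_id (ideal_of {?s * _ - ?p})")
proof (rule prime_principal_linear[of "(\<lambda>_. 0)((3, 4) := 2)"])
  show "nzd_mod ?p (ideal_of {?s})"
    by ((rule nzd_mod_graph[of _ 3 4 "r23 * r24"
        "(\<lambda>_. 0)((1, 3) := -1)"]; simp add: free_of_rvar))
qed (simp_all add: free_of_rvar)

lemma prime_12c3_13c24:
  "prime_id (ideal_of (minors_of [(1,2,[3]), (1,3,[2,4])]))"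
  by (simp add: minors_of_simps,
    rule prime_graph[of 1 2 "r13 * r23"], simp add: poly_simps,
    rule prime_id_cong[OF prime_reduced_12c3_13c24]; simp add: poly_simps)

lemma prime_reduced_12c3_34c12:
  "prime_id (ideal_of {r13 * (1 - r23) * (- r23 - 1) * r14 - (r13^2 * r23^2 * r34
      - r13^2 * r23 * r24 + r23 * r24 - r34)})"
  (is "prime_id (ideal_of {?s * _ - ?p})")
proof (rule prime_principal_linear[of "(\<lambda>_. 0)((1, 3) := 2)"])
  show "nzd_mod ?p (ideal_of {?s})"
    by (rule nzd_mod_principal_mult[of "(\<lambda>_. 0)((1, 3) := 2)"], simp,
      rule nzd_mod_principal_mult[of "(\<lambda>_. 0)((1, 3) := 2)"], simp,
      (rule nzd_mod_graph[of _ 1 3 "0"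
        "(\<lambda>_. 0)((3, 4) := 1)"]; simp add: free_of_rvar),
      (rule nzd_mod_graph[of _ 2 3 "1"
        "(\<lambda>_. 0)((2, 3) := 1, (3, 4) := -1)"]; simp add: free_of_rvar),
      (rule nzd_mod_graph[of _ 2 3 "- 1"
        "(\<lambda>_. 0)((2, 3) := -1, (3, 4) := -1)"]; simp add: free_of_rvar))
qed (simp_all add: free_of_rvar)

lemma prime_12c3_34c12:
  "prime_id (ideal_of (minors_of [(1,2,[3]), (3,4,[1,2])]))"
  by (simp add: minors_of_simps,
    rule prime_graph[of 1 2 "r13 * r23"], simp add: poly_simps,
    rule prime_id_cong[OF prime_reduced_12c3_34c12]; simp add: poly_simps)

lemma prime_reduced_12_12c34_34:
  "prime_id (ideal_of {(- r23) * r13 - r14 * r24})"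
  (is "prime_id (ideal_of {?s * _ - ?p})")
proof (rule prime_principal_linear[of "(\<lambda>_. 0)((2, 3) := 1)"])
  show "nzd_mod ?p (ideal_of {?s})"
    by ((rule nzd_mod_graph[of _ 2 3 "0"
        "(\<lambda>_. 0)((1, 4) := 2, (2, 4) := 1)"]; simp add: free_of_rvar))
qed (simp_all add: free_of_rvar)

lemma prime_12_12c34_34:
  "prime_id (ideal_of (minors_of [(1,2,[]), (1,2,[3,4]), (3,4,[])]))"
  by (simp add: minors_of_simps,
    rule prime_graph[of 1 2 0], simp add: poly_simps,
    rule prime_graph[of 3 4 0], simp add: poly_simps,
    rule prime_id_cong[OF prime_reduced_12_12c34_34]; simp add: poly_simps)

lemma prime_reduced_12_12c34_34c1:
  "prime_id (ideal_of {r13 * (1 - r14) * (- r14 - 1) * r23 - (r14 * r24 - r13^2 * r14 * r24)})"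
  (is "prime_id (ideal_of {?s * _ - ?p})")
proof (rule prime_principal_linear[of "(\<lambda>_. 0)((1, 3) := 2)"])
  show "nzd_mod ?p (ideal_of {?s})"
    by (rule nzd_mod_principal_mult[of "(\<lambda>_. 0)((1, 3) := 2)"], simp,
      rule nzd_mod_principal_mult[of "(\<lambda>_. 0)((1, 3) := 2)"], simp,
      (rule nzd_mod_graph[of _ 1 3 "0"
        "(\<lambda>_. 0)((1, 4) := -1, (2, 4) := 2)"]; simp add: free_of_rvar),
      (rule nzd_mod_graph[of _ 1 4 "1"
        "(\<lambda>_. 0)((1, 4) := 1, (2, 4) := 1)"]; simp add: free_of_rvar),
      (rule nzd_mod_graph[of _ 1 4 "- 1"
        "(\<lambda>_. 0)((1, 4) := -1, (2, 4) := 2)"]; simp add: free_of_rvar))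
qed (simp_all add: free_of_rvar)

lemma prime_12_12c34_34c1:
  "prime_id (ideal_of (minors_of [(1,2,[]), (1,2,[3,4]), (3,4,[1])]))"
  by (simp add: minors_of_simps,
    rule prime_graph[of 1 2 0], simp add: poly_simps,
    rule prime_graph[of 3 4 "r13 * r14"], simp add: poly_simps,
    rule prime_id_cong[OF prime_reduced_12_12c34_34c1]; simp add: poly_simps)

lemma prime_reduced_12_13c4_24c13:
  "prime_id (ideal_of {r34 * (1 - r14) * (- r14 - 1) * r23 - (r14^2 * r24 * r34^2 - r24)})"
  (is "prime_id (ideal_of {?s * _ - ?p})")
proof (rule prime_principal_linear[of "(\<lambda>_. 0)((3, 4) := 2)"])
  show "nzd_mod ?p (ideal_of {?s})"
    by (rule nzd_mod_principal_mult[of "(\<lambda>_. 0)((3, 4) := 2)"], simp,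
      rule nzd_mod_principal_mult[of "(\<lambda>_. 0)((3, 4) := 2)"], simp,
      (rule nzd_mod_graph[of _ 3 4 "0"
        "(\<lambda>_. 0)((2, 4) := 2)"]; simp add: free_of_rvar),
      (rule nzd_mod_graph[of _ 1 4 "1"
        "(\<lambda>_. 0)((1, 4) := 1, (2, 4) := 1)"]; simp add: free_of_rvar),
      (rule nzd_mod_graph[of _ 1 4 "- 1"
        "(\<lambda>_. 0)((1, 4) := -1, (2, 4) := 2)"]; simp add: free_of_rvar))
qed (simp_all add: free_of_rvar)

lemma prime_12_13c4_24c13:
  "prime_id (ideal_of (minors_of [(1,2,[]), (1,3,[4]), (2,4,[1,3])]))"
  by (simp add: minors_of_simps,
    rule prime_graph[of 1 2 0], simp add: poly_simps,
    rule prime_graph[of 1 3 "r14 * r34"], simp add: poly_simps,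
    rule prime_id_cong[OF prime_reduced_12_13c4_24c13]; simp add: poly_simps)

lemma prime_reduced_12_13c4_34c12:
  "prime_id (ideal_of {(- r24) * r23 - (r14^2 * r34 - r34)})"
  (is "prime_id (ideal_of {?s * _ - ?p})")
proof (rule prime_principal_linear[of "(\<lambda>_. 0)((2, 4) := 1)"])
  show "nzd_mod ?p (ideal_of {?s})"
    by ((rule nzd_mod_graph[of _ 2 4 "0"
        "(\<lambda>_. 0)((3, 4) := -1)"]; simp add: free_of_rvar))
qed (simp_all add: free_of_rvar)

lemma prime_12_13c4_34c12:
  "prime_id (ideal_of (minors_of [(1,2,[]), (1,3,[4]), (3,4,[1,2])]))"
  by (simp add: minors_of_simps,
    rule prime_graph[of 1 2 0], simp add: poly_simps,
    rule prime_graph[of 1 3 "r14 * r34"], simp add: poly_simps,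
    rule prime_id_cong[OF prime_reduced_12_13c4_34c12]; simp add: poly_simps)

lemma prime_reduced_12_13c24_34:
  "prime_id (ideal_of {r23 * r24 * r14 - (r13 * r24^2 - r13)})"
  (is "prime_id (ideal_of {?s * _ - ?p})")
proof (rule prime_principal_linear[of "(\<lambda>_. 0)((2, 3) := 1, (2, 4) := 1)"])
  show "nzd_mod ?p (ideal_of {?s})"
    by (rule nzd_mod_principal_mult[of "(\<lambda>_. 0)((2, 3) := 1, (2, 4) := 1)"], simp,
      (rule nzd_mod_graph[of _ 2 3 "0"
        "(\<lambda>_. 0)((1, 3) := -1)"]; simp add: free_of_rvar),
      (rule nzd_mod_graph[of _ 2 4 "0"
        "(\<lambda>_. 0)((1, 3) := 1)"]; simp add: free_of_rvar))
qed (simp_all add: free_of_rvar)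

lemma prime_12_13c24_34:
  "prime_id (ideal_of (minors_of [(1,2,[]), (1,3,[2,4]), (3,4,[])]))"
  by (simp add: minors_of_simps,
    rule prime_graph[of 1 2 0], simp add: poly_simps,
    rule prime_graph[of 3 4 0], simp add: poly_simps,
    rule prime_id_cong[OF prime_reduced_12_13c24_34]; simp add: poly_simps)

lemma prime_reduced_12_13c24_34c1:
  "prime_id (ideal_of {r14 * r24 * r23 - (r13 * r14^2 + r13 * r24^2 - r13)})"
  (is "prime_id (ideal_of {?s * _ - ?p})")
proof (rule prime_principal_linear[of "(\<lambda>_. 0)((1, 4) := 2, (2, 4) := 1)"])
  show "nzd_mod ?p (ideal_of {?s})"
    by (rule nzd_mod_principal_mult[of "(\<lambda>_. 0)((1, 4) := 2, (2, 4) := 1)"], simp,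
      (rule nzd_mod_graph[of _ 1 4 "0"
        "(\<lambda>_. 0)((1, 3) := 1)"]; simp add: free_of_rvar),
      (rule nzd_mod_graph[of _ 2 4 "0"
        "(\<lambda>_. 0)((1, 3) := 1)"]; simp add: free_of_rvar))
qed (simp_all add: free_of_rvar)

lemma prime_12_13c24_34c1:
  "prime_id (ideal_of (minors_of [(1,2,[]), (1,3,[2,4]), (3,4,[1])]))"
  by (simp add: minors_of_simps,
    rule prime_graph[of 1 2 0], simp add: poly_simps,
    rule prime_graph[of 3 4 "r13 * r14"], simp add: poly_simps,
    rule prime_id_cong[OF prime_reduced_12_13c24_34c1]; simp add: poly_simps)

lemma prime_reduced_12_34c1_34c2:
  "prime_id (ideal_of {r14 * r13 - r23 * r24})"
  (is "prime_id (ideal_of {?s * _ - ?p})")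
proof (rule prime_principal_linear[of "(\<lambda>_. 0)((1, 4) := 2)"])
  show "nzd_mod ?p (ideal_of {?s})"
    by ((rule nzd_mod_graph[of _ 1 4 "0"
        "(\<lambda>_. 0)((2, 3) := 1, (2, 4) := 1)"]; simp add: free_of_rvar))
qed (simp_all add: free_of_rvar)

lemma prime_12_34c1_34c2:
  "prime_id (ideal_of (minors_of [(1,2,[]), (3,4,[1]), (3,4,[2])]))"
  by (simp add: minors_of_simps,
    rule prime_graph[of 1 2 0], simp add: poly_simps,
    rule prime_graph[of 3 4 "r13 * r14"], simp add: poly_simps,
    rule prime_id_cong[OF prime_reduced_12_34c1_34c2]; simp add: poly_simps)

lemma prime_12c3_12c4_34c1:
  "prime_id (ideal_of (minors_of [(1,2,[3]), (1,2,[4]), (3,4,[1])]))"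
  by (simp add: minors_of_simps,
    rule prime_graph[of 1 2 "r13 * r23"], simp add: poly_simps,
    rule prime_graph[of 3 4 "r13 * r14"], simp add: poly_simps,
    rule prime_id_cong[OF prime_reduced_12c3_12c4]; simp add: poly_simps)

lemma prime_reduced_12_13_23c14:
  "prime_id (ideal_of {(- r34) * r24 - (r14^2 * r23 - r23)})"
  (is "prime_id (ideal_of {?s * _ - ?p})")
proof (rule prime_principal_linear[of "(\<lambda>_. 0)((3, 4) := 2)"])
  show "nzd_mod ?p (ideal_of {?s})"
    by ((rule nzd_mod_graph[of _ 3 4 "0"
        "(\<lambda>_. 0)((2, 3) := 1)"]; simp add: free_of_rvar))
qed (simp_all add: free_of_rvar)

lemma prime_12_13_23c14:
  "prime_id (ideal_of (minors_of [(1,2,[]), (1,2,[3]), (1,3,[]), (1,3,[2]), (2,3,[1,4])]))"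
  by (simp add: minors_of_simps,
    rule prime_graph[of 1 2 0], simp add: poly_simps,
    rule prime_graph[of 1 3 0], simp add: poly_simps,
    rule prime_id_cong[OF prime_reduced_12_13_23c14]; simp add: poly_simps)

text \<open>
  Linear in the second factor, with a unit as right-hand side.
\<close>

lemma prime_hyperbola:
  assumes "i \<noteq> k \<or> j \<noteq> l"
  shows "prime_id (ideal_of {rvar i j * rvar k l - 1})" "prime_id (ideal_of {rvar i j * rvar k l
      + 1})"
proof -
  have "prime_id (ideal_of {rvar i j * rvar k l - 1})" "prime_id (ideal_of {rvar i j * rvar k l
      - (- 1)})"
    by (rule prime_principal_linear[of "\<lambda>_. 1"];
        use assms nzd_mod_one in \<open>auto simp: free_of_rvar nzd_mod_def idl.span_neg dest: idl.span_neg\<close>)+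
  then show "prime_id (ideal_of {rvar i j * rvar k l
      - 1})" "prime_id (ideal_of {rvar i j * rvar k l + 1})"
    by simp_all
qed

lemma prime_reduced_12c3_13c4_34c12: "prime_id (ideal_of {r23 * (r34 * r14 - 1) * (r34 * r14
    + 1) * r24
    - (r14^2 * r23^2 * r34^3 - r14^2 * r23^2 * r34 + r14^2 * r34
        - r34)})" (is "prime_id (ideal_of {?s * r24 - ?p})")
proof (rule prime_principal_linear[of "(\<lambda>_. 0)((2, 3) := 1)"])
  show "nzd_mod ?p (ideal_of {?s})"
  proof (intro nzd_mod_principal_mult[of "(\<lambda>_. 0)((2, 3) := 1)"])
    show "nzd_mod ?p (ideal_of {r23})"
      by (rule nzd_mod_graph[of _ 2 3 0 "(\<lambda>_. 0)((3, 4) := 1)"]) simp_all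
    show "nzd_mod ?p (ideal_of {r34 * r14 - 1})"
      by (rule nzd_mod_by_point[of _ "(\<lambda>_. 0)((1, 4) := 1/2, (3, 4) := 2)"])
        (simp_all add: prime_hyperbola power2_eq_square)
    show "nzd_mod ?p (ideal_of {r34 * r14 + 1})"
      by (rule nzd_mod_by_point[of _ "(\<lambda>_. 0)((1, 4) := - 1/2, (3, 4) := 2)"])
        (simp_all add: prime_hyperbola power2_eq_square)
  qed simp_all
qed (simp_all add: free_of_rvar)

lemma prime_12c3_13c4_34c12: "prime_id (ideal_of (minors_of [(1,2,[3]), (1,3,[4]), (3,4,[1,2])]))"
  by (simp add: minors_of_simps,
    rule prime_graph[of 1 2 "r13 * r23"], simp add: algebra_simps power2_eq_square,
    rule prime_graph[of 1 3 "r14 * r34"], simp add: algebra_simps power2_eq_square,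
    rule prime_id_cong[OF prime_reduced_12c3_13c4_34c12]; simp add: poly_simps)

text \<open>
  On each of the two hypersurfaces \<open>r23 * r13 = e\<close> the equation \<open>r23 * r13 = r14 * r24\<close> becomes a
  second hyperbola.
\<close>

lemma prime_two_hyperbolas:
  assumes e: "e = 1 \<or> e = - 1"
  shows "prime_id (ideal_of {r23 * r13 - e, r23 * r13 - r14 * r24})"
proof -
  have e1: "prime_id (ideal_of {r23 * r13 - e})"
    using e prime_hyperbola[of 2 1 3 3] by auto
  have "prime_id (ideal_of (insert (r24 * r14 - e) {r23 * r13 - e}))"
  proof (rule prime_linear[OF e1])
    show "r24 \<notin> ideal_of {r23 * r13 - e}"
      by (rule not_in_ideal_of[of _ "(\<lambda>_. 1)((1, 3) := eval_at (\<lambda>_. 1) e)"]) (use e in auto)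
    have "e * e = 1" using e by auto
    then have "a \<in> ideal_of (insert r24 {r23 * r13 - e})" if "a * e \<in> ideal_of (insert r24 {r23 * r13 - e})" for a
      using ideal_of_mult_right[OF that, of e] by (simp add: mult.assoc)
    then show "nzd_mod e (ideal_of (insert r24 {r23 * r13 - e}))"
      by (simp add: nzd_mod_def)
  qed (use e in \<open>auto simp: free_of_rvar\<close>)
  also have "ideal_of (insert (r24 * r14 - e) {r23 * r13 - e}) = ideal_of {r23 * r13 - e, r23 * r13
      - r14 * r24}"
    by (rule ideal_of_replace[of _ 1, symmetric]) simp
  finally show ?thesis .
qed

lemma prime_reduced_12c3_12c4_34c12: "prime_id (ideal_of {(r23 * r13 - 1) * (r23 * r13 + 1) * r34
     - (r13 * r14 * r23^2 + r13^2 * r23 * r24 - r13 * r14 - r23 * r24), r23 * r13 - r14 * r24})"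
  (is "prime_id (ideal_of {?s * r34 - ?p, ?j})")
proof (rule prime_linear)
  show J: "prime_id (ideal_of {?j})" by (rule prime_reduced_12c3_12c4)
  show "?s \<notin> ideal_of {?j}"
    by (rule not_in_ideal_of[of _ "\<lambda>_. 0"]) simp_all
  show "nzd_mod ?p (ideal_of (insert ?s {?j}))"
  proof (rule nzd_mod_product_ideal)
    show "nzd_mod ?p (ideal_of {r23 * r13 - 1, ?j})"
      by (rule nzd_mod_by_point[OF prime_two_hyperbolas, of _
            "(\<lambda>_. 0)((1, 3) := 2, (2, 3) := 1/2, (1, 4) := 2, (2, 4) := 1/2)"]) (simp_all add: power2_eq_square)
    have "nzd_mod ?p (ideal_of {r23 * r13 - (- 1), ?j})"
      by (rule nzd_mod_by_point[OF prime_two_hyperbolas, of _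
            "(\<lambda>_. 0)((1, 3) := 2, (2, 3) := - 1/2, (1, 4) := 2, (2, 4) := - 1/2)"]) (simp_all add: power2_eq_square)
    then show "nzd_mod ?p (ideal_of {r23 * r13 + 1, ?j})" by simp
    show "nzd_mod (r23 * r13 - 1) (ideal_of {?j})"
      by (rule nzd_mod_by_point[OF J, of "\<lambda>_. 0"]) simp_all
  qed
qed (simp_all add: free_of_rvar)

lemma prime_12c3_12c4_34c12: "prime_id (ideal_of (minors_of [(1,2,[3]), (1,2,[4]), (3,4,[1,2])]))"
  by (simp add: minors_of_simps,
    rule prime_graph[of 1 2 "r13 * r23"], simp add: algebra_simps power2_eq_square,
    rule prime_id_cong[OF prime_reduced_12c3_12c4_34c12]; simp add: poly_simps)

section \<open>Relations with one further quadratic equation\<close>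

text \<open>
  The point given to \<open>prime_quadratic\<close> is one where the discriminant is negative.
\<close>

lemma prime_reduced_12_12c34_34c12: "prime_id (ideal_of {(r14 * r24) * r13^2 + (r23 * (r14^2
    + r24^2 - 1)) * r13
    + r14 * r24 * (r23^2 - 1)})" (is "prime_id (ideal_of {?f})")
proof (rule prime_quadratic[of "(\<lambda>_. 0)((1, 4) := 1, (2, 4) := 1, (2, 3) := 2)"])
  show "r14 * r24 \<noteq> 0"
    by (rule nonzero_by_point[of "\<lambda>_. 1"]) simp
  show "nzd_mod ?f (ideal_of {r14 * r24})"
    by (rule nzd_mod_principal_mult[of "\<lambda>_. 1"], simp,
      (rule nzd_mod_graph[of _ 1 4 0 "(\<lambda>_. 0)((1, 3) := 1, (2, 3) := 1)"]; simp),
      (rule nzd_mod_graph[of _ 2 4 0 "(\<lambda>_. 0)((1, 3) := 1, (2, 3) := 1)"]; simp))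
qed (simp_all add: free_of_rvar)

lemma prime_12_12c34_34c12: "prime_id (ideal_of (minors_of [(1,2,[]), (1,2,[3,4]), (3,4,[1,2])]))"
  by (simp add: minors_of_simps,
    rule prime_graph[of 1 2 0], simp,
    rule prime_graph[of 3 4 "r13 * r14 + r23 * r24"], simp add: algebra_simps power2_eq_square,
    rule prime_id_cong[OF prime_reduced_12_12c34_34c12]; simp add: poly_simps)

lemma prime_reduced_12c3_13c24_34c1: "prime_id (ideal_of {(- r13) * r14^2 + (r23 * r24 * (1
    + r13^2)) * r14
    + r13 * (1 - r23^2 - r24^2)})" (is "prime_id (ideal_of {?f})")
proof (rule prime_quadratic[of "(\<lambda>_. 0)((1, 3) := 1, (2, 3) := 2)"])
  show "- r13 \<noteq> 0"
    by (rule nonzero_by_point[of "\<lambda>_. 1"]) simp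
  show "nzd_mod ?f (ideal_of {- r13})"
    by (rule nzd_mod_graph[of _ 1 3 0 "(\<lambda>_. 1)((1, 3) := 0)"]) simp_all
qed (simp_all add: free_of_rvar)

lemma prime_12c3_13c24_34c1: "prime_id (ideal_of (minors_of [(1,2,[3]), (1,3,[2,4]), (3,4,[1])]))"
  by (simp add: minors_of_simps,
    rule prime_graph[of 1 2 "r13 * r23"], simp,
    rule prime_graph[of 3 4 "r13 * r14"], simp,
    rule prime_id_cong[OF prime_reduced_12c3_13c24_34c1]; simp add: poly_simps)

section \<open>Relations with two further linear equations\<close>

text \<open>
  Eliminating the indeterminate from \<open>f\<close> and \<open>h\<close>, both linear in it, leaves \<open>Q\<close>. Up to saturation by
  \<open>s\<close> the ideal is generated by \<open>Q\<close> and \<open>f\<close>. That \<open>s\<close> is a nonzerodivisor follows by moving it past \<open>f\<close>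
  and then past \<open>h\<close>; \<open>g\<close> is what \<open>f\<close> becomes modulo \<open>s\<close>.
\<close>

lemma prime_two_linear_equations:
  assumes Q: "prime_id (ideal_of {Q})" "eval_at q Q = 0" "eval_at q s \<noteq> 0" "free_of (i, j) Q"
    and f: "free_of (i, j) s" "free_of (i, j) p" "f = s * rvar i j - p"
    and rel: "Q = s * h - k * f"
    and s: "nzd_mod f (ideal_of {s})" and fs: "ideal_of {s, f} = ideal_of {g, s}"
    and h: "nzd_mod h (ideal_of {g, s})"
  shows "prime_id (ideal_of {f, h})"
proof (rule prime_by_elimination[OF Q(1)])
  show "s \<notin> ideal_of {Q}"
    by (rule not_in_ideal_of[of _ q]) (use Q in simp_all)
  have "s * h - k * f \<in> ideal_of {f, h}"
    by (intro idl.span_diff ideal_of_mult_left idl.span_base) simp_all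
  then show "\<forall>g\<in>{Q}. g \<in> ideal_of {f, h}" by (simp add: rel)
  show "s * rvar i j - p \<in> ideal_of {f, h}"
    unfolding f(3)[symmetric] by (rule idl.span_base) simp
  have "Q + k * f \<in> ideal_of (insert f {Q})"
    by (intro idl.span_add ideal_of_mult_left idl.span_base) simp_all
  then have "s ^ 1 * h \<in> ideal_of (insert f {Q})" by (simp add: rel)
  then have "h \<in> saturation (ideal_of (insert f {Q})) s"
    unfolding saturation_def by blast
  then show "\<forall>g\<in>{f, h}. g \<in> saturation (ideal_of (insert (s * rvar i j - p) {Q})) s"
    unfolding f(3)[symmetric] by (simp add: in_saturation_base)
  have "s \<noteq> 0" using Q(3) by auto
  then have "nzd_mod s (ideal_of {f})"
    using nzd_mod_swap[OF nzd_mod_zero_ideal s] by simp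
  then have "nzd_mod s (ideal_of (insert h {f}))"
    by (rule nzd_mod_swap) (use fs h in simp)
  then show "nzd_mod s (ideal_of {f, h})" by (simp add: insert_commute)
qed (use Q f in simp_all)

text \<open>
  The result of eliminating \<open>r34\<close> from the two equations below.
\<close>

lemma prime_quadric_12_13c24_24c13: "prime_id (ideal_of {(r14 * r24) * r13^2 + (r23 * (1 - r14^2
    - r24^2)) * r13
    + r14 * r24 * (r23^2 - 1)})" (is "prime_id (ideal_of {?f})")
proof (rule prime_quadratic[of "(\<lambda>_. 0)((1, 4) := 1, (2, 4) := 1, (2, 3) := 2)"])
  show "r14 * r24 \<noteq> 0"
    by (rule nonzero_by_point[of "\<lambda>_. 1"]) simp
  show "nzd_mod ?f (ideal_of {r14 * r24})"
    by (rule nzd_mod_principal_mult[of "\<lambda>_. 1"], simp,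
      (rule nzd_mod_graph[of _ 1 4 0 "(\<lambda>_. 0)((1, 3) := 1, (2, 3) := 1)"]; simp),
      (rule nzd_mod_graph[of _ 2 4 0 "(\<lambda>_. 0)((1, 3) := 1, (2, 3) := 1)"]; simp))
qed (simp_all add: free_of_rvar)

lemma prime_reduced_12_13c24_24c13: "prime_id (ideal_of {r14 * r34 - (r13 - r13 * r24^2
    + r14 * r23 * r24),
    r23 * r34 - (r24 - r24 * r13^2 + r13 * r14 * r23)})"
  (is "prime_id (ideal_of {?f, ?h})")
proof (rule prime_two_linear_equations[OF prime_quadric_12_13c24_24c13, where k = r23 and q = "(\<lambda>_. 0)((1, 4) := 1)"])
  show "nzd_mod ?f (ideal_of {r14})"
    by (rule nzd_mod_graph[of _ 1 4 0 "(\<lambda>_. 0)((1, 3) := 1)"]) simp_all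
  show "ideal_of {r14, ?f} = ideal_of {r13 * (r24 - 1) * (r24 + 1), r14}"
    by (rule ideal_of_replace[of _ "r34 - r23 * r24"]) (simp add: algebra_simps power2_eq_square)
  have "prime_id (ideal_of {r13, r14})" "prime_id (ideal_of {r24 - 1,
      r14})" "prime_id (ideal_of {r24 + 1, r14})"
    subgoal by (rule prime_two_graphs[of _ 1 4 0 _ 1 3 0]; simp add: free_of_rvar)
    subgoal by (rule prime_two_graphs[of _ 1 4 0 _ 2 4 1]; simp add: free_of_rvar)
    subgoal by (rule prime_two_graphs[of _ 1 4 0 _ 2 4 "- 1"]; simp add: free_of_rvar)
    done
  note primes = this
  have h1: "nzd_mod ?h (ideal_of {r13, r14})"
    by (rule nzd_mod_by_point[OF primes(1), of "(\<lambda>_. 0)((2, 4) := 1)"]) simp_all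
  have h2: "nzd_mod ?h (ideal_of {r24 - 1, r14})"
    by (rule nzd_mod_by_point[OF primes(2), of "(\<lambda>_. 0)((2, 4) := 1)"]) simp_all
  have h3: "nzd_mod ?h (ideal_of {r24 + 1, r14})"
    by (rule nzd_mod_by_point[OF primes(3), of "(\<lambda>_. 0)((2, 4) := - 1)"]) simp_all
  have "nzd_mod r13 (ideal_of {r14})" "nzd_mod (r13 * (r24 - 1)) (ideal_of {r14})"
    by (rule nzd_mod_graph[of _ 1 4 0 "(\<lambda>_. 0)((1, 3) := 1)"]; simp)+
  then show "nzd_mod ?h (ideal_of {r13 * (r24 - 1) * (r24 + 1), r14})"
    by (intro nzd_mod_product_ideal h1 h2 h3)
qed (simp_all add: free_of_rvar, simp add: algebra_simps power2_eq_square)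

lemma prime_12_13c24_24c13: "prime_id (ideal_of (minors_of [(1,2,[]), (1,3,[2,4]), (2,4,[1,3])]))"
  by (simp add: minors_of_simps,
    rule prime_graph[of 1 2 0], simp,
    rule prime_id_cong[OF prime_reduced_12_13c24_24c13]; simp add: poly_simps)

text \<open>
  The result of eliminating \<open>r13\<close> from the two equations below.
\<close>

lemma prime_quadric_12c34_34c12: "prime_id (ideal_of {(r34 * r23 - r24) * r14^2 + (r12 * (1 + r24^2
    - r34^2 - r23^2)) * r14
    + ((r34 * r24 - r23) * (r34 * (1 - r12^2) - r23 * r24) - r12^2 * r24 * (1 - r34^2))})"
  (is "prime_id (ideal_of {?f})")
proof (rule prime_quadratic[of "(\<lambda>_. 0)((1, 2) := 2, (2, 3) := 1, (2, 4) := 1)"])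
  show "r34 * r23 - r24 \<noteq> 0"
    by (rule nonzero_by_point[of "(\<lambda>_. 0)((2, 4) := 1)"]) simp
  show "nzd_mod ?f (ideal_of {r34 * r23 - r24})"
    by (rule nzd_mod_graph[of _ 2 4 "r34 * r23" "(\<lambda>_. 0)((1, 2) := 1, (1, 4) := 1)"])
      (simp_all add: free_of_rvar)
qed (simp_all add: free_of_rvar)

lemma prime_reduced_12c34_34c12: "prime_id (ideal_of {(r34 * r24 - r23) * r13 - (r14 * r24
    - r34 * r14 * r23 - r12 * (1 - r34^2)),
   r34 * (1 - r12^2) - r13 * r14 - r23 * r24 + r12 * (r13 * r24 + r23 * r14)})"
  (is "prime_id (ideal_of {?f, ?h})")
proof (rule prime_two_linear_equations[OF prime_quadric_12c34_34c12, where k = "r12 * r24 - r14" and q = "(\<lambda>_. 0)((2, 3) := 1)"])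
  show "nzd_mod ?f (ideal_of {r34 * r24 - r23})"
    by (rule nzd_mod_graph[of _ 2 3 "r34 * r24" "(\<lambda>_. 0)((1, 2) := 1)"]) (simp_all add: free_of_rvar)
  show "ideal_of {r34 * r24 - r23, ?f} = ideal_of {(r34 - 1) * (r34 + 1) * (r12 - r14 * r24),
      r34 * r24 - r23}"
    by (rule ideal_of_replace[of _ "r13 - r34 * r14"]) (simp add: algebra_simps power2_eq_square)
  have "prime_id (ideal_of {r34 - 1, r34 * r24 - r23})" "prime_id (ideal_of {r34 + 1, r34 * r24
      - r23})"
     "prime_id (ideal_of {r12 - r14 * r24, r34 * r24 - r23})"
    subgoal by (rule prime_two_graphs[of _ 2 3 "r34 * r24" _ 3 4 1]; simp add: free_of_rvar)
    subgoal by (rule prime_two_graphs[of _ 2 3 "r34 * r24" _ 3 4 "- 1"]; simp add: free_of_rvar)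
    subgoal by (rule prime_two_graphs[of _ 2 3 "r34 * r24" _ 1 2 "r14 * r24"]; simp add: free_of_rvar)
    done
  note primes = this
  have h1: "nzd_mod ?h (ideal_of {r34 - 1, r34 * r24 - r23})"
    by (rule nzd_mod_by_point[OF primes(1), of "(\<lambda>_. 0)((3, 4) := 1)"]) simp_all
  have h2: "nzd_mod ?h (ideal_of {r34 + 1, r34 * r24 - r23})"
    by (rule nzd_mod_by_point[OF primes(2), of "(\<lambda>_. 0)((3, 4) := - 1)"]) simp_all
  have h3: "nzd_mod ?h (ideal_of {r12 - r14 * r24, r34 * r24 - r23})"
    by (rule nzd_mod_by_point[OF primes(3), of "(\<lambda>_. 0)((3, 4) := 2)"]) simp_all
  have "nzd_mod (r34 - 1) (ideal_of {r34 * r24 - r23})" "nzd_mod ((r34 - 1) * (r34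
      + 1)) (ideal_of {r34 * r24 - r23})"
    by (rule nzd_mod_graph[of _ 2 3 "r34 * r24" "\<lambda>_. 0"]; simp add: free_of_rvar)+
  then show "nzd_mod ?h (ideal_of {(r34 - 1) * (r34 + 1) * (r12 - r14 * r24), r34 * r24 - r23})"
    by (intro nzd_mod_product_ideal h1 h2 h3)
qed (simp_all add: free_of_rvar, simp add: algebra_simps power2_eq_square)

lemma prime_12c34_34c12: "prime_id (ideal_of (minors_of [(1,2,[3,4]), (3,4,[1,2])]))"
  by (rule prime_id_cong[OF prime_reduced_12c34_34c12]; simp add: minors_of_simps poly_simps)

section \<open>The four exceptions\<close>

text \<open>
  The variety of the ideal has a component on which the first factor of the product vanishes and one on
  which the second does.
\<close>

lemma ideal_of_substitution:
  assumes "rvar i j - p \<in> G" "subst_var (i, j) p f \<in> ideal_of (subst_var (i, j) p ` G)"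
  shows "f \<in> ideal_of G"
  using ideal_of_substitution_iff[OF idl.span_base[OF assms(1)]] assms(2) by blast

text \<open>
  The points \<open>q\<close> and \<open>q'\<close> are real zeros of the ideal at which \<open>f\<close>, respectively \<open>g\<close>, does not vanish.
\<close>

lemma not_prime_on_carrierI:
  assumes "f \<in> corr_carrier" "g \<in> corr_carrier" "f * g \<in> ideal_of G"
    and "\<forall>x\<in>G. eval_at q x = 0" "eval_at q f \<noteq> 0" "\<forall>x\<in>G. eval_at q' x = 0" "eval_at q' g \<noteq> 0"
  shows "\<not> prime_on_carrier (ideal_of G)"
proof -
  have "f \<notin> ideal_of G" "g \<notin> ideal_of G"
    using not_in_ideal_of[of G q f] not_in_ideal_of[of G q' g] assms by blast+
  with assms(1-3) show ?thesis by (auto simp: prime_on_carrier_def)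
qed

lemma combination_in_ideal: "a \<in> G \<Longrightarrow> b \<in> G \<Longrightarrow> c = u * a + v * b \<Longrightarrow> c \<in> ideal_of G"
  by (simp add: idl.span_add idl.span_base ideal_of_mult_left)

lemma not_prime_L15: "\<not> prime_on_carrier (ideal_of (minors_of [(1,4,[]), (1,4,[2,3]), (2,3,[]),
    (2,3,[1,4])]))"
proof (rule not_prime_on_carrierI)
  show "r24 * (r12^2 - r34^2) \<in> ideal_of (minors_of [(1,4,[]), (1,4,[2,3]), (2,3,[]), (2,3,[1,4])])"
    by (simp add: minors_of_simps,
      rule ideal_of_substitution[of 1 4 0], simp,
      rule ideal_of_substitution[of 2 3 0], simp,
      rule combination_in_ideal[of "- (r12 * r24) - r13 * r34" _ "- (r12 * r13) - r24 * r34" _ "- r12" r34];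
      simp add: algebra_simps power2_eq_square)
  show "\<forall>x\<in>minors_of [(1,4,[]), (1,4,[2,3]), (2,3,[]), (2,3,[1,4])].
      eval_at ((\<lambda>_. 0)((1, 2) := 1, (3, 4) := 1, (2, 4) := 1, (1, 3) := - 1)) x = 0"
    by (simp add: minors_of_simps)
  show "\<forall>x\<in>minors_of [(1,4,[]), (1,4,[2,3]), (2,3,[]), (2,3,[1,4])].
      eval_at ((\<lambda>_. 0)((1, 2) := 1)) x = 0"
    by (simp add: minors_of_simps)
qed (simp_all add: corr_carrier_closed corr_carrier_diff power2_eq_square)

lemma not_prime_L24: "\<not> prime_on_carrier (ideal_of (minors_of [(1,2,[]), (2,3,[1,4]), (2,4,[3])]))"
proof (rule not_prime_on_carrierI)
  show "r23 * (1 - r14^2 - r34^2 + r13 * r14 * r34) \<in> ideal_of (minors_of [(1,2,[]), (2,3,[1,4]),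
      (2,4,[3])])"
    by (simp add: minors_of_simps,
      rule ideal_of_substitution[of 1 2 0], simp,
      rule ideal_of_substitution[of 2 4 "r23 * r34"], simp,
      rule idl.span_base, simp add: algebra_simps power2_eq_square)
  show "\<forall>x\<in>minors_of [(1,2,[]), (2,3,[1,4]), (2,4,[3])]. eval_at ((\<lambda>_. 0)((1, 4) := 1,
      (2, 3) := 1)) x = 0"
    by (simp add: minors_of_simps)
  show "\<forall>x\<in>minors_of [(1,2,[]), (2,3,[1,4]), (2,4,[3])]. eval_at (\<lambda>_. 0) x = 0"
    by (simp add: minors_of_simps)
qed (simp_all add: corr_carrier_closed corr_carrier_diff power2_eq_square)

lemma not_prime_L28: "\<not> prime_on_carrier (ideal_of (minors_of [(1,3,[2]), (1,4,[]), (2,3,[1,4]),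
    (2,4,[3])]))"
proof (rule not_prime_on_carrierI)
  show "r23 * (1 - r12^2 - r34^2) \<in> ideal_of (minors_of [(1,3,[2]), (1,4,[]), (2,3,[1,4]),
      (2,4,[3])])"
    by (simp add: minors_of_simps,
      rule ideal_of_substitution[of 1 4 0], simp,
      rule ideal_of_substitution[of 1 3 "r12 * r23"], simp,
      rule ideal_of_substitution[of 2 4 "r23 * r34"], simp,
      rule idl.span_base, simp add: algebra_simps power2_eq_square)
  show "\<forall>x\<in>minors_of [(1,3,[2]), (1,4,[]), (2,3,[1,4]), (2,4,[3])].
      eval_at ((\<lambda>_. 0)((1, 2) := 1, (2, 3) := 1, (1, 3) := 1)) x = 0"
    by (simp add: minors_of_simps)
  show "\<forall>x\<in>minors_of [(1,3,[2]), (1,4,[]), (2,3,[1,4]), (2,4,[3])]. eval_at (\<lambda>_. 0) x = 0"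
    by (simp add: minors_of_simps)
qed (simp_all add: corr_carrier_closed corr_carrier_diff power2_eq_square)

lemma not_prime_L37: "\<not> prime_on_carrier (ideal_of (minors_of [(1,2,[3]), (1,2,[4]), (3,4,[1]),
    (3,4,[2])]))"
proof (rule not_prime_on_carrierI)
  show "r13 * (r23^2 - r14^2) \<in> ideal_of (minors_of [(1,2,[3]), (1,2,[4]), (3,4,[1]), (3,4,[2])])"
    by (simp add: minors_of_simps,
      rule ideal_of_substitution[of 1 2 "r13 * r23"], simp,
      rule ideal_of_substitution[of 3 4 "r13 * r14"], simp,
      rule combination_in_ideal[of "r13 * r23 - r14 * r24" _ "r13 * r14 - r23 * r24" _ r23 "- r14"];
      simp add: algebra_simps power2_eq_square)
  show "\<forall>x\<in>minors_of [(1,2,[3]), (1,2,[4]), (3,4,[1]), (3,4,[2])]. eval_at (\<lambda>_. 1) x = 0"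
    by (simp add: minors_of_simps)
  show "\<forall>x\<in>minors_of [(1,2,[3]), (1,2,[4]), (3,4,[1]), (3,4,[2])].
      eval_at ((\<lambda>_. 0)((2, 3) := 1)) x = 0"
    by (simp add: minors_of_simps)
qed (simp_all add: corr_carrier_closed corr_carrier_diff power2_eq_square)

section \<open>Representable relations\<close>

text \<open>
  The inferences below use positivity on three indices at a time, so it is stated in that form.
\<close>

definition correlation_like :: "(nat \<Rightarrow> nat \<Rightarrow> real) \<Rightarrow> bool" where
  "correlation_like r \<longleftrightarrow> (\<forall>a b. r a b = r b a) \<and> (\<forall>a\<in>{1..4}. r a a = 1) \<and>
     (\<forall>i\<in>{1..4}. \<forall>j\<in>{1..4}. \<forall>k\<in>{1..4}. distinct [i, j, k] \<longrightarrow>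
       (\<forall>x y z. (x, y, z) \<noteq> (0, 0, 0) \<longrightarrow>
          x\<^sup>2 + y\<^sup>2 + z\<^sup>2 + 2 * x * y * r i j + 2 * x * z * r i k + 2 * y * z * r j k > 0))"

text \<open>
  Rescaling the rows and columns to a unit diagonal does not affect which minors vanish.
\<close>

lemma minor_poly_scale:
  fixes r :: "nat \<Rightarrow> nat \<Rightarrow> 'a::comm_ring_1"
  shows "minor_poly (\<lambda>a b. d a * d b * r a b) i j C = d i * d j * (\<Prod>k\<leftarrow>C. (d k)\<^sup>2) * minor_poly r i j C"
  by (cases "(r, i, j, C)" rule: minor_poly.cases) (simp_all add: algebra_simps power2_eq_square)

lemma PD_quadratic_form:
  assumes \<Sigma>: "\<Sigma> \<in> PD 4" and v: "\<exists>a\<in>{1..4}. v a \<noteq> 0"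
  shows "(\<Sum>a\<in>{1..4}. \<Sum>b\<in>{1..4}. v a * v b * \<Sigma> $$ (a - 1, b - 1)) > 0"
proof -
  let ?v = "vec 4 (\<lambda>i. v (Suc i))"
  have S: "\<Sigma> \<in> carrier_mat 4 4" using \<Sigma> by (simp add: PD_def)
  obtain a where a: "a \<in> {1..4}" "v a \<noteq> 0" using v by blast
  have "?v $ (a - 1) \<noteq> 0\<^sub>v 4 $ (a - 1)" using a by (auto simp: Suc_diff_1)
  then have "?v \<noteq> 0\<^sub>v 4" by auto
  then have "?v \<bullet> (\<Sigma> *\<^sub>v ?v) > 0" using \<Sigma> by (simp add: PD_def)
  also have "?v \<bullet> (\<Sigma> *\<^sub>v ?v) = (\<Sum>i<4. \<Sum>j<4. v (Suc i) * v (Suc j) * \<Sigma> $$ (i, j))"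
    using S by (auto simp: scalar_prod_def sum_distrib_left lessThan_atLeast0 mult_ac intro!: sum.cong)
  also have "\<dots> = (\<Sum>a\<in>{1..4}. \<Sum>b\<in>{1..4}. v a * v b * \<Sigma> $$ (a - 1, b - 1))"
  proof -
    have shift: "(\<Sum>i<4. h (Suc i)) = (\<Sum>a\<in>{1..4}. h a)" for h :: "nat \<Rightarrow> real"
      by (rule sum.reindex_bij_witness[of _ "\<lambda>a. a - 1" Suc]) auto
    show ?thesis
      using shift[of "\<lambda>a. \<Sum>b\<in>{1..4}. v a * v b * \<Sigma> $$ (a - 1, b - 1)"]
        shift[of "\<lambda>b. v (Suc i) * v b * \<Sigma> $$ (i, b - 1)" for i] by simp
  qed
  finally show ?thesis .
qed

lemma representable_correlation:
  assumes rep: "representable 4 L"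
  obtains r where "correlation_like r"
    and "\<And>i j C. i \<in> {1..4} \<Longrightarrow> j \<in> {1..4} \<Longrightarrow> set C \<subseteq> {1..4} \<Longrightarrow> distinct (i # j # C)
      \<Longrightarrow> minor_poly r i j C = 0 \<longleftrightarrow> ci i j (set C) \<in> L"
proof -
  obtain \<Sigma> where \<Sigma>: "\<Sigma> \<in> PD 4"
    and L: "\<And>i j C. i \<in> {1..4} \<Longrightarrow> j \<in> {1..4} \<Longrightarrow> i \<noteq> j \<Longrightarrow> C \<subseteq> {1..4} - {i, j}
      \<Longrightarrow> ci_minor \<Sigma> i j C = 0 \<longleftrightarrow> ci i j C \<in> L"
    using rep unfolding representable_def by metis
  define s where "s a b = (if a \<in> {1..4} \<and> b \<in> {1..4} then \<Sigma> $$ (a - 1, b - 1) else 0)" for a b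
  have S: "\<Sigma> \<in> carrier_mat 4 4" "transpose_mat \<Sigma> = \<Sigma>" using \<Sigma> by (auto simp: PD_def)
  have s_sym: "s a b = s b a" for a b
  proof (cases "a \<in> {1..4} \<and> b \<in> {1..4}")
    case True
    then have "transpose_mat \<Sigma> $$ (a - 1, b - 1) = \<Sigma> $$ (b - 1, a - 1)"
      using S(1) by (intro index_transpose_mat) auto
    then show ?thesis using True S(2) by (simp add: s_def)
  qed (auto simp: s_def)
  have s_pos: "(\<Sum>a\<in>{1..4}. \<Sum>b\<in>{1..4}. v a * v b * s a b) > 0" if "\<exists>a\<in>{1..4}. v a \<noteq> 0" for v
  proof -
    have "(\<Sum>a\<in>{1..4}. \<Sum>b\<in>{1..4}. v a * v b * s a b)
        = (\<Sum>a\<in>{1..4}. \<Sum>b\<in>{1..4}. v a * v b * \<Sigma> $$ (a - 1, b - 1))"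
      by (intro sum.cong) (auto simp: s_def)
    then show ?thesis using PD_quadratic_form[OF \<Sigma> that] by simp
  qed
  have form3: "(\<Sum>a\<in>{1..4}. \<Sum>b\<in>{1..4}. v a * v b * s a b)
      = v i * v i * s i i + v j * v j * s j j + v k * v k * s k k
        + 2 * v i * v j * s i j + 2 * v i * v k * s i k + 2 * v j * v k * s j k"
    if "i \<in> {1..4}" "j \<in> {1..4}" "k \<in> {1..4}" "distinct [i, j, k]" "\<And>a. a \<notin> {i, j, k} \<Longrightarrow> v a = 0" for i j k and v :: "nat \<Rightarrow> real"
  proof -
    have "(\<Sum>a\<in>{1..4}. \<Sum>b\<in>{1..4}. v a * v b * s a b) = (\<Sum>a\<in>{i, j, k}. \<Sum>b\<in>{1..4}. v a * v b * s a b)"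
      by (rule sum.mono_neutral_right) (use that in auto)
    also have "\<dots> = (\<Sum>a\<in>{i, j, k}. \<Sum>b\<in>{i, j, k}. v a * v b * s a b)"
      by (intro sum.cong sum.mono_neutral_right) (use that in auto)
    finally show ?thesis
      using that(4) s_sym[of j i] s_sym[of k i] s_sym[of k j] by (simp add: algebra_simps)
  qed
  have diag: "s a a > 0" if a: "a \<in> {1..4}" for a
  proof -
    obtain j k where jk: "j \<in> {1..4}" "k \<in> {1..4}" "distinct [a, j, k]"
    proof -
      have "a = 1 \<or> a = 2 \<or> a = 3 \<or> a = 4" using a by auto
      then show ?thesis using that[of 1 2] that[of 1 3] that[of 2 3] by auto
    qed
    have "(\<Sum>b\<in>{1..4}. \<Sum>c\<in>{1..4}. ((\<lambda>_. 0)(a := 1)) b * ((\<lambda>_. 0)(a := 1)) c * s b c) > 0"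
      by (rule s_pos) (use a in auto)
    then show ?thesis
      using form3[of a j k "(\<lambda>_. 0)(a := 1)"] jk a by auto
  qed
  define d where "d a = (if a \<in> {1..4} then sqrt (s a a) else 1)" for a
  have d: "d a > 0" for a using diag by (simp add: d_def)
  have dd: "d a * d a = s a a" if "a \<in> {1..4}" for a
    using that diag[OF that] by (simp add: d_def)
  define r where "r a b = s a b / (d a * d b)" for a b
  have sr: "s = (\<lambda>a b. d a * d b * r a b)"
    using d by (intro ext) (simp add: r_def less_imp_neq[THEN not_sym])
  have pos3: "x\<^sup>2 + y\<^sup>2 + z\<^sup>2 + 2 * x * y * r i j + 2 * x * z * r i k + 2 * y * z * r j k > 0"
    if ijk: "i \<in> {1..4}" "j \<in> {1..4}" "k \<in> {1..4}" "distinct [i, j, k]" and xyz: "(x, y, z) \<noteq> (0, 0, 0)"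
    for i j k and x y z :: real
  proof -
    define v where "v = (\<lambda>_. 0)(i := x / d i, j := y / d j, k := z / d k)"
    have v: "v i = x / d i" "v j = y / d j" "v k = z / d k" "\<And>a. a \<notin> {i, j, k} \<Longrightarrow> v a = 0"
      using ijk by (auto simp: v_def)
    have "\<exists>a\<in>{1..4}. v a \<noteq> 0"
      using xyz v(1-3) d[of i] d[of j] d[of k] ijk(1-3) by (metis divide_eq_0_iff less_irrefl)
    then have "0 < (\<Sum>a\<in>{1..4}. \<Sum>b\<in>{1..4}. v a * v b * s a b)" by (rule s_pos)
    also have "\<dots> = v i * v i * s i i + v j * v j * s j j + v k * v k * s k k
        + 2 * v i * v j * s i j + 2 * v i * v k * s i k + 2 * v j * v k * s j k"
      by (rule form3[OF ijk v(4)])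
    also have "\<dots> = x\<^sup>2 + y\<^sup>2 + z\<^sup>2 + 2 * x * y * r i j + 2 * x * z * r i k + 2 * y * z * r j k"
      using d[of i] d[of j] d[of k] unfolding v r_def
      by (simp add: dd[OF ijk(1), symmetric] dd[OF ijk(2), symmetric] dd[OF ijk(3), symmetric] power2_eq_square)
    finally show ?thesis .
  qed
  have "correlation_like r"
    unfolding correlation_like_def
  proof (intro conjI allI ballI impI)
    show "r a b = r b a" for a b by (simp add: r_def s_sym[of a b] mult.commute)
    show "r a a = 1" if "a \<in> {1..4}" for a
      using d[of a] diag[OF that] by (simp add: r_def dd[OF that])
  qed (rule pos3; simp)
  moreover have "minor_poly r i j C = 0 \<longleftrightarrow> ci i j (set C) \<in> L"
    if "i \<in> {1..4}" "j \<in> {1..4}" "set C \<subseteq> {1..4}" "distinct (i # j # C)" for i j C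
  proof -
    have "card (set C) \<le> 2"
    proof -
      have "card (set C) \<le> card ({1..4} - {i, j} :: nat set)"
        by (rule card_mono) (use that in auto)
      also have "\<dots> = 2" using that by (subst card_Diff_subset) auto
      finally show ?thesis .
    qed
    then have len: "length C \<le> 2" using that(4) by (simp add: distinct_card)
    have "ci_minor \<Sigma> i j (set C) = minor_poly s i j (sorted_list_of_set (set C))"
      unfolding ci_minor_def
    proof (rule det_submat_minor_poly)
      show "s a b = s b a" for a b by (rule s_sym)
    qed (use that len in \<open>auto simp: s_def distinct_card\<close>)
    also have "\<dots> = minor_poly s i j C"
      by (rule minor_poly_cong) (use that len s_sym in \<open>auto simp: distinct_card\<close>)
    also have "\<dots> = d i * d j * (\<Prod>k\<leftarrow>C. (d k)\<^sup>2) * minor_poly r i j C"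
      unfolding sr by (rule minor_poly_scale)
    finally have "ci_minor \<Sigma> i j (set C) = 0 \<longleftrightarrow> minor_poly r i j C = 0"
      using d by (auto simp: prod_list_zero_iff less_imp_neq[THEN not_sym])
    then show ?thesis using L[of i j "set C"] that by auto
  qed
  ultimately show ?thesis by (rule that)
qed

definition vanishing :: "(nat \<Rightarrow> nat \<Rightarrow> real) \<Rightarrow> couple \<Rightarrow> bool" where
  "vanishing r = (\<lambda>(i, j, C). minor_poly r i j C = 0)"

text \<open>
  The first five lines are the semigraphoid, intersection, composition and weak transitivity axioms
  of a gaussoid with empty context, the next five the same with context \<open>l\<close>. The last five do not
  follow from them; they exclude the gaussoids over four indices that no real positive definite
  matrix realises.
\<close>

definition ci_axioms :: "(couple \<Rightarrow> bool) \<Rightarrow> nat \<Rightarrow> nat \<Rightarrow> nat \<Rightarrow> nat \<Rightarrow> bool" where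
  "ci_axioms M i j k l \<longleftrightarrow>
     (M (i, j, []) \<and> M (i, k, [j]) \<longrightarrow> M (i, k, [])) \<and>
     (M (i, j, []) \<and> M (i, k, [j]) \<longrightarrow> M (i, j, [k])) \<and>
     (M (i, j, [k]) \<and> M (i, k, [j]) \<longrightarrow> M (i, j, [])) \<and>
     (M (i, j, []) \<and> M (i, k, []) \<longrightarrow> M (i, j, [k])) \<and>
     (M (i, j, []) \<and> M (i, j, [k]) \<longrightarrow> M (i, k, []) \<or> M (j, k, [])) \<and>
     (M (i, j, [l]) \<and> M (i, k, [j, l]) \<longrightarrow> M (i, k, [l])) \<and>
     (M (i, j, [l]) \<and> M (i, k, [j, l]) \<longrightarrow> M (i, j, [k, l])) \<and>
     (M (i, j, [k, l]) \<and> M (i, k, [j, l]) \<longrightarrow> M (i, j, [l])) \<and>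
     (M (i, j, [l]) \<and> M (i, k, [l]) \<longrightarrow> M (i, j, [k, l])) \<and>
     (M (i, j, [l]) \<and> M (i, j, [k, l]) \<longrightarrow> M (i, k, [l]) \<or> M (j, k, [l])) \<and>
     (M (i, j, [k]) \<and> M (i, k, [l]) \<and> M (i, l, [j]) \<longrightarrow> M (i, j, [])) \<and>
     (M (i, j, []) \<and> M (i, j, [k, l]) \<and> M (k, l, [i]) \<and> M (k, l, [j]) \<longrightarrow> M (k, l, [])) \<and>
     (M (i, j, []) \<and> M (i, k, [l]) \<and> M (j, l, [i, k]) \<and> M (k, l, [j]) \<longrightarrow> M (j, l, [])) \<and>
     (M (i, j, []) \<and> M (k, l, []) \<and> M (i, k, [j, l]) \<and> M (j, l, [i, k]) \<longrightarrow> M (i, k, [])) \<and>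
     (M (i, j, [k]) \<and> M (i, k, [l]) \<and> M (j, l, [i]) \<and> M (k, l, [j]) \<longrightarrow> M (j, l, []))"

text \<open>
  Here \<open>u\<close>, \<open>v\<close>, \<open>w\<close> are the entries \<open>ij\<close>, \<open>ik\<close>, \<open>jk\<close> and \<open>a\<close>, \<open>b\<close> the diagonal entries \<open>jj\<close>, \<open>kk\<close> of a
  matrix: of \<open>r\<close> itself, or of its Schur complement with respect to a fourth index.
\<close>

lemma gaussoid_identities:
  fixes u v w a b :: real
  assumes "a > 0" "b > 0" "a * b - w\<^sup>2 > 0"
  shows "u = 0 \<and> v * a - u * w = 0 \<longrightarrow> v = 0"
    and "u = 0 \<and> v * a - u * w = 0 \<longrightarrow> u * b - v * w = 0"
    and "u * b - v * w = 0 \<and> v * a - u * w = 0 \<longrightarrow> u = 0"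
    and "u = 0 \<and> v = 0 \<longrightarrow> u * b - v * w = 0"
    and "u = 0 \<and> u * b - v * w = 0 \<longrightarrow> v = 0 \<or> w = 0"
proof -
  show "u * b - v * w = 0 \<and> v * a - u * w = 0 \<longrightarrow> u = 0"
  proof
    assume e: "u * b - v * w = 0 \<and> v * a - u * w = 0"
    have "u * (a * b - w\<^sup>2) = a * (u * b - v * w) + w * (v * a - u * w)"
      by (simp add: algebra_simps power2_eq_square)
    then have "u * (a * b - w\<^sup>2) = 0" using e by simp
    then show "u = 0" using assms(3) by simp
  qed
qed (use assms in auto)

context
  fixes r :: "nat \<Rightarrow> nat \<Rightarrow> real" and i j k l :: nat
  assumes r: "correlation_like r"
    and range: "i \<in> {1..4}" "j \<in> {1..4}" "k \<in> {1..4}" "l \<in> {1..4}" and dist: "distinct [i, j, k, l]"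
begin

lemma r_sym: "r a b = r b a"
  using r by (simp add: correlation_like_def)

lemma r_diag: "r i i = 1" "r j j = 1" "r k k = 1" "r l l = 1"
  using r range unfolding correlation_like_def by blast+

lemma r_pos3:
  assumes "a \<in> {i, j, k, l}" "b \<in> {i, j, k, l}" "c \<in> {i, j, k, l}" "distinct [a, b, c]"
    and "(x, y, z) \<noteq> (0, 0, 0)"
  shows "x\<^sup>2 + y\<^sup>2 + z\<^sup>2 + 2 * x * y * r a b + 2 * x * z * r a c + 2 * y * z * r b c > 0"
proof -
  have "a \<in> {1..4}" "b \<in> {1..4}" "c \<in> {1..4}" using assms(1-3) range by auto
  then show ?thesis using r assms(4,5) unfolding correlation_like_def by blast
qed

lemma r_less_one:
  assumes "a \<in> {i, j, k, l}" "b \<in> {i, j, k, l}" "a \<noteq> b"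
  shows "(r a b)\<^sup>2 < 1"
proof -
  obtain c where c: "c \<in> {i, j, k, l}" "distinct [a, b, c]"
    using assms dist by auto
  show ?thesis
    using r_pos3[OF assms(1,2) c, of 1 "- r a b" 0] by (simp add: power2_eq_square)
qed

text \<open>
  The determinant of the Schur complement with respect to \<open>c\<close>.
\<close>

lemma r_pos_schur:
  assumes "a \<in> {i, j, k, l}" "b \<in> {i, j, k, l}" "c \<in> {i, j, k, l}" "distinct [a, b, c]"
  shows "(1 - (r a c)\<^sup>2) * (1 - (r b c)\<^sup>2) - (r a b - r a c * r b c)\<^sup>2 > 0"
proof -
  \<comment> \<open>The quadratic form is evaluated at the vector that minimises it over the coordinate \<open>c\<close>, the
    other two being \<open>?B\<close> and \<open>- ?w\<close>.\<close>
  let ?B = "1 - (r b c)\<^sup>2" and ?w = "r a b - r a c * r b c"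
  have B: "?B > 0" using r_less_one[of b c] assms by auto
  have "0 < ?B\<^sup>2 + (- ?w)\<^sup>2 + (- (?B * r a c) + ?w * r b c)\<^sup>2 + 2 * ?B * (- ?w) * r a b
      + 2 * ?B * (- (?B * r a c) + ?w * r b c) * r a c + 2 * (- ?w) * (- (?B * r a c) + ?w * r b c) * r b c"
    by (rule r_pos3[OF assms]) (use B in auto)
  also have "\<dots> = ?B * ((1 - (r a c)\<^sup>2) * ?B - ?w\<^sup>2)"
    by (simp add: algebra_simps power2_eq_square)
  finally show ?thesis using B by (simp add: zero_less_mult_iff)
qed

lemma gaussoid_axioms_vanishing:
  "vanishing r (i, j, []) \<and> vanishing r (i, k, [j]) \<longrightarrow> vanishing r (i, k, [])"
  "vanishing r (i, j, []) \<and> vanishing r (i, k, [j]) \<longrightarrow> vanishing r (i, j, [k])"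
  "vanishing r (i, j, [k]) \<and> vanishing r (i, k, [j]) \<longrightarrow> vanishing r (i, j, [])"
  "vanishing r (i, j, []) \<and> vanishing r (i, k, []) \<longrightarrow> vanishing r (i, j, [k])"
  "vanishing r (i, j, []) \<and> vanishing r (i, j, [k]) \<longrightarrow> vanishing r (i, k, []) \<or> vanishing r (j, k, [])"
  "vanishing r (i, j, [l]) \<and> vanishing r (i, k, [j, l]) \<longrightarrow> vanishing r (i, k, [l])"
  "vanishing r (i, j, [l]) \<and> vanishing r (i, k, [j, l]) \<longrightarrow> vanishing r (i, j, [k, l])"
  "vanishing r (i, j, [k, l]) \<and> vanishing r (i, k, [j, l]) \<longrightarrow> vanishing r (i, j, [l])"
  "vanishing r (i, j, [l]) \<and> vanishing r (i, k, [l]) \<longrightarrow> vanishing r (i, j, [k, l])"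
  "vanishing r (i, j, [l]) \<and> vanishing r (i, j, [k, l]) \<longrightarrow> vanishing r (i, k, [l]) \<or> vanishing r (j, k, [l])"
proof -
  note sym = r_sym[of k j] r_sym[of j i] r_sym[of k i] r_sym[of l i] r_sym[of l j] r_sym[of l k]
  have pos: "(1::real) > 0" "1 * 1 - (r j k)\<^sup>2 > 0"
    using r_less_one[of j k] dist by auto
  define t where "t a b = r a b - r a l * r b l" for a b
  have tpos: "t j j > 0" "t k k > 0" "t j j * t k k - (t j k)\<^sup>2 > 0"
    using r_less_one[of j l] r_less_one[of k l] r_pos_schur[of j k l] dist
    by (auto simp: t_def r_diag power2_eq_square)
  have V: "vanishing r (i, j, []) \<longleftrightarrow> r i j = 0" "vanishing r (i, k, []) \<longleftrightarrow> r i k = 0"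
    "vanishing r (j, k, []) \<longleftrightarrow> r j k = 0"
    "vanishing r (i, j, [k]) \<longleftrightarrow> r i j * 1 - r i k * r j k = 0"
    "vanishing r (i, k, [j]) \<longleftrightarrow> r i k * 1 - r i j * r j k = 0"
    "vanishing r (i, j, [l]) \<longleftrightarrow> t i j = 0" "vanishing r (i, k, [l]) \<longleftrightarrow> t i k = 0"
    "vanishing r (j, k, [l]) \<longleftrightarrow> t j k = 0"
    unfolding vanishing_def t_def by (simp_all add: r_diag sym)
  have "minor_poly r i j [k, l] = t i j * t k k - t i k * t j k"
    "minor_poly r i k [j, l] = t i k * t j j - t i j * t j k"
    unfolding t_def by (simp_all add: r_diag sym algebra_simps power2_eq_square)
  then have V2: "vanishing r (i, j, [k, l]) \<longleftrightarrow> t i j * t k k - t i k * t j k = 0"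
    "vanishing r (i, k, [j, l]) \<longleftrightarrow> t i k * t j j - t i j * t j k = 0"
    by (simp_all add: vanishing_def)
  show "vanishing r (i, j, []) \<and> vanishing r (i, k, [j]) \<longrightarrow> vanishing r (i, k, [])"
    unfolding V by (rule gaussoid_identities(1)[OF pos(1,1,2)])
  show "vanishing r (i, j, []) \<and> vanishing r (i, k, [j]) \<longrightarrow> vanishing r (i, j, [k])"
    unfolding V by (rule gaussoid_identities(2)[OF pos(1,1,2)])
  show "vanishing r (i, j, [k]) \<and> vanishing r (i, k, [j]) \<longrightarrow> vanishing r (i, j, [])"
    unfolding V by (rule gaussoid_identities(3)[OF pos(1,1,2)])
  show "vanishing r (i, j, []) \<and> vanishing r (i, k, []) \<longrightarrow> vanishing r (i, j, [k])"
    unfolding V by (rule gaussoid_identities(4)[OF pos(1,1,2)])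
  show "vanishing r (i, j, []) \<and> vanishing r (i, j, [k]) \<longrightarrow> vanishing r (i, k, []) \<or> vanishing r (j, k, [])"
    unfolding V by (rule gaussoid_identities(5)[OF pos(1,1,2)])
  show "vanishing r (i, j, [l]) \<and> vanishing r (i, k, [j, l]) \<longrightarrow> vanishing r (i, k, [l])"
    unfolding V V2 by (rule gaussoid_identities(1)[OF tpos])
  show "vanishing r (i, j, [l]) \<and> vanishing r (i, k, [j, l]) \<longrightarrow> vanishing r (i, j, [k, l])"
    unfolding V V2 by (rule gaussoid_identities(2)[OF tpos])
  show "vanishing r (i, j, [k, l]) \<and> vanishing r (i, k, [j, l]) \<longrightarrow> vanishing r (i, j, [l])"
    unfolding V V2 by (rule gaussoid_identities(3)[OF tpos])
  show "vanishing r (i, j, [l]) \<and> vanishing r (i, k, [l]) \<longrightarrow> vanishing r (i, j, [k, l])"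
    unfolding V V2 by (rule gaussoid_identities(4)[OF tpos])
  show "vanishing r (i, j, [l]) \<and> vanishing r (i, j, [k, l]) \<longrightarrow> vanishing r (i, k, [l]) \<or> vanishing r (j, k, [l])"
    unfolding V V2 by (rule gaussoid_identities(5)[OF tpos])
qed

lemma inference_rules_vanishing:
  "vanishing r (i, j, [k]) \<and> vanishing r (i, k, [l]) \<and> vanishing r (i, l, [j]) \<longrightarrow> vanishing r (i, j, [])"
  "vanishing r (i, j, []) \<and> vanishing r (i, j, [k, l]) \<and> vanishing r (k, l, [i]) \<and> vanishing r (k, l, [j]) \<longrightarrow> vanishing r (k, l, [])"
  "vanishing r (i, j, []) \<and> vanishing r (i, k, [l]) \<and> vanishing r (j, l, [i, k]) \<and> vanishing r (k, l, [j]) \<longrightarrow> vanishing r (j, l, [])"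
  "vanishing r (i, j, []) \<and> vanishing r (k, l, []) \<and> vanishing r (i, k, [j, l]) \<and> vanishing r (j, l, [i, k]) \<longrightarrow> vanishing r (i, k, [])"
  "vanishing r (i, j, [k]) \<and> vanishing r (i, k, [l]) \<and> vanishing r (j, l, [i]) \<and> vanishing r (k, l, [j]) \<longrightarrow> vanishing r (j, l, [])"
proof -
  note sym = r_sym[of k j] r_sym[of j i] r_sym[of k i] r_sym[of l i] r_sym[of l j] r_sym[of l k]
  define x a b c d y where "x = r i j" and "a = r i k" and "b = r i l" and "c = r j k" and "d = r j l" and "y = r k l"
  have lt: "x\<^sup>2 < 1" "a\<^sup>2 < 1" "b\<^sup>2 < 1" "c\<^sup>2 < 1" "d\<^sup>2 < 1" "y\<^sup>2 < 1"
    unfolding x_def a_def b_def c_def d_def y_def using dist by (auto intro!: r_less_one)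
  have prod: "u * v < 1" if "0 \<le> u" "u < 1" "0 \<le> v" "v < 1" for u v :: real
    using that mult_strict_mono[of u 1 v 1] by (cases "u = 0 \<or> v = 0") auto
  have ax1: "x = 0" if "x = a * c" "a = b * y" "b = x * d"
  proof -
    have "x = b * y * c" by (simp only: that(1,2))
    also have "\<dots> = x * (d * (y * c))" by (simp only: that(3) mult.assoc)
    finally have "x\<^sup>2 = (x * (d * (y * c)))\<^sup>2" by (rule arg_cong)
    then have "x\<^sup>2 * (1 - d\<^sup>2 * (y\<^sup>2 * c\<^sup>2)) = 0" by (simp add: power_mult_distrib algebra_simps)
    moreover have "d\<^sup>2 * (y\<^sup>2 * c\<^sup>2) < 1" using lt by (intro prod) (auto intro!: prod)
    ultimately show ?thesis by simp
  qed
  have ax2: "y = 0" if "- (a * c) - b * d + y * (a * d + b * c) = 0" "y = a * b" "y = c * d"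
  proof (rule ccontr)
    assume y: "y \<noteq> 0"
    \<comment> \<open>A sum of squares with positive weights, multiplied by \<open>y\<close>, is a combination of the
      hypotheses.\<close>
    have "y * (a\<^sup>2 * (1 - b\<^sup>2) + d\<^sup>2 * (1 - a\<^sup>2))
        = - (a * d) * (- (a * c) - b * d + y * (a * d + b * c))
          + a\<^sup>2 * (y - c * d) + d\<^sup>2 * (y - a * b) + y * (a * b) * (c * d - a * b)"
      by (simp add: algebra_simps power2_eq_square)
    also have "\<dots> = 0"
      unfolding that(1) that(2)[symmetric] that(3)[symmetric] by simp
    finally have "y * (a\<^sup>2 * (1 - b\<^sup>2) + d\<^sup>2 * (1 - a\<^sup>2)) = 0" .
    then have "a\<^sup>2 * (1 - b\<^sup>2) + d\<^sup>2 * (1 - a\<^sup>2) = 0" using y by simp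
    moreover have "a\<^sup>2 * (1 - b\<^sup>2) \<ge> 0" "d\<^sup>2 * (1 - a\<^sup>2) \<ge> 0" using lt by simp_all
    ultimately have "a\<^sup>2 * (1 - b\<^sup>2) = 0" by linarith
    then show False using lt(3) y that(2) by simp
  qed
  have ax3: "d = 0" if "a = b * y" "y = c * d" "d * (1 - a\<^sup>2) - c * y + a * b * c = 0"
  proof -
    have a: "a = b * (c * d)" by (simp only: that(1,2))
    have "d * ((1 - c\<^sup>2) + (b\<^sup>2 * c\<^sup>2) * (1 - d\<^sup>2)) = d * (1 - a\<^sup>2) - c * y + a * b * c"
      unfolding a that(2) by (simp add: algebra_simps power2_eq_square)
    then have "d * ((1 - c\<^sup>2) + (b\<^sup>2 * c\<^sup>2) * (1 - d\<^sup>2)) = 0" by (simp only: that(3))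
    moreover have "(1 - c\<^sup>2) + (b\<^sup>2 * c\<^sup>2) * (1 - d\<^sup>2) > 0" using lt by (intro add_pos_nonneg) simp_all
    ultimately show ?thesis by simp
  qed
  have ax4: "a = 0" if e: "y = 0" "a * (1 - d\<^sup>2) + b * c * d = 0" "d * (1 - a\<^sup>2) + a * b * c = 0"
  proof (rule ccontr)
    assume a: "a \<noteq> 0"
    have "a\<^sup>2 - d\<^sup>2 = a * (a * (1 - d\<^sup>2) + b * c * d) - d * (d * (1 - a\<^sup>2) + a * b * c)"
      by (simp add: algebra_simps power2_eq_square)
    then have ad: "a\<^sup>2 = d\<^sup>2" unfolding e by simp
    have "a * (1 - a\<^sup>2) = - (b * c * d)" using e(2) unfolding ad by simp
    then have "(a * (1 - a\<^sup>2))\<^sup>2 = (b * c * d)\<^sup>2" by simp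
    then have "a\<^sup>2 * ((1 - a\<^sup>2) * (1 - a\<^sup>2)) = a\<^sup>2 * (b\<^sup>2 * c\<^sup>2)"
      by (simp add: power_mult_distrib ad[symmetric] power2_eq_square[of "1 - a\<^sup>2"] mult_ac)
    then have bc: "(1 - a\<^sup>2) * (1 - a\<^sup>2) = b\<^sup>2 * c\<^sup>2" using a by simp
    \<comment> \<open>As \<open>y = 0\<close>, the forms on \<open>i, k, l\<close> and on \<open>j, k, l\<close> bound \<open>b\<close> and \<open>c\<close> so tightly that this
      product cannot be reached.\<close>
    have "0 < 1\<^sup>2 + (- a)\<^sup>2 + (- b)\<^sup>2 + 2 * 1 * (- a) * r i k + 2 * 1 * (- b) * r i l + 2 * (- a) * (- b) * r k l"
      by (rule r_pos3) (use dist in auto)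
    then have b: "b\<^sup>2 < 1 - a\<^sup>2" using e(1) by (simp add: a_def b_def y_def power2_eq_square)
    have "0 < 1\<^sup>2 + (- c)\<^sup>2 + (- d)\<^sup>2 + 2 * 1 * (- c) * r j k + 2 * 1 * (- d) * r j l + 2 * (- c) * (- d) * r k l"
      by (rule r_pos3) (use dist in auto)
    then have c: "c\<^sup>2 < 1 - a\<^sup>2" using e(1) ad by (simp add: c_def d_def y_def power2_eq_square)
    have "b\<^sup>2 * c\<^sup>2 < (1 - a\<^sup>2) * (1 - a\<^sup>2)"
      by (rule mult_strict_mono'[OF b c]) simp_all
    with bc show False by simp
  qed
  have ax5: "d = 0" if "x = a * c" "a = b * y" "d = x * b" "y = c * d"
  proof -
    have "d = c * (b * (b * (c * d)))" using that by (simp add: mult_ac)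
    then have "d * (1 - b\<^sup>2 * c\<^sup>2) = 0" by (simp add: algebra_simps power2_eq_square)
    moreover have "b\<^sup>2 * c\<^sup>2 < 1" using lt by (intro prod) auto
    ultimately show ?thesis by simp
  qed
  have V: "vanishing r (i, j, [k]) \<longleftrightarrow> x = a * c" "vanishing r (i, k, [l]) \<longleftrightarrow> a = b * y"
    "vanishing r (i, l, [j]) \<longleftrightarrow> b = x * d" "vanishing r (k, l, [i]) \<longleftrightarrow> y = a * b"
    "vanishing r (k, l, [j]) \<longleftrightarrow> y = c * d" "vanishing r (j, l, [i]) \<longleftrightarrow> d = x * b"
    "vanishing r (i, j, []) \<longleftrightarrow> x = 0" "vanishing r (i, k, []) \<longleftrightarrow> a = 0"
    "vanishing r (j, l, []) \<longleftrightarrow> d = 0" "vanishing r (k, l, []) \<longleftrightarrow> y = 0"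
    "vanishing r (i, j, [k, l]) \<longleftrightarrow> x * (1 - y\<^sup>2) - a * c - b * d + y * (a * d + b * c) = 0"
    "vanishing r (i, k, [j, l]) \<longleftrightarrow> a * (1 - d\<^sup>2) - x * c - b * y + d * (x * y + b * c) = 0"
    "vanishing r (j, l, [i, k]) \<longleftrightarrow> d * (1 - a\<^sup>2) - x * b - c * y + a * (x * y + b * c) = 0"
    unfolding vanishing_def x_def a_def b_def c_def d_def y_def
    by (simp_all add: r_diag sym algebra_simps)
  show "vanishing r (i, j, [k]) \<and> vanishing r (i, k, [l]) \<and> vanishing r (i, l, [j]) \<longrightarrow> vanishing r (i, j, [])"
    unfolding V using ax1 by blast
  show "vanishing r (i, j, []) \<and> vanishing r (i, j, [k, l]) \<and> vanishing r (k, l, [i]) \<and> vanishing r (k, l, [j]) \<longrightarrow> vanishing r (k, l, [])"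
    unfolding V by (intro impI, elim conjE, rule ax2; simp)
  show "vanishing r (i, j, []) \<and> vanishing r (i, k, [l]) \<and> vanishing r (j, l, [i, k]) \<and> vanishing r (k, l, [j]) \<longrightarrow> vanishing r (j, l, [])"
    unfolding V by (intro impI, elim conjE, rule ax3; simp add: mult.assoc)
  show "vanishing r (i, j, []) \<and> vanishing r (k, l, []) \<and> vanishing r (i, k, [j, l]) \<and> vanishing r (j, l, [i, k]) \<longrightarrow> vanishing r (i, k, [])"
    unfolding V by (intro impI, elim conjE, rule ax4; simp add: mult_ac)
  show "vanishing r (i, j, [k]) \<and> vanishing r (i, k, [l]) \<and> vanishing r (j, l, [i]) \<and> vanishing r (k, l, [j]) \<longrightarrow> vanishing r (j, l, [])"
    unfolding V using ax5 by blast
qed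

lemma ci_axioms_vanishing: "ci_axioms (vanishing r) i j k l"
  unfolding ci_axioms_def
  by (intro conjI) (rule gaussoid_axioms_vanishing inference_rules_vanishing)+

end

section \<open>Classification\<close>

definition label_orders :: "(nat \<times> nat \<times> nat \<times> nat) list" where
  "label_orders =
    [(1,2,3,4), (1,2,4,3), (1,3,2,4), (1,3,4,2), (1,4,2,3), (1,4,3,2),
     (2,1,3,4), (2,1,4,3), (2,3,1,4), (2,3,4,1), (2,4,1,3), (2,4,3,1),
     (3,1,2,4), (3,1,4,2), (3,2,1,4), (3,2,4,1), (3,4,1,2), (3,4,2,1),
     (4,1,2,3), (4,1,3,2), (4,2,1,3), (4,2,3,1), (4,3,1,2), (4,3,2,1)]"

text \<open>
  Corresponding positions for different arguments are images of each other under relabelling.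
\<close>

definition couples :: "nat \<Rightarrow> nat \<Rightarrow> nat \<Rightarrow> nat \<Rightarrow> couple list" where
  "couples i j k l =
    [(i,j,[]), (i,j,[k]), (i,j,[l]), (i,j,[k,l]), (i,k,[]), (i,k,[j]), (i,k,[l]), (i,k,[j,l]),
     (i,l,[]), (i,l,[j]), (i,l,[k]), (i,l,[j,k]), (j,k,[]), (j,k,[i]), (j,k,[l]), (j,k,[i,l]),
     (j,l,[]), (j,l,[i]), (j,l,[k]), (j,l,[i,k]), (k,l,[]), (k,l,[i]), (k,l,[j]), (k,l,[i,j])]"

definition exceptional_classes :: "couple list list" where
  "exceptional_classes =
    [[(1,4,[]), (1,4,[2,3]), (2,3,[]), (2,3,[1,4])],
     [(1,2,[]), (2,3,[1,4]), (2,4,[3])],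
     [(1,3,[2]), (1,4,[]), (2,3,[1,4]), (2,4,[3])],
     [(1,2,[3]), (1,2,[4]), (3,4,[1]), (3,4,[2])]]"

definition prime_classes :: "couple list list" where
  "prime_classes =
   [[],
    [(1,2,[])],
    [(1,2,[3])],
    [(1,2,[3,4])],
    [(1,2,[]), (1,2,[3,4])],
    [(1,2,[]), (1,3,[4])],
    [(1,2,[]), (1,3,[2,4])],
    [(1,2,[]), (3,4,[])],
    [(1,2,[]), (3,4,[1])],
    [(1,2,[]), (3,4,[1,2])],
    [(1,2,[3]), (1,2,[4])],
    [(1,2,[3]), (1,3,[4])],
    [(1,2,[3]), (1,3,[2,4])],
    [(1,2,[3]), (3,4,[1])],
    [(1,2,[3]), (3,4,[1,2])],
    [(1,2,[3,4]), (3,4,[1,2])],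
    [(1,2,[]), (1,2,[3,4]), (3,4,[])],
    [(1,2,[]), (1,2,[3,4]), (3,4,[1])],
    [(1,2,[]), (1,2,[3,4]), (3,4,[1,2])],
    [(1,2,[]), (1,3,[4]), (2,4,[3])],
    [(1,2,[]), (1,3,[4]), (2,4,[1,3])],
    [(1,2,[]), (1,3,[4]), (3,4,[2])],
    [(1,2,[]), (1,3,[4]), (3,4,[1,2])],
    [(1,2,[]), (1,3,[2,4]), (2,4,[1,3])],
    [(1,2,[]), (1,3,[2,4]), (3,4,[])],
    [(1,2,[]), (1,3,[2,4]), (3,4,[1])],
    [(1,2,[]), (3,4,[1]), (3,4,[2])],
    [(1,2,[3]), (1,2,[4]), (3,4,[1])],
    [(1,2,[3]), (1,2,[4]), (3,4,[1,2])],
    [(1,2,[3]), (1,3,[4]), (2,4,[1])],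
    [(1,2,[3]), (1,3,[4]), (3,4,[1,2])],
    [(1,2,[3]), (1,3,[2,4]), (3,4,[1])],
    [(1,2,[]), (1,2,[3]), (1,3,[]), (1,3,[2])],
    [(1,2,[3]), (1,2,[3,4]), (1,4,[3]), (1,4,[2,3])],
    [(1,2,[]), (1,2,[3]), (1,3,[]), (1,3,[2]), (2,3,[4])],
    [(1,2,[]), (1,2,[3]), (1,3,[]), (1,3,[2]), (2,3,[1,4])],
    [(1,2,[]), (1,3,[4]), (1,3,[2,4]), (2,3,[4]), (2,3,[1,4])],
    [(1,2,[3]), (1,2,[3,4]), (1,4,[2]), (2,4,[3]), (2,4,[1,3])],
    [(1,2,[]), (1,2,[3]), (1,3,[]), (1,3,[2]), (2,3,[]), (2,3,[1])],
    [(1,2,[3]), (1,2,[3,4]), (1,4,[3]), (1,4,[2,3]), (2,4,[3]), (2,4,[1,3])],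
    [(1,2,[]), (1,2,[3]), (1,2,[4]), (1,3,[]), (1,3,[2]), (2,4,[]), (2,4,[1])],
    [(1,2,[]), (1,2,[3]), (1,2,[3,4]), (1,3,[]), (1,3,[2]), (2,4,[3]), (2,4,[1,3])],
    [(1,2,[3]), (1,2,[4]), (1,2,[3,4]), (1,3,[4]), (1,3,[2,4]), (2,4,[3]), (2,4,[1,3])],
    [(1,2,[]), (1,2,[3]), (1,2,[4]), (1,2,[3,4]), (1,3,[]), (1,3,[2]), (1,3,[4]), (1,3,[2,4]),
        (1,4,[]), (1,4,[2]), (1,4,[3]), (1,4,[2,3])],
    [(1,2,[]), (1,2,[3]), (1,2,[4]), (1,2,[3,4]), (1,3,[]), (1,3,[2]), (1,3,[4]), (1,3,[2,4]),
        (1,4,[]), (1,4,[2]), (1,4,[3]), (1,4,[2,3]), (2,3,[]), (2,3,[1])],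
    [(1,2,[]), (1,2,[3]), (1,2,[4]), (1,2,[3,4]), (1,3,[]), (1,3,[2]), (1,3,[4]), (1,3,[2,4]),
        (1,4,[]), (1,4,[2]), (1,4,[3]), (1,4,[2,3]), (2,3,[4]), (2,3,[1,4])],
    [(1,2,[]), (1,2,[3]), (1,2,[4]), (1,2,[3,4]), (1,3,[]), (1,3,[2]), (1,3,[4]), (1,3,[2,4]),
        (2,4,[]), (2,4,[1]), (2,4,[3]), (2,4,[1,3]), (3,4,[]), (3,4,[1]), (3,4,[2]), (3,4,[1,2])],
    [(1,2,[]), (1,2,[3]), (1,2,[4]), (1,2,[3,4]), (1,3,[]), (1,3,[2]), (1,3,[4]), (1,3,[2,4]),
        (1,4,[]), (1,4,[2]), (1,4,[3]), (1,4,[2,3]), (2,3,[]), (2,3,[1]), (2,3,[4]), (2,3,[1,4]),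
        (2,4,[]), (2,4,[1]), (2,4,[3]), (2,4,[1,3])],
    [(1,2,[]), (1,2,[3]), (1,2,[4]), (1,2,[3,4]), (1,3,[]), (1,3,[2]), (1,3,[4]), (1,3,[2,4]),
        (1,4,[]), (1,4,[2]), (1,4,[3]), (1,4,[2,3]), (2,3,[]), (2,3,[1]), (2,3,[4]), (2,3,[1,4]),
        (2,4,[]), (2,4,[1]), (2,4,[3]), (2,4,[1,3]), (3,4,[]), (3,4,[1]), (3,4,[2]), (3,4,[1,2])]]"

definition matches :: "(couple \<Rightarrow> bool) \<Rightarrow> nat \<Rightarrow> nat \<Rightarrow> nat \<Rightarrow> nat \<Rightarrow> couple list \<Rightarrow> bool" where
  "matches M i j k l ts \<longleftrightarrow> list_all2 (\<lambda>t u. M u \<longleftrightarrow> t \<in> set ts) (couples 1 2 3 4) (couples i j k l)"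

text \<open>
  Negating the claim gives, for each relabelling and each class, a clause that some couple breaks the
  match. Together with the axioms these clauses over 24 atoms are unsatisfiable.
\<close>

lemma classification:
  assumes clauses: "\<forall>(i, j, k, l)\<in>set label_orders. ci_axioms M i j k l"
    and swap: "\<And>i j C. M (i, j, C) = M (j, i, C)" "\<And>i j k l. M (i, j, [k, l]) = M (i, j, [l, k])"
  shows "\<exists>ts\<in>set (exceptional_classes @ prime_classes). \<exists>(i, j, k, l)\<in>set label_orders. matches M i j k l ts"
proof (rule ccontr)
  assume "\<not> ?thesis"
  then have neg: "\<forall>(i, j, k, l)\<in>set label_orders. \<forall>ts\<in>set (exceptional_classes @ prime_classes). \<not> matches M i j k l ts"
    by blast
  have member: "(\<forall>ts\<in>set (exceptional_classes @ prime_classes). \<not> matches M i j k l ts)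
      \<longleftrightarrow> (\<forall>bs\<in>set (map (\<lambda>ts. map (\<lambda>t. t \<in> set ts) (couples 1 2 3 4)) (exceptional_classes @ prime_classes)).
            \<not> list_all2 (\<lambda>b u. M u = b) bs (couples i j k l))" for i j k l
    by (simp only: matches_def set_map ball_simps list_all2_map1)
  \<comment> \<open>The membership tests do not depend on the relabelling and are evaluated once.\<close>
  obtain bss where bss: "map (\<lambda>ts. map (\<lambda>t. t \<in> set ts) (couples 1 2 3 4)) (exceptional_classes @ prime_classes) = bss"
    by blast
  note bss' = bss[unfolded couples_def exceptional_classes_def prime_classes_def append.simps list.map, simplified]
  \<comment> \<open>Rewriting every couple to its sorted form identifies the atoms of different relabellings.\<close>
  note order = swap(1)[of 2 1] swap(1)[of 3 1] swap(1)[of 4 1] swap(1)[of 3 2] swap(1)[of 4 2] swap(1)[of 4 3]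
    swap(2)[of _ _ 2 1] swap(2)[of _ _ 3 1] swap(2)[of _ _ 4 1] swap(2)[of _ _ 3 2] swap(2)[of _ _ 4 2] swap(2)[of _ _ 4 3]
  note sets = label_orders_def list.set ball_simps(5,7) prod.case
  note A = clauses[unfolded ci_axioms_def, simplified sets order]
  have B: "\<forall>(i, j, k, l)\<in>set label_orders. \<forall>bs\<in>set bss. \<not> list_all2 (\<lambda>b u. M u = b) bs (couples i j k l)"
    using neg by (simp only: member bss)
  note B' = B[unfolded bss'[symmetric] couples_def, simplified sets list.rel_inject eq_True eq_False simp_thms(11-) order]
  show False using A B' by satx
qed

lemma prime_classes_prime: "\<forall>ts\<in>set prime_classes. prime_id (ideal_of (minors_of ts))"
  unfolding prime_classes_def list.set ball_simps
  by (intro conjI TrueI) (rule prime_empty prime_12 prime_12c3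
    prime_12_13c4 prime_12_34 prime_12_34c1
    prime_12_34c12 prime_12c3_13c4 prime_12c3_34c1
    prime_12_13c4_24c3 prime_12_13c4_34c2 prime_12c3_13c4_24c1
    prime_12_13 prime_12c3_14c3 prime_12_13_23c4
    prime_12_13c4_23c4 prime_12c3_14c2_24c3 prime_12_13_23
    prime_12c3_14c3_24c3 prime_12_13_24 prime_12_13_24c3
    prime_12c4_13c4_24c3 prime_12_13_14 prime_12_13_14_23
    prime_12_13_14_23c4 prime_12_13_24_34 prime_12_13_14_23_24
    prime_12_13_14_23_24_34 prime_12c34 prime_12_12c34
    prime_12_13c24 prime_12c3_12c4 prime_12c3_13c24
    prime_12c3_34c12 prime_12_12c34_34 prime_12_12c34_34c1
    prime_12_13c4_24c13 prime_12_13c4_34c12 prime_12_13c24_34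
    prime_12_13c24_34c1 prime_12_34c1_34c2 prime_12c3_12c4_34c1
    prime_12_13_23c14 prime_12c3_13c4_34c12 prime_12c3_12c4_34c12
    prime_12_12c34_34c12 prime_12c3_13c24_34c1 prime_12_13c24_24c13
    prime_12c34_34c12)+

lemma exceptional_classes_not_prime:
  "\<forall>ts\<in>set exceptional_classes. \<not> prime_on_carrier (ideal_of (minors_of ts))"
  unfolding exceptional_classes_def list.set ball_simps
  by (intro conjI TrueI not_prime_L15 not_prime_L24 not_prime_L28 not_prime_L37)

lemma ci_couples4: "ci_couples 4 = to_ci ` set (couples 1 2 3 4)"
proof (intro equalityI subsetI)
  have range: "{1..4} = {1, 2, 3, 4 :: nat}" by auto
  have pick: "ci i j C \<in> to_ci ` set (couples 1 2 3 4)"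
    if C: "C \<subseteq> {k, l}" and listed: "{(i, j, []), (i, j, [k]), (i, j, [l]), (i, j, [k, l])} \<subseteq> set (couples 1 2 3 4)"
    for i j k l C
  proof -
    have "C = set [] \<or> C = set [k] \<or> C = set [l] \<or> C = set [k, l]" using C by auto
    then obtain D where "D \<in> {[], [k], [l], [k, l]}" "C = set D" by blast
    then show ?thesis using listed by (intro image_eqI[of _ _ "(i, j, D)"]) (auto simp: to_ci_def)
  qed
  have ordered: "ci i j C \<in> to_ci ` set (couples 1 2 3 4)"
    if "i < j" "i \<in> {1..4}" "j \<in> {1..4}" and C: "C \<subseteq> {1, 2, 3, 4} - {i, j}" for i j C
  proof -
    have "i = 1 \<and> j = 2 \<or> i = 1 \<and> j = 3 \<or> i = 1 \<and> j = 4 \<or> i = 2 \<and> j = 3 \<or> i = 2 \<and> j = 4 \<or> i = 3 \<and> j = 4"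
      using that by auto
    then show ?thesis
    proof (elim disjE conjE)
      assume ij: "i = 1" "j = 2"
      have "C \<subseteq> {3, 4}" using C unfolding ij by auto
      then show ?thesis unfolding ij by (rule pick) (simp add: couples_def)
    next
      assume ij: "i = 1" "j = 3"
      have "C \<subseteq> {2, 4}" using C unfolding ij by auto
      then show ?thesis unfolding ij by (rule pick) (simp add: couples_def)
    next
      assume ij: "i = 1" "j = 4"
      have "C \<subseteq> {2, 3}" using C unfolding ij by auto
      then show ?thesis unfolding ij by (rule pick) (simp add: couples_def)
    next
      assume ij: "i = 2" "j = 3"
      have "C \<subseteq> {1, 4}" using C unfolding ij by auto
      then show ?thesis unfolding ij by (rule pick) (simp add: couples_def)
    next
      assume ij: "i = 2" "j = 4"
      have "C \<subseteq> {1, 3}" using C unfolding ij by auto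
      then show ?thesis unfolding ij by (rule pick) (simp add: couples_def)
    next
      assume ij: "i = 3" "j = 4"
      have "C \<subseteq> {1, 2}" using C unfolding ij by auto
      then show ?thesis unfolding ij by (rule pick) (simp add: couples_def)
    qed
  qed
  fix x assume "x \<in> ci_couples 4"
  then obtain i j C where x: "x = ci i j C" and ij: "i \<in> {1..4}" "j \<in> {1..4}" "i \<noteq> j"
      and "C \<subseteq> {1..4} - {i, j}"
    by (auto simp: ci_couples_def)
  then have C: "C \<subseteq> {1, 2, 3, 4} - {i, j}" by (simp only: range)
  have "ci i j C = ci j i C" by (simp add: ci_def insert_commute)
  moreover have "C \<subseteq> {1, 2, 3, 4} - {j, i}" using C by blast
  ultimately show "x \<in> to_ci ` set (couples 1 2 3 4)"
    using ordered[OF _ ij(1,2) C] ordered[OF _ ij(2,1)] ij(3) x by (metis nat_neq_iff)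
next
  fix x assume "x \<in> to_ci ` set (couples 1 2 3 4)"
  then obtain i j C where t: "(i, j, C) \<in> set (couples 1 2 3 4)" "x = ci i j (set C)"
    by (auto simp: to_ci_def)
  have "\<forall>(i, j, C)\<in>set (couples 1 2 3 4). i \<in> {1..4} \<and> j \<in> {1..4} \<and> i \<noteq> j \<and> set C \<subseteq> {1..4} - {i, j}"
    by (simp add: couples_def)
  with t show "x \<in> ci_couples 4"
    unfolding ci_couples_def by blast
qed

lemma class_couples: "\<forall>ts\<in>set (exceptional_classes @ prime_classes). set ts \<subseteq> set (couples 1 2 3 4)"
  by (simp add: exceptional_classes_def prime_classes_def couples_def)

lemma class_wellformed:
  assumes "ts \<in> set (exceptional_classes @ prime_classes)"
  shows "gens (to_ci ` set ts) = minors_of ts"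
proof -
  have "\<forall>(i, j, C)\<in>set (couples 1 2 3 4). i \<noteq> j \<and> distinct C \<and> length C \<le> 2"
    by (simp add: couples_def)
  then show ?thesis
    unfolding minors_of_def by (intro gens_to_ci) (use class_couples assms in blast)
qed

definition permutation_of :: "nat \<Rightarrow> nat \<Rightarrow> nat \<Rightarrow> nat \<Rightarrow> nat \<Rightarrow> nat" where
  "permutation_of i j k l = id(1 := i, 2 := j, 3 := k, 4 := l)"

lemma permutation_of_permutes:
  assumes "(i, j, k, l) \<in> set label_orders"
  shows "permutation_of i j k l permutes {1..4}"
proof -
  have ijkl: "distinct [i, j, k, l]" "{i, j, k, l} = {1, 2, 3, 4}"
    using assms unfolding label_orders_def by auto
  have range: "{1..4} = {1, 2, 3, 4 :: nat}" by auto
  have "bij_betw (permutation_of i j k l) {1..4} {1..4}"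
    unfolding range bij_betw_def permutation_of_def using ijkl by (auto simp: inj_on_def)
  then show ?thesis
    by (rule bij_imp_permutes) (auto simp: permutation_of_def)
qed

text \<open>
  Every couple is the image of a listed one, so that agreement on the list determines \<open>L\<close>.
\<close>

lemma relabel_of_matches:
  assumes L: "L \<subseteq> ci_couples 4" and order: "(i, j, k, l) \<in> set label_orders"
    and ts: "set ts \<subseteq> set (couples 1 2 3 4)" and matches: "matches (\<lambda>t. to_ci t \<in> L) i j k l ts"
  shows "L = relabel (permutation_of i j k l) (to_ci ` set ts)"
proof -
  let ?\<pi> = "permutation_of i j k l"
  define move where "move = (\<lambda>(a, b, C). (?\<pi> a, ?\<pi> b, map ?\<pi> C))"
  define act where "act = (\<lambda>(E, C). (?\<pi> ` E, ?\<pi> ` C))"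
  have move: "to_ci (move t) = act (to_ci t)" for t
    by (cases t) (simp add: move_def act_def to_ci_def ci_def)
  have "couples i j k l = map move (couples 1 2 3 4)"
    by (simp add: couples_def move_def permutation_of_def)
  then have iff: "act (to_ci t) \<in> L \<longleftrightarrow> t \<in> set ts" if "t \<in> set (couples 1 2 3 4)" for t
    using matches that
    by (auto simp: matches_def list_all2_map2 list_all2_same move)
  have "x \<in> act ` (to_ci ` set ts)" if x: "x \<in> L" for x
  proof -
    obtain a b C where abC: "x = ci a b C" "a \<in> {1..4}" "b \<in> {1..4}" "a \<noteq> b" "C \<subseteq> {1..4} - {a, b}"
      using x L by (auto simp: ci_couples_def)
    note p = permutation_of_permutes[OF order]
    let ?\<sigma> = "inv_into UNIV ?\<pi>"
    have \<sigma>: "?\<sigma> permutes {1..4}" by (rule permutes_inv[OF p])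
    have inv: "?\<pi> (?\<sigma> y) = y" for y by (rule permutes_inverses(1)[OF p])
    have \<sigma>_eq: "?\<sigma> y = ?\<sigma> z \<longleftrightarrow> y = z" for y z
      by (rule inj_eq[OF permutes_inj[OF \<sigma>]])
    have "?\<sigma> a \<in> {1..4}" "?\<sigma> b \<in> {1..4}" "?\<sigma> a \<noteq> ?\<sigma> b" "?\<sigma> ` C \<subseteq> {1..4} - {?\<sigma> a, ?\<sigma> b}"
      unfolding permutes_in_image[OF \<sigma>] \<sigma>_eq
      using abC(2-5) by (simp_all only:) (use permutes_in_image[OF \<sigma>] in \<open>auto simp: \<sigma>_eq\<close>)
    then have "ci (?\<sigma> a) (?\<sigma> b) (?\<sigma> ` C) \<in> ci_couples 4"
      unfolding ci_couples_def by blast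
    then obtain t where t: "t \<in> set (couples 1 2 3 4)" "to_ci t = ci (?\<sigma> a) (?\<sigma> b) (?\<sigma> ` C)"
      unfolding ci_couples4 by auto
    have "act (to_ci t) = x"
      unfolding t(2) abC(1) by (simp add: act_def ci_def image_image inv)
    then show ?thesis using iff[OF t(1)] x by auto
  qed
  moreover have "x \<in> L" if "x \<in> act ` (to_ci ` set ts)" for x
    using that iff ts by auto
  ultimately show ?thesis
    unfolding relabel_def act_def[symmetric] by blast
qed

lemma representable_classification:
  assumes L: "L \<subseteq> ci_couples 4" and rep: "representable 4 L"
  obtains \<pi> ts where "\<pi> permutes {1..4}" "ts \<in> set (exceptional_classes @ prime_classes)"
    "L = relabel \<pi> (to_ci ` set ts)"
proof -
  obtain r where r: "correlation_like r"
    and iff: "\<And>i j C. i \<in> {1..4} \<Longrightarrow> j \<in> {1..4} \<Longrightarrow> set C \<subseteq> {1..4} \<Longrightarrow> distinct (i # j # C)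
      \<Longrightarrow> minor_poly r i j C = 0 \<longleftrightarrow> ci i j (set C) \<in> L"
    by (rule representable_correlation[OF rep]) blast
  have "\<forall>(i, j, k, l)\<in>set label_orders. ci_axioms (\<lambda>t. to_ci t \<in> L) i j k l"
  proof (clarify)
    fix i j k l assume "(i, j, k, l) \<in> set label_orders"
    then have ijkl: "i \<in> {1..4}" "j \<in> {1..4}" "k \<in> {1..4}" "l \<in> {1..4}" "distinct [i, j, k, l]"
      unfolding label_orders_def by auto
    have eq: "to_ci (a, b, C) \<in> L \<longleftrightarrow> vanishing r (a, b, C)"
      if "set (a # b # C) \<subseteq> {i, j, k, l}" "distinct (a # b # C)" for a b C
    proof -
      have "{i, j, k, l} \<subseteq> {1..4}" using ijkl(1-4) by blast
      then have "a \<in> {1..4}" "b \<in> {1..4}" "set C \<subseteq> {1..4}" using that(1) by (simp_all only: list.set) blast+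
      from iff[OF this that(2)] show ?thesis by (simp add: vanishing_def to_ci_def)
    qed
    have "ci_axioms (\<lambda>t. to_ci t \<in> L) i j k l \<longleftrightarrow> ci_axioms (vanishing r) i j k l"
      unfolding ci_axioms_def using ijkl(5) by (simp add: eq)
    then show "ci_axioms (\<lambda>t. to_ci t \<in> L) i j k l"
      using ci_axioms_vanishing[OF r ijkl] by blast
  qed
  then have "\<exists>ts\<in>set (exceptional_classes @ prime_classes).
      \<exists>(i, j, k, l)\<in>set label_orders. matches (\<lambda>t. to_ci t \<in> L) i j k l ts"
    by (rule classification) (simp_all add: to_ci_def ci_def insert_commute)
  then obtain ts i j k l where ts: "ts \<in> set (exceptional_classes @ prime_classes)"
    and order: "(i, j, k, l) \<in> set label_orders" and matches: "matches (\<lambda>t. to_ci t \<in> L) i j k l ts"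
    by blast
  have "set ts \<subseteq> set (couples 1 2 3 4)" using class_couples ts by blast
  from that[OF permutation_of_permutes[OF order] ts relabel_of_matches[OF L order this matches]]
  show ?thesis .
qed

lemma exceptional_relations:
  "{L15, L24, L28, L37} = (\<lambda>ts. to_ci ` set ts) ` set exceptional_classes"
  by (simp only: exceptional_classes_def L15_def L24_def L28_def L37_def to_ci_def
      list.set image_insert image_empty prod.case)

lemma ci_equivalent_relabel: "ci_equivalent 4 L L' \<longleftrightarrow> (\<exists>\<pi>. \<pi> permutes {1..4} \<and> L' = relabel \<pi> L)"
  by (simp add: ci_equivalent_def relabel_def)

theorem proposition4p1:
  fixes L :: "ci_couple set"
  assumes "ci_relation 4 L"
    and "representable 4 L"
  shows "primeideal (ci_ideal 4 L) (corr_ring 4) \<longleftrightarrow>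
         \<not> (ci_equivalent 4 L L15 \<or> ci_equivalent 4 L L24 \<or>
            ci_equivalent 4 L L28 \<or> ci_equivalent 4 L L37)"
proof -
  have L: "L \<subseteq> ci_couples 4"
    using assms(1) by (simp add: ci_relation_def)
  have "\<not> prime_on_carrier (ideal_of (gens L))" if equiv: "ci_equivalent 4 L L'" "L' \<in> {L15, L24, L28, L37}" for L'
  proof
    assume prime: "prime_on_carrier (ideal_of (gens L))"
    obtain \<pi> where \<pi>: "\<pi> permutes {1..4}" "L' = relabel \<pi> L"
      using equiv(1) by (auto simp: ci_equivalent_relabel)
    obtain ts where ts: "ts \<in> set exceptional_classes" "L' = to_ci ` set ts"
      using equiv(2) unfolding exceptional_relations by blast
    have "relabel (inv_into UNIV \<pi>) L' = L"
      unfolding \<pi>(2) by (rule relabel_inverse[OF \<pi>(1)])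
    then have "prime_on_carrier (ideal_of (gens L'))"
      using prime_on_carrier_relabel[OF permutes_inv[OF \<pi>(1)], of L'] prime by simp
    moreover have "gens L' = minors_of ts"
      unfolding ts(2) by (rule class_wellformed) (use ts(1) in simp)
    ultimately show False
      using exceptional_classes_not_prime ts(1) by metis
  qed
  moreover have "prime_on_carrier (ideal_of (gens L))" if not_equiv: "\<And>L'. L' \<in> {L15, L24, L28, L37} \<Longrightarrow> \<not> ci_equivalent 4 L L'"
  proof -
    obtain \<pi> ts where \<pi>: "\<pi> permutes {1..4}" and ts: "ts \<in> set (exceptional_classes @ prime_classes)"
      and L_ts: "L = relabel \<pi> (to_ci ` set ts)"
      by (rule representable_classification[OF L assms(2)])
    have inv: "relabel (inv_into UNIV \<pi>) L = to_ci ` set ts"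
      unfolding L_ts by (rule relabel_inverse[OF \<pi>])
    have "ci_equivalent 4 L (to_ci ` set ts)"
      unfolding ci_equivalent_relabel using inv permutes_inv[OF \<pi>] by metis
    then have "ts \<notin> set exceptional_classes"
      using not_equiv unfolding exceptional_relations by blast
    then have "ts \<in> set prime_classes" using ts by simp
    then have "prime_id (ideal_of (minors_of ts))" using prime_classes_prime by blast
    then have "prime_on_carrier (ideal_of (gens (relabel (inv_into UNIV \<pi>) L)))"
      unfolding inv class_wellformed[OF ts] by (rule prime_on_carrierI)
    then show ?thesis by (rule prime_on_carrier_relabel[OF permutes_inv[OF \<pi>]])
  qed
  ultimately show ?thesis
    unfolding primeideal_ci_ideal_iff[OF L] by blast
qed

end
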